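(* Let $q_1,q_2$ be real-valued locally summable potentials on $[\ell,\infty)$ such that the corresponding minimal symmetric operators $\dot A_1,\dot A_2$ have deficiency indices $(1,1)$, with Weyl–Titchmarsh functions $m_{\infty,1},m_{\infty,2}$ and associated functions $m_{\alpha,1},m_{\alpha,2}$. Let $\alpha_1,\alpha_2\in\mathbb R$, and let $\Theta_1=\Theta_{\tan\alpha_1,i}$ (built on $\dot A_1$) and $\Theta_2=\Theta_{\tan\alpha_2,i}$ (built on $\dot A_2$) be the Schrödinger L-systems realizing $-m_{\alpha_1,1}$ and $-m_{\alpha_2,2}$ respectively. If $m_{\infty,1}(z)=m_{\infty,2}(z)$ for all $z\in\mathbb C\setminus\mathbb R$ and $V_{\Theta_1}(z)=V_{\Theta_2}(z)$ for all $z\in\mathbb C\setminus\mathbb R$, then $\Theta_1=\Theta_2$.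
   Context: Setting. Let $\ell\ge0$; for a real-valued locally summable potential $q$ on $[\ell,\infty)$ put $l_q(y)=-y''+q(x)y$, and let $\dot A_q$ be the minimal symmetric operator $\dot A_qy=l_q(y)$ with $y(\ell)=y'(\ell)=0$ in $L^2[\ell,\infty)$, assumed to have deficiency indices $(1,1)$. Let $\mathcal H_+=\mathrm{dom}(\dot A_q^* )$ with inner product $(y,z)_+=\int_\ell^\infty(y\bar z+l_q(y)\overline{l_q(z)})\,dx$ and $\mathcal H_+\subset L^2[\ell,\infty)\subset\mathcal H_-$ the associated rigged Hilbert space; $\delta(x-\ell),\delta'(x-\ell)\in\mathcal H_-$ act by $(y,\delta(x-\ell))=y(\ell)$, $(y,\delta'(x-\ell))=-y'(\ell)$. Weyl–Titchmarsh functions. For $z\in\mathbb C\setminus\mathbb R$ let $\varphi_1,\varphi_2$ solve $l_q(\varphi)=z\varphi$ with $\varphi_1(\ell)=0,\varphi_1'(\ell)=1$, $\varphi_2(\ell)=-1,\varphi_2'(\ell)=0$; $m_\infty(z)$ is the unique number such that $\varphi_2+m_\infty(z)\varphi_1\in L^2[\ell,\infty)$. For $\alpha\in\mathbb R$ put $m_\alpha(z)=\frac{\sin\alpha+m_\infty(z)\cos\alpha}{\cos\alpha-m_\infty(z)\sin\alpha}$. Schrödinger L-systems. For $h$ with $\operatorname{Im}h>0$ and $\mu\in\mathbb R\cup\{\infty\}$, the Schrödinger L-system $\Theta_{\mu,h}$ built on $\dot A_q$ consists of the rigged space above, the main operator $T_hy=l_q(y)$ on $\{y\in\mathcal H_+:y'(\ell)=hy(\ell)\}$,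 the state-space operator $\mathbb A_{\mu,h}y=l_q(y)-\frac1{\mu-h}[y'(\ell)-hy(\ell)][\mu\delta(x-\ell)+\delta'(x-\ell)]$ (for $\mu=\infty$: $l_q(y)-[y'(\ell)-hy(\ell)]\delta(x-\ell)$), and the channel operator $K_{\mu,h}c=c\,g_{\mu,h}$, $g_{\mu,h}=\frac{(\operatorname{Im}h)^{1/2}}{|\mu-h|}[\mu\delta(x-\ell)+\delta'(x-\ell)]$ (for $\mu=\infty$: $(\operatorname{Im}h)^{1/2}\delta(x-\ell)$). Its impedance function $V_\Theta(z)=K^*(\operatorname{Re}\mathbb A-zI)^{-1}K$ is known to equal $\frac{(m_\infty(z)+\mu)\operatorname{Im}h}{(\mu-\operatorname{Re}h)m_\infty(z)+\mu\operatorname{Re}h-|h|^2}$; in particular $V_{\Theta_{\tan\alpha,i}}=-m_\alpha$ (convention $\tan\alpha=\infty$ when $\cos\alpha=0$). It is known that $m_\infty$ is never identically $\pm i$ on the upper half-plane, and (Borg–Marchenko) that $m_{\infty}$ determines $q$ a.e. Two L-systems are equal if their rigged spaces $\mathcal H_+\subset L^2\subset\mathcal H_-$ coincide, their state-space operators coincide, and their channel operators coincide. *)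

theory Defs
  imports "HOL-Analysis.Analysis"
begin

text \<open>Functions on the half-line [l, infinity) are modelled as maps real => complex;
  only their values on {l..} matter (elements of H_+ are normalised to vanish on (-inf,l)).\<close>

definition locsum :: "real \<Rightarrow> (real \<Rightarrow> real) \<Rightarrow> bool" where
  "locsum l q \<longleftrightarrow> (\<forall>b. set_integrable lborel {l..b} q)"

definition sqint :: "real \<Rightarrow> (real \<Rightarrow> complex) \<Rightarrow> bool" where
  "sqint l f \<longleftrightarrow> set_borel_measurable lborel {l..} f
      \<and> set_integrable lborel {l..} (\<lambda>x. (cmod (f x))\<^sup>2)"

definition l2ip :: "real \<Rightarrow> (real \<Rightarrow> complex) \<Rightarrow> (real \<Rightarrow> complex) \<Rightarrow> complex" where
  "l2ip l f g = set_lebesgue_integral lborel {l..} (\<lambda>x. f x * cnj (g x))"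

definition dl :: "real \<Rightarrow> (real \<Rightarrow> complex) \<Rightarrow> real \<Rightarrow> complex" where
  "dl l y x = vector_derivative y (at x within {l..})"

text \<open>y and y1 are locally absolutely continuous on [l, infinity) with y' = y1, y1' = y2 (a.e.).\<close>
definition rep :: "real \<Rightarrow> (real \<Rightarrow> complex) \<Rightarrow> (real \<Rightarrow> complex) \<Rightarrow> (real \<Rightarrow> complex) \<Rightarrow> bool" where
  "rep l y y1 y2 \<longleftrightarrow> (\<forall>b. set_integrable lborel {l..b} y2)
     \<and> (\<forall>x\<ge>l. y1 x = y1 l + set_lebesgue_integral lborel {l..x} y2)
     \<and> (\<forall>x\<ge>l. y x = y l + set_lebesgue_integral lborel {l..x} y1)"

text \<open>A (a.e. determined) second derivative, and the differential expression l_q.\<close>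
definition sec :: "real \<Rightarrow> (real \<Rightarrow> complex) \<Rightarrow> real \<Rightarrow> complex" where
  "sec l y = (SOME y2. \<exists>y1. rep l y y1 y2)"

definition lq :: "(real \<Rightarrow> real) \<Rightarrow> real \<Rightarrow> (real \<Rightarrow> complex) \<Rightarrow> real \<Rightarrow> complex" where
  "lq q l y x = - sec l y x + complex_of_real (q x) * y x"

text \<open>H_+ = dom of the adjoint of the minimal operator (the maximal domain).\<close>
definition Hplus :: "(real \<Rightarrow> real) \<Rightarrow> real \<Rightarrow> (real \<Rightarrow> complex) set" where
  "Hplus q l = {y. (\<forall>x<l. y x = 0) \<and> (\<exists>y1 y2. rep l y y1 y2)
                  \<and> sqint l y \<and> sqint l (lq q l y)}"

definition plus_ip_q :: "(real \<Rightarrow> real) \<Rightarrow> real \<Rightarrow> (real \<Rightarrow> complex) \<Rightarrow> (real \<Rightarrow> complex) \<Rightarrow> complex" where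
  "plus_ip_q q l y z = l2ip l y z + l2ip l (lq q l y) (lq q l z)"

definition kerset :: "(real \<Rightarrow> real) \<Rightarrow> real \<Rightarrow> complex \<Rightarrow> (real \<Rightarrow> complex) set" where
  "kerset q l z = {y \<in> Hplus q l. AE x in lborel. x \<ge> l \<longrightarrow> lq q l y x = z * y x}"

definition dim_one :: "real \<Rightarrow> (real \<Rightarrow> complex) set \<Rightarrow> bool" where
  "dim_one l S \<longleftrightarrow> (\<exists>y0\<in>S. (\<exists>x\<ge>l. y0 x \<noteq> 0) \<and> (\<forall>y\<in>S. \<exists>c. \<forall>x\<ge>l. y x = c * y0 x))"

definition def11 :: "(real \<Rightarrow> real) \<Rightarrow> real \<Rightarrow> bool" where
  "def11 q l \<longleftrightarrow> dim_one l (kerset q l \<i>) \<and> dim_one l (kerset q l (- \<i>))"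

definition sol :: "(real \<Rightarrow> real) \<Rightarrow> real \<Rightarrow> complex \<Rightarrow> (real \<Rightarrow> complex) \<Rightarrow> bool" where
  "sol q l z phi \<longleftrightarrow> rep l phi (dl l phi) (\<lambda>t. (complex_of_real (q t) - z) * phi t)"

definition m_inf :: "(real \<Rightarrow> real) \<Rightarrow> real \<Rightarrow> complex \<Rightarrow> complex" where
  "m_inf q l z = (THE m. \<forall>phi1 phi2.
      sol q l z phi1 \<and> phi1 l = 0 \<and> dl l phi1 l = 1 \<and>
      sol q l z phi2 \<and> phi2 l = -1 \<and> dl l phi2 l = 0
      \<longrightarrow> sqint l (\<lambda>x. phi2 x + m * phi1 x))"

text \<open>L-systems with rigged space H_+ in L^2[base, infinity) in H_-.  An element f of H_-
  is represented by the functional w |-> (w, f) on H_+.  stateop Y y is (the functional of)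
  the image of y under the state-space operator; chan Y c is the image of c under K.\<close>
record lsys =
  base :: real
  hplus :: "(real \<Rightarrow> complex) set"
  plus_ip :: "(real \<Rightarrow> complex) \<Rightarrow> (real \<Rightarrow> complex) \<Rightarrow> complex"
  stateop :: "(real \<Rightarrow> complex) \<Rightarrow> (real \<Rightarrow> complex) \<Rightarrow> complex"
  chan :: "complex \<Rightarrow> (real \<Rightarrow> complex) \<Rightarrow> complex"

definition lsys_eq :: "lsys \<Rightarrow> lsys \<Rightarrow> bool" where
  "lsys_eq S T \<longleftrightarrow> base S = base T \<and> hplus S = hplus T
     \<and> (\<forall>y\<in>hplus S. \<forall>z\<in>hplus S. plus_ip S y z = plus_ip T y z)
     \<and> (\<forall>y\<in>hplus S. \<forall>w\<in>hplus S. stateop S y w = stateop T y w)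
     \<and> (\<forall>c. \<forall>w\<in>hplus S. chan S c w = chan T c w)"

text \<open>Impedance V(z) = K^* (Re A - z I)^{-1} K: with g = K 1, V(z) = (y, g) where y in H_+
  solves (Re A - z I) y = g in H_-;  (w, Re A y) = ((w, A y) + conj (y, A w))/2.\<close>
definition impedance :: "lsys \<Rightarrow> complex \<Rightarrow> complex" where
  "impedance S z = (THE v. \<exists>y\<in>hplus S.
      (\<forall>w\<in>hplus S. (stateop S y w + cnj (stateop S w y)) / 2 - cnj z * l2ip (base S) w y
                     = chan S 1 w)
      \<and> v = chan S 1 y)"

text \<open>mu = None encodes mu = infinity.\<close>
definition mu_of :: "real \<Rightarrow> real option" where
  "mu_of a = (if cos a = 0 then None else Some (tan a))"

text \<open>(w, mu delta + delta') = mu w(l) - w'(l)  (mu real).\<close>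
definition schr_stateop :: "(real \<Rightarrow> real) \<Rightarrow> real \<Rightarrow> real option \<Rightarrow> complex
     \<Rightarrow> (real \<Rightarrow> complex) \<Rightarrow> (real \<Rightarrow> complex) \<Rightarrow> complex" where
  "schr_stateop q l mu h y w = (case mu of
      None \<Rightarrow> l2ip l w (lq q l y) - cnj (dl l y l - h * y l) * w l
    | Some m \<Rightarrow> l2ip l w (lq q l y)
         - cnj ((dl l y l - h * y l) / (complex_of_real m - h))
           * (complex_of_real m * w l - dl l w l))"

definition schr_g :: "real \<Rightarrow> real option \<Rightarrow> complex \<Rightarrow> (real \<Rightarrow> complex) \<Rightarrow> complex" where
  "schr_g l mu h w = (case mu of
      None \<Rightarrow> complex_of_real (sqrt (Im h)) * w l
    | Some m \<Rightarrow> complex_of_real (sqrt (Im h) / cmod (complex_of_real m - h))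
                 * (complex_of_real m * w l - dl l w l))"

definition schr_lsys :: "(real \<Rightarrow> real) \<Rightarrow> real \<Rightarrow> real option \<Rightarrow> complex \<Rightarrow> lsys" where
  "schr_lsys q l mu h =
     \<lparr> base = l, hplus = Hplus q l, plus_ip = plus_ip_q q l,
       stateop = schr_stateop q l mu h,
       chan = (\<lambda>c w. cnj c * schr_g l mu h w) \<rparr>"

end

theory Submission
  imports Defs "HOL-Complex_Analysis.Complex_Analysis"
begin

text \<open>By limit-point theory, the impedance of the system with parameter \<open>\<mu>\<close> is
  \<open>(m + \<mu>) / (\<mu> m - 1)\<close> with \<open>m = m_\<infinity>(z)\<close>, which determines \<open>\<mu>\<close> as soon as
  \<open>m\<^sup>2 \<noteq> -1\<close>. It remains to recover the potential from \<open>m_\<infinity>\<close>, for which we use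
  Bennewitz' proof of the Borg-Marchenko theorem. Let \<open>\<phi>\<^sub>j\<close>, \<open>\<theta>\<^sub>j\<close> be the solutions with
  Cauchy data \<open>(0, 1)\<close> and \<open>(-1, 0)\<close> for \<open>q\<^sub>j\<close>, and \<open>\<psi>\<^sub>j = \<theta>\<^sub>j + m \<phi>\<^sub>j\<close>. At a fixed point
  \<open>\<theta>\<^sub>1 \<phi>\<^sub>2 - \<phi>\<^sub>1 \<theta>\<^sub>2 = \<psi>\<^sub>1 \<phi>\<^sub>2 - \<phi>\<^sub>1 \<psi>\<^sub>2\<close> is entire in \<open>z\<close> of order at most 1/2. On the
  imaginary axis it tends to 0, because the diagonal Green functions \<open>\<psi>\<^sub>j \<phi>\<^sub>j\<close> do and
  \<open>\<phi>\<^sub>2 / \<phi>\<^sub>1\<close> tends to 1. Hence it vanishes by Phragmen-Lindelof and Liouville. Differentiating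
  \<open>\<theta>\<^sub>1 \<phi>\<^sub>2 = \<phi>\<^sub>1 \<theta>\<^sub>2\<close> in \<open>x\<close> gives \<open>\<phi>\<^sub>1\<^sup>2 = \<phi>\<^sub>2\<^sup>2\<close>, and two more derivatives give
  \<open>q\<^sub>1 = q\<^sub>2\<close> almost everywhere.\<close>

section \<open>Locally absolutely continuous functions\<close>

text \<open>The potentials are only locally summable, so second derivatives exist only almost
  everywhere and \<open>lq\<close> is determined only up to null sets. All equations are therefore
  used in integrated form: \<open>ac\<close> pairs a function with one admissible derivative. This
  is also why recovering the potential almost everywhere is enough: it enters an L-system only
  through integrals and square integrability. Deficiency indices (1,1) speak of \<i> and -\<i> only.
  They are carried to every nonreal z by showing that two independent square integrable solutions at
  one point would give two at \<i>. This makes the Weyl coefficient unique and lets boundary terms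
  at infinity vanish. The case m^2 = -1 has to be avoided because the impedance is then the same for
  every parameter. That it cannot hold throughout is derived from the same asymptotics as the
  Borg-Marchenko argument. No expansion of m is needed for these: signs of imaginary parts already
  force the diagonal Green function to zero along the imaginary axis.\<close>

definition ac :: "real \<Rightarrow> (real \<Rightarrow> 'a) \<Rightarrow> (real \<Rightarrow> 'a::{euclidean_space,real_normed_field}) \<Rightarrow> bool" where
  "ac l f g \<longleftrightarrow> (\<forall>b. set_integrable lborel {l..b} g)
     \<and> (\<forall>x\<ge>l. f x = f l + (LINT t:{l..x}|lborel. g t))"

lemma set_integral_split:
  fixes g :: "real \<Rightarrow> 'a::euclidean_space"
  assumes g: "set_integrable lborel {a..c} g" and ab: "a \<le> b" "b \<le> c"
  shows "(LINT x:{a..c}|lborel. g x) = (LINT x:{a..b}|lborel. g x) + (LINT x:{b..c}|lborel. g x)"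
proof -
  have 1: "set_integrable lborel {a..b} g" "set_integrable lborel {b..c} g"
    by (rule set_integrable_subset[OF g]; use ab in auto)+
  show ?thesis
    using Henstock_Kurzweil_Integration.integral_combine[of a b c g]
      set_borel_integral_eq_integral[OF g] set_borel_integral_eq_integral[OF 1(1)]
      set_borel_integral_eq_integral[OF 1(2)] ab by simp
qed

lemma continuous_on_atLeast:
  fixes f :: "real \<Rightarrow> 'a::topological_space"
  assumes "\<And>b. continuous_on {l..b} f"
  shows "continuous_on {l..} f"
  unfolding continuous_on_eq_continuous_within
proof
  fix x assume x: "x \<in> {l..}"
  have "continuous (at x within {l..x+1}) f"
    using assms[of "x+1"] x by (auto simp: continuous_on_eq_continuous_within)
  moreover have "at x within {l..x+1} = at x within {l..}"
    by (rule at_within_nhd[of x "{..<x+1}"]) auto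
  ultimately show "continuous (at x within {l..}) f" by simp
qed

lemma set_integrable_continuous_mult:
  fixes f g :: "real \<Rightarrow> 'a::{euclidean_space,real_normed_field}"
  assumes f: "continuous_on {a..b} f" and g: "set_integrable lborel {a..b} g"
  shows "set_integrable lborel {a..b} (\<lambda>t. f t * g t)"
proof -
  have "compact (f ` {a..b})" using f by (intro compact_continuous_image) auto
  then obtain B where B: "\<And>x. x \<in> {a..b} \<Longrightarrow> norm (f x) \<le> B"
    by (meson bounded_iff compact_imp_bounded imageI)
  have mf: "(\<lambda>x. indicat_real {a..b} x *\<^sub>R f x) \<in> borel_measurable borel"
    using set_measurable_continuous_on[of "{a..b}" f] f
    by (auto simp: set_borel_measurable_def)
  have mg: "integrable lborel (\<lambda>x. indicat_real {a..b} x *\<^sub>R g x)"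
    using g by (simp add: set_integrable_def)
  have "integrable lborel (\<lambda>x. (indicat_real {a..b} x *\<^sub>R f x) * (indicat_real {a..b} x *\<^sub>R g x))"
  proof (rule Bochner_Integration.integrable_bound)
    show "integrable lborel (\<lambda>x. B * norm (indicat_real {a..b} x *\<^sub>R g x))"
      using mg by (intro integrable_mult_right integrable_norm)
    show "AE x in lborel. norm (indicat_real {a..b} x *\<^sub>R f x * indicat_real {a..b} x *\<^sub>R g x)
         \<le> norm (B * norm (indicat_real {a..b} x *\<^sub>R g x))"
    proof (rule AE_I2)
      fix x
      show "norm (indicat_real {a..b} x *\<^sub>R f x * indicat_real {a..b} x *\<^sub>R g x)
         \<le> norm (B * norm (indicat_real {a..b} x *\<^sub>R g x))"
      proof (cases "x \<in> {a..b}")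
        case True
        have "norm (f x) * norm (g x) \<le> \<bar>B\<bar> * norm (g x)"
          using B[OF True] by (intro mult_right_mono) auto
        then show ?thesis using True by (simp add: norm_mult abs_mult)
      qed auto
    qed
  qed (use mf mg in measurable)
  then show ?thesis
    unfolding set_integrable_def
    by (rule Bochner_Integration.integrable_cong[THEN iffD1, rotated 2]) (auto split: split_indicator)
qed

lemma acI:
  assumes "\<And>b. set_integrable lborel {l..b} g"
    and "\<And>x. x \<ge> l \<Longrightarrow> f x = f l + (LINT t:{l..x}|lborel. g t)"
  shows "ac l f g"
  using assms unfolding ac_def by blast

lemma ac_int: "ac l f g \<Longrightarrow> set_integrable lborel {l..b} g"
  unfolding ac_def by blast

lemma ac_eq: "ac l f g \<Longrightarrow> x \<ge> l \<Longrightarrow> f x = f l + (LINT t:{l..x}|lborel. g t)"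
  unfolding ac_def by blast

lemma ac_integrable:
  assumes "ac l f g" "l \<le> a" shows "set_integrable lborel {a..b} g"
  by (rule set_integrable_subset[of _ "{l..b}"]) (use assms ac_int in auto)

lemma ac_diff:
  assumes "ac l f g" "l \<le> a" "a \<le> b"
  shows "f b - f a = (LINT t:{a..b}|lborel. g t)"
proof -
  have "f b = f l + (LINT t:{l..b}|lborel. g t)" "f a = f l + (LINT t:{l..a}|lborel. g t)"
    using assms ac_eq order_trans by blast+
  then show ?thesis
    using set_integral_split[OF ac_integrable[OF assms(1) order_refl], of a b] assms by simp
qed

lemma ac_continuous:
  assumes "ac l f g" shows "continuous_on {l..} f"
proof (rule continuous_on_atLeast)
  fix b
  have g: "set_integrable lborel {l..x} g" for x using assms by (rule ac_int)
  have "continuous_on {l..b} (\<lambda>x. f l + integral {l..x} g)"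
    by (intro continuous_on_add continuous_on_const indefinite_integral_continuous_1
        set_borel_integral_eq_integral(1)[OF g])
  then show "continuous_on {l..b} f"
    by (rule continuous_on_eq)
      (metis ac_eq[OF assms] set_borel_integral_eq_integral(2)[OF g] atLeastAtMost_iff)
qed

lemma ac_continuous_Icc: "ac l f g \<Longrightarrow> l \<le> a \<Longrightarrow> continuous_on {a..b} f"
  using ac_continuous continuous_on_subset by fastforce

lemma ac_const [simp]: "ac l (\<lambda>x. c) (\<lambda>x. 0)"
  by (simp add: ac_def set_integrable_def)

lemma ac_add:
  assumes f: "ac l f f'" and g: "ac l g g'" shows "ac l (\<lambda>x. f x + g x) (\<lambda>x. f' x + g' x)"
proof (rule acI)
  fix x assume "x \<ge> l"
  then show "f x + g x = f l + g l + (LINT t:{l..x}|lborel. f' t + g' t)"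
    using ac_eq[OF f, of x] ac_eq[OF g, of x] by (simp add: set_integral_add(2)[OF ac_int[OF f] ac_int[OF g]])
qed (intro set_integral_add ac_int[OF f] ac_int[OF g])

lemma ac_cmult:
  assumes f: "ac l f f'" shows "ac l (\<lambda>x. c * f x) (\<lambda>x. c * f' x)"
proof (rule acI)
  fix x assume "x \<ge> l"
  then show "c * f x = c * f l + (LINT t:{l..x}|lborel. c * f' t)"
    using ac_eq[OF f, of x] by (simp add: algebra_simps)
qed (use ac_int[OF f] in auto)

lemma ac_diff_fun: "ac l f f' \<Longrightarrow> ac l g g' \<Longrightarrow> ac l (\<lambda>x. f x - g x) (\<lambda>x. f' x - g' x)"
  using ac_add[of l f f' "\<lambda>x. (-1) * g x" "\<lambda>x. (-1) * g' x"] ac_cmult[of l g g' "-1"] by simp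

lemma ac_cong:
  assumes "ac l f f'" "\<And>x. x \<ge> l \<Longrightarrow> f x = g x" "\<And>x. x \<ge> l \<Longrightarrow> f' x = g' x"
  shows "ac l g g'"
proof -
  have "set_integrable lborel {l..b} g' = set_integrable lborel {l..b} f'" for b
    by (rule set_integrable_cong) (use assms(3) in auto)
  moreover have "(LINT t:{l..b}|lborel. g' t) = (LINT t:{l..b}|lborel. f' t)" for b
    by (rule set_lebesgue_integral_cong) (use assms(3) in auto)
  ultimately show ?thesis
    using ac_int[OF assms(1)] ac_eq[OF assms(1)] assms(2) by (intro acI) (metis order_refl)+
qed

lemma ac_primitive:
  assumes "\<And>b. set_integrable lborel {l..b} g"
  shows "ac l (\<lambda>x. c + (LINT t:{l..x}|lborel. g t)) g"
proof -
  have "(LINT t:{l}|lborel. g t) = 0"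
    using set_borel_integral_eq_integral(2)[OF assms[of l]] by simp
  then show ?thesis using assms by (intro acI) auto
qed

lemma set_integrable_cnj:
  "set_integrable M S f \<Longrightarrow> set_integrable M S (\<lambda>x. cnj (f x))"
  unfolding set_integrable_def
  by (drule integrable_cnj) simp

lemma set_integral_cnj:
  "(LINT t:S|M. cnj (f t)) = cnj (LINT t:S|M. f t)"
  unfolding set_lebesgue_integral_def
  using Bochner_Integration.integral_cnj[of M "\<lambda>t. indicat_real S t *\<^sub>R f t"] by simp

lemma ac_cnj:
  assumes "ac l f f'" shows "ac l (\<lambda>x. cnj (f x)) (\<lambda>x. cnj (f' x))"
proof (rule acI)
  fix x assume "x \<ge> l"
  then show "cnj (f x) = cnj (f l) + (LINT t:{l..x}|lborel. cnj (f' t))"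
    using ac_eq[OF assms, of x] by (simp add: set_integral_cnj)
qed (use ac_int[OF assms] set_integrable_cnj in auto)

lemma ac_C1:
  fixes f :: "real \<Rightarrow> 'a::{euclidean_space,real_normed_field}"
  assumes "\<And>x. x \<ge> l \<Longrightarrow> (f has_vector_derivative f' x) (at x within {l..})"
    and "continuous_on {l..} f'"
  shows "ac l f f'"
proof -
  have i: "set_integrable lborel {l..b} f'" for b
    by (rule borel_integrable_atLeastAtMost') (use assms(2) continuous_on_subset in fastforce)
  have "(f' has_integral f x - f l) {l..x}" if "x \<ge> l" for x
    by (rule fundamental_theorem_of_calculus[OF that])
      (use assms(1) has_vector_derivative_within_subset in fastforce)
  then show ?thesis
    by (intro acI i) (metis set_borel_integral_eq_integral(2)[OF i] integral_unique add_diff_eq add_diff_cancel_left')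
qed

text \<open>The defect \<open>H a b\<close> of the formula is additive over adjacent intervals, and
  where \<open>f\<close> and \<open>g\<close> oscillate by at most \<open>e\<close> it is at most
  \<open>e\<close> times the integral of \<open>k\<close>. Bolzano's principle glues these local
  bounds, and \<open>e\<close> is arbitrary. This gives a product rule without pointwise
  differentiability.\<close>

lemma ac_mult:
  fixes f g :: "real \<Rightarrow> 'a::{euclidean_space,real_normed_field}"
  assumes f: "ac l f f'" and g: "ac l g g'"
  shows "ac l (\<lambda>x. f x * g x) (\<lambda>x. f' x * g x + f x * g' x)"
proof -
  have cf: "continuous_on {l..} f" and cg: "continuous_on {l..} g"
    using f g ac_continuous by blast+
  have cfi: "continuous_on {a..b} f" and cgi: "continuous_on {a..b} g" if "l \<le> a" for a b
    using f g that ac_continuous_Icc by blast+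
  have i1: "set_integrable lborel {a..b} (\<lambda>x. f' x * g x)" if "l \<le> a" for a b
    using set_integrable_continuous_mult[OF cgi[OF that] ac_integrable[OF f that]]
    by (simp add: mult.commute)
  have i2: "set_integrable lborel {a..b} (\<lambda>x. f x * g' x)" if "l \<le> a" for a b
    by (rule set_integrable_continuous_mult[OF cfi[OF that] ac_integrable[OF g that]])
  define h where "h = (\<lambda>x. f' x * g x + f x * g' x)"
  have ih: "set_integrable lborel {a..b} h" if "l \<le> a" for a b
    unfolding h_def using i1 i2 that by (intro set_integral_add) auto
  define k where "k = (\<lambda>x. norm (f' x) + norm (g' x))"
  have ik: "set_integrable lborel {a..b} k" if "l \<le> a" for a b
    unfolding k_def using ac_integrable[OF f that] ac_integrable[OF g that]
    by (intro set_integral_add set_integrable_norm)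
  define H where "H = (\<lambda>a b. f b * g b - f a * g a - (LINT t:{a..b}|lborel. h t))"
  have Hsum: "H a c = H a b + H b c" if "l \<le> a" "a \<le> b" "b \<le> c" for a b c
    unfolding H_def using set_integral_split[OF ih[OF that(1)], of b c] that by simp
  have "f x * g x = f l * g l + (LINT t:{l..x}|lborel. h t)" if x: "x \<ge> l" for x
  proof -
    have bd: "norm (H l x) \<le> e * (LINT t:{l..x}|lborel. k t)" if e: "e > 0" for e
    proof -
      \<comment> \<open>The local intervals around a point may begin left of \<open>l\<close>, where
        nothing is known; the guard makes the claim vacuous there.\<close>
      define P where "P = (\<lambda>a b. l \<le> a \<longrightarrow> norm (H a b) \<le> e * (LINT t:{a..b}|lborel. k t))"
      have "P l x"
        using x
      proof (induction rule: Bolzano)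
        case (trans a b c)
        show ?case unfolding P_def
        proof
          assume la: "l \<le> a"
          have "norm (H a c) \<le> norm (H a b) + norm (H b c)"
            using Hsum[OF la trans(3,4)] norm_triangle_ineq by metis
          also have "\<dots> \<le> e * (LINT t:{a..b}|lborel. k t) + e * (LINT t:{b..c}|lborel. k t)"
            using trans la unfolding P_def by (intro add_mono) auto
          also have "\<dots> = e * (LINT t:{a..c}|lborel. k t)"
            using set_integral_split[OF ik[OF la] trans(3,4)] by (simp add: algebra_simps)
          finally show "norm (H a c) \<le> e * (LINT t:{a..c}|lborel. k t)" .
        qed
      next
        case (local y)
        have "\<exists>d>0. \<forall>u\<in>{l..}. dist u y < d \<longrightarrow> dist (f u) (f y) < e/2"
          using cf local e unfolding continuous_on_iff by (metis atLeast_iff half_gt_zero)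
        then obtain d1 where d1: "d1 > 0" "\<And>u. u \<ge> l \<Longrightarrow> dist u y < d1 \<Longrightarrow> dist (f u) (f y) < e/2"
          by auto
        have "\<exists>d>0. \<forall>u\<in>{l..}. dist u y < d \<longrightarrow> dist (g u) (g y) < e/2"
          using cg local e unfolding continuous_on_iff by (metis atLeast_iff half_gt_zero)
        then obtain d2 where d2: "d2 > 0" "\<And>u. u \<ge> l \<Longrightarrow> dist u y < d2 \<Longrightarrow> dist (g u) (g y) < e/2"
          by auto
        have "P a b" if ab: "a \<le> y" "y \<le> b" "b - a < min d1 d2" for a b
          unfolding P_def
        proof
          assume la: "l \<le> a"
          have osc: "norm (g b - g u) \<le> e" "norm (f a - f u) \<le> e" if "u \<in> {a..b}" for u
          proof -
            have "dist (g b) (g y) < e/2" "dist (g u) (g y) < e/2"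
              by (intro d2; use that la ab in \<open>auto simp: dist_real_def\<close>)+
            then have "dist (g b) (g u) < e"
              using dist_triangle2[of "g b" "g u" "g y"] by linarith
            then show "norm (g b - g u) \<le> e" by (simp add: dist_norm)
            have "dist (f a) (f y) < e/2" "dist (f u) (f y) < e/2"
              by (intro d1; use that la ab in \<open>auto simp: dist_real_def\<close>)+
            then have "dist (f a) (f u) < e"
              using dist_triangle2[of "f a" "f u" "f y"] by linarith
            then show "norm (f a - f u) \<le> e" by (simp add: dist_norm)
          qed
          have iF: "set_integrable lborel {a..b} (\<lambda>u. g b * f' u)"
            and iG: "set_integrable lborel {a..b} (\<lambda>u. f a * g' u)"
            using ac_integrable[OF f la] ac_integrable[OF g la] by auto
          \<comment> \<open>Freezing \<open>g\<close> at the right end and \<open>f\<close> at the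
            left end makes the splitting exact, so that only the oscillation over {a..b} enters the
            error.\<close>
          have "f b * g b - f a * g a = (f b - f a) * g b + f a * (g b - g a)"
            by (simp add: algebra_simps)
          also have "\<dots> = (LINT u:{a..b}|lborel. g b * f' u) + (LINT u:{a..b}|lborel. f a * g' u)"
            using ac_diff[OF f la, of b] ac_diff[OF g la, of b] ab by (simp add: mult.commute)
          also have "\<dots> = (LINT u:{a..b}|lborel. g b * f' u + f a * g' u)"
            using iF iG by (simp add: set_integral_add)
          finally have "H a b = (LINT u:{a..b}|lborel. (g b * f' u + f a * g' u) - h u)"
            unfolding H_def using iF iG ih[OF la] by (simp add: set_integral_diff set_integral_add)
          also have "norm \<dots> \<le> (LINT u:{a..b}|lborel. norm ((g b * f' u + f a * g' u) - h u))"
            using iF iG ih[OF la] by (intro set_integral_norm_bound set_integral_diff set_integral_add)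
          also have "\<dots> \<le> (LINT u:{a..b}|lborel. e * k u)"
          proof (rule set_integral_mono)
            show "set_integrable lborel {a..b} (\<lambda>u. norm ((g b * f' u + f a * g' u) - h u))"
              using iF iG ih[OF la] by (intro set_integrable_norm set_integral_diff set_integral_add)
            show "set_integrable lborel {a..b} (\<lambda>u. e * k u)" using ik[OF la] by simp
            fix u assume u: "u \<in> {a..b}"
            have "(g b * f' u + f a * g' u) - h u = (g b - g u) * f' u + (f a - f u) * g' u"
              by (simp add: h_def algebra_simps)
            also have "norm \<dots> \<le> norm (g b - g u) * norm (f' u) + norm (f a - f u) * norm (g' u)"
              by (metis norm_mult norm_triangle_ineq)
            also have "\<dots> \<le> e * norm (f' u) + e * norm (g' u)"
              by (intro add_mono mult_right_mono osc u) auto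
            finally show "norm ((g b * f' u + f a * g' u) - h u) \<le> e * k u"
              by (simp add: k_def algebra_simps)
          qed
          also have "\<dots> = e * (LINT u:{a..b}|lborel. k u)" by simp
          finally show "norm (H a b) \<le> e * (LINT u:{a..b}|lborel. k u)" .
        qed
        then show ?case using d1(1) d2(1) by (intro exI[of _ "min d1 d2"]) auto
      qed
      then show ?thesis by (simp add: P_def)
    qed
    define I where "I = (LINT t:{l..x}|lborel. k t)"
    have I: "I \<ge> 0" unfolding I_def set_lebesgue_integral_def
      by (intro integral_nonneg_AE AE_I2) (auto simp: k_def)
    have "norm (H l x) \<le> 0"
    proof (rule field_le_epsilon)
      fix e :: real assume e: "e > 0"
      have "norm (H l x) \<le> (e/(I+1)) * I" unfolding I_def by (rule bd) (use e I in \<open>auto simp: I_def[symmetric]\<close>)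
      also have "\<dots> \<le> e" using e I by (simp add: field_simps)
      finally show "norm (H l x) \<le> 0 + e" by simp
    qed
    then show ?thesis by (simp add: H_def algebra_simps)
  qed
  then show ?thesis using ih[OF order_refl] unfolding h_def by (intro acI)
qed

text \<open>Half-lines form an intersection-stable generator of the Borel sets, so vanishing
  integrals spread from them to every Borel set, and a density with all integrals zero vanishes
  almost everywhere. The total integral, needed for complements, comes from exhausting the line by
  half-lines.\<close>

lemma AE_zero_if_integrals_zero:
  fixes h :: "real \<Rightarrow> 'a::euclidean_space"
  assumes h: "integrable lborel h" and z: "\<And>x. (LINT t:{..x}|lborel. h t) = 0"
  shows "AE x in lborel. h x = 0"
proof (rule sigma_finite_measure.density_zero[OF sigma_finite_lborel h])
  have z2: "(LINT t|lborel. h t) = 0"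
  proof -
    have "(\<lambda>n. LINT t:{..real n}|lborel. h t) \<longlonglongrightarrow> (LINT t:(\<Union>n. {..real n})|lborel. h t)"
    proof (rule set_integral_cont_up)
      show "incseq (\<lambda>n. {..real n})" by (auto simp: incseq_def)
      show "set_integrable lborel (\<Union>n. {..real n}) h"
        unfolding set_integrable_def by (intro integrable_mult_indicator h) auto
    qed auto
    moreover have "(\<Union>n. {..real n}) = (UNIV::real set)"
      by (auto simp: real_arch_simple)
    ultimately have "(\<lambda>n::nat. 0) \<longlonglongrightarrow> (LINT t|lborel. h t)"
      by (simp add: z set_lebesgue_integral_def[of lborel UNIV])
    then show ?thesis using LIMSEQ_unique tendsto_const by blast
  qed
  fix A :: "real set" assume "A \<in> sets lborel"
  then have A: "A \<in> sigma_sets UNIV (range (\<lambda>a::real. {..a}))"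
    using arg_cong[OF borel_eq_atMost[where 'a=real], of sets] by simp
  have st: "Int_stable (range (\<lambda>a::real. {..a}))"
    by (auto simp: Int_stable_def)
  have sb: "S \<in> sigma_sets UNIV (range (\<lambda>a::real. {..a})) \<Longrightarrow> S \<in> sets borel" for S
    using arg_cong[OF borel_eq_atMost[where 'a=real], of sets] by simp
  show "(LINT t:A|lborel. h t) = 0"
    using st Pow_UNIV[THEN equalityD2, THEN subset_trans[OF subset_UNIV]] A
  proof (induction rule: sigma_sets_induct_disjoint)
    case (basic A) then show ?case using z by auto
  next
    case empty then show ?case by (simp add: set_lebesgue_integral_def)
  next
    case (compl A)
    have A: "A \<in> sets borel" using sb compl by auto
    have "(LINT t:UNIV|lborel. h t) = (LINT t:A|lborel. h t) + (LINT t:UNIV - A|lborel. h t)"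
      by (subst set_integral_Un[symmetric])
        (use A h in \<open>auto simp: set_integrable_def intro!: integrable_mult_indicator\<close>)
    then show ?case using compl z2 by (simp add: set_lebesgue_integral_def)
  next
    case (union A)
    have "(LINT t:(\<Union>i. A i)|lborel. h t) = (\<Sum>i. LINT t:A i|lborel. h t)"
    proof (rule lebesgue_integral_countable_add)
      show *: "A i \<in> sets lborel" for i using sb union(2) by auto
      show "set_integrable lborel (\<Union>i. A i) h"
        unfolding set_integrable_def by (intro integrable_mult_indicator h) (use * in auto)
      show "\<And>i j. i \<noteq> j \<Longrightarrow> A i \<inter> A j = {}" using union(1) by (auto simp: disjoint_family_on_def)
    qed
    then show ?case using union by simp
  qed
qed

lemma ac_AE_unique:
  assumes "ac l f f1" "ac l f f2"
  shows "AE x in lborel. x \<ge> l \<longrightarrow> f1 x = f2 x"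
proof -
  have *: "AE x in lborel. x \<in> {l..real n} \<longrightarrow> f1 x = f2 x" for n
  proof -
    define h where "h = (\<lambda>x. indicat_real {l..real n} x *\<^sub>R (f1 x - f2 x))"
    have d: "set_integrable lborel {l..x} (\<lambda>x. f1 x - f2 x)" for x
      using assms by (intro set_integral_diff ac_int)
    have "(LINT t:{l..y}|lborel. f1 t - f2 t) = 0" if "y \<ge> l" for y
      using assms ac_diff[OF assms(1) _ that] ac_diff[OF assms(2) _ that]
      by (subst set_integral_diff) (auto intro: ac_int)
    then have dz: "(LINT t:{l..y}|lborel. f1 t - f2 t) = 0" for y
      by (cases "y \<ge> l") (auto simp: set_lebesgue_integral_def)
    have "AE x in lborel. h x = 0"
    proof (rule AE_zero_if_integrals_zero)
      show "integrable lborel h" using d[of n] by (simp add: h_def set_integrable_def)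
      fix x
      have "(LINT t:{..x}|lborel. h t) = (LINT t:{l..min x n}|lborel. f1 t - f2 t)"
        unfolding set_lebesgue_integral_def h_def
        by (rule Bochner_Integration.integral_cong) (auto split: split_indicator)
      then show "(LINT t:{..x}|lborel. h t) = 0" using dz by simp
    qed
    then show ?thesis by eventually_elim (auto simp: h_def)
  qed
  have "AE x in lborel. \<forall>n. x \<in> {l..real n} \<longrightarrow> f1 x = f2 x"
    using * unfolding AE_all_countable by blast
  then show ?thesis
    by eventually_elim (meson atLeastAtMost_iff real_arch_simple)
qed

lemma ac_has_vector_derivative:
  assumes f: "ac l f f'" and c: "continuous_on {l..} f'" and x: "x \<ge> l"
  shows "(f has_vector_derivative f' x) (at x within {l..})"
proof -
  have i: "set_integrable lborel {l..y} f'" for y using f by (rule ac_int)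
  have "((\<lambda>u. f l + integral {l..u} f') has_vector_derivative f' x) (at x within {l..x+1})"
    using has_vector_derivative_add[OF has_vector_derivative_const
        integral_has_vector_derivative[OF continuous_on_subset[OF c], of l "x+1" x]] x by auto
  then have "(f has_vector_derivative f' x) (at x within {l..x+1})"
  proof (rule has_vector_derivative_transform[rotated 2])
    fix u assume "u \<in> {l..x+1}"
    then show "f u = f l + integral {l..u} f'"
      using ac_eq[OF f, of u] set_borel_integral_eq_integral(2)[OF i] by (metis atLeastAtMost_iff)
  qed (use x in auto)
  moreover have "at x within {l..x+1} = at x within {l..}"
    by (rule at_within_nhd[of x "{..<x+1}"]) auto
  ultimately show ?thesis by simp
qed

lemma atLeast_not_bot: "(x::real) \<ge> l \<Longrightarrow> at x within {l..} \<noteq> bot"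
proof -
  assume "x \<ge> l"
  have "at x within {x..x+1} \<noteq> bot" by (simp add: trivial_limit_within islimpt_Icc)
  moreover have "at x within {x..x+1} \<le> at x within {l..}" using \<open>x \<ge> l\<close> by (intro at_le) auto
  ultimately show ?thesis by (metis bot.extremum_uniqueI)
qed

lemma ac_dl:
  assumes f: "ac l f f'" and c: "continuous_on {l..} f'" and x: "x \<ge> l"
  shows "dl l f x = f' x"
  unfolding dl_def
  by (rule vector_derivative_within[OF atLeast_not_bot[OF x] ac_has_vector_derivative[OF assms]])

section \<open>The initial value problem\<close>

lemma norm_set_integral_le:
  fixes f :: "real \<Rightarrow> 'a::euclidean_space"
  assumes "set_integrable M S f" "set_integrable M S g" "\<And>t. t \<in> S \<Longrightarrow> norm (f t) \<le> g t"
  shows "norm (LINT t:S|M. f t) \<le> (LINT t:S|M. g t)"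
  using set_integral_norm_bound[OF assms(1)] set_integral_mono[OF set_integrable_norm[OF assms(1)] assms(2,3)]
  by linarith

text \<open>The product form \<open>c n * k t\<close> of the bound gives summability of the norms
  both pointwise and under the integral, as termwise integration requires. A general
  \<open>k\<close> is allowed because the coefficient of the differential equation is integrable but
  perhaps unbounded.\<close>

lemma ac_suminf:
  fixes F f :: "nat \<Rightarrow> real \<Rightarrow> 'a::{euclidean_space,real_normed_field}"
  assumes ac: "\<And>n. ac l (F n) (f n)" and F0: "\<And>n. F n l = 0"
    and bound: "\<And>b. \<exists>c k. summable c \<and> set_integrable lborel {l..b} k
        \<and> (\<forall>n. \<forall>t\<in>{l..b}. norm (f n t) \<le> c n * (k t :: real))"
  shows "ac l (\<lambda>x. \<Sum>n. F n x) (\<lambda>x. \<Sum>n. f n x)"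
    and "x \<ge> l \<Longrightarrow> summable (\<lambda>n. F n x)"
proof -
  have *: "set_integrable lborel {l..x} (\<lambda>t. \<Sum>n. f n t)
        \<and> (\<lambda>n. LINT t:{l..x}|lborel. f n t) sums (LINT t:{l..x}|lborel. (\<Sum>n. f n t))" for x
  proof -
    obtain c k where c: "summable c" and k: "set_integrable lborel {l..x} k"
      and le: "\<And>n t. t \<in> {l..x} \<Longrightarrow> norm (f n t) \<le> c n * (k t :: real)"
      using bound[of x] by auto
    define g where "g = (\<lambda>n t. indicat_real {l..x} t *\<^sub>R f n t)"
    have gi: "integrable lborel (g n)" for n
      using ac_int[OF ac, of x n] by (simp add: g_def set_integrable_def)
    have "(LINT t|lborel. norm (g n t)) \<le> c n * (LINT t:{l..x}|lborel. k t)" for n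
    proof -
      have "(LINT t:{l..x}|lborel. norm (f n t)) \<le> (LINT t:{l..x}|lborel. c n * k t)"
        by (rule set_integral_mono) (use ac_int[OF ac, of x n] k le in \<open>auto intro: set_integrable_norm\<close>)
      moreover have "(LINT t|lborel. norm (g n t)) = (LINT t:{l..x}|lborel. norm (f n t))"
        by (simp add: g_def set_lebesgue_integral_def)
      ultimately show ?thesis by simp
    qed
    then have s1: "summable (\<lambda>n. LINT t|lborel. norm (g n t))"
      by (intro summable_comparison_test'[OF summable_mult2[OF c]]) auto
    have s2: "AE t in lborel. summable (\<lambda>n. norm (g n t))"
    proof (rule AE_I2)
      fix t show "summable (\<lambda>n. norm (g n t))"
      proof (cases "t \<in> {l..x}")
        case True
        show ?thesis
          by (rule summable_comparison_test'[OF summable_mult2[OF c, of "k t"]])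
            (use le[OF True] True in \<open>auto simp: g_def\<close>)
      qed (simp add: g_def)
    qed
    have eq: "(\<lambda>t. \<Sum>n. g n t) = (\<lambda>t. indicat_real {l..x} t *\<^sub>R (\<Sum>n. f n t))"
      by (auto simp: g_def split: split_indicator)
    have "integrable lborel (\<lambda>t. \<Sum>n. g n t)" by (rule integrable_suminf[OF gi s2 s1])
    moreover have "(\<lambda>n. integral\<^sup>L lborel (g n)) sums (LINT t|lborel. (\<Sum>n. g n t))"
      by (rule sums_integral[OF gi s2 s1])
    ultimately show ?thesis
      unfolding eq by (simp add: g_def set_integrable_def set_lebesgue_integral_def)
  qed
  have F: "F n x = (LINT t:{l..x}|lborel. f n t)" if "x \<ge> l" for n x
    using ac_eq[OF ac[of n] that] F0 by simp
  have S: "(\<lambda>n. F n x) sums (LINT t:{l..x}|lborel. (\<Sum>n. f n t))" if "x \<ge> l" for x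
    using * F[OF that] by simp
  show "ac l (\<lambda>x. \<Sum>n. F n x) (\<lambda>x. \<Sum>n. f n x)"
    using * S F0 by (intro acI) (auto simp: sums_iff)
  show "x \<ge> l \<Longrightarrow> summable (\<lambda>n. F n x)"
    using S by (auto simp: sums_iff)
qed

lemma ac_power:
  assumes "ac l f f'"
  shows "ac l (\<lambda>x. f x ^ Suc n) (\<lambda>x. of_nat (Suc n) * f x ^ n * f' x)"
proof (induction n)
  case (Suc n)
  show ?case
    by (rule ac_cong[OF ac_mult[OF assms Suc]]) (auto simp: algebra_simps)
qed (use assms in simp)

text \<open>Picard iteration from the affine function with the given data: \<open>Z n\<close> is the
  primitive of \<open>p * Y n\<close>, \<open>Y (Suc n)\<close> the primitive of \<open>Z n\<close>,
  and the solution is the sum of all \<open>Y n\<close>.\<close>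

lemma ivp_exists:
  fixes p :: "real \<Rightarrow> complex"
  assumes p: "\<And>b. set_integrable lborel {l..b} p"
  shows "\<exists>y y1. ac l y y1 \<and> ac l y1 (\<lambda>t. p t * y t) \<and> y l = A \<and> y1 l = B"
proof -
  define Y where "Y = rec_nat (\<lambda>x. A + B * complex_of_real (x - l))
     (\<lambda>n Yn x. LINT s:{l..x}|lborel. (LINT t:{l..s}|lborel. p t * Yn t))"
  define Z where "Z = (\<lambda>n x. LINT t:{l..x}|lborel. p t * Y n t)"
  have Y0: "Y 0 = (\<lambda>x. A + B * complex_of_real (x - l))" by (simp add: Y_def)
  have YS: "Y (Suc n) = (\<lambda>x. LINT s:{l..x}|lborel. Z n s)" for n by (simp add: Y_def Z_def)
  have prim: "ac l (\<lambda>x. LINT t:{l..x}|lborel. g t) g"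
    if "\<And>b. set_integrable lborel {l..b} g" for g :: "real \<Rightarrow> complex"
    using ac_primitive[OF that, of 0] by simp
  have prim0: "(LINT t:{l..l}|lborel. g t) = 0" for g :: "real \<Rightarrow> complex"
  proof -
    have "AE t in lborel. indicat_real {l..l} t *\<^sub>R g t = 0"
      by (rule AE_I'[of "{l}"]) (auto split: split_indicator)
    then show ?thesis unfolding set_lebesgue_integral_def by (rule integral_eq_zero_AE)
  qed
  have ac0: "ac l (Y 0) (\<lambda>x. B)"
    unfolding Y0 by (rule ac_C1) (auto intro!: derivative_eq_intros)
  have both: "continuous_on {l..} (Y n) \<and> ac l (Z n) (\<lambda>t. p t * Y n t)" for n
  proof (induction n)
    case 0
    have c: "continuous_on {l..} (Y 0)" using ac_continuous[OF ac0] .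
    have "ac l (Z 0) (\<lambda>t. p t * Y 0 t)" unfolding Z_def
      by (rule prim, subst mult.commute, rule set_integrable_continuous_mult)
        (use c p in \<open>auto intro: continuous_on_subset\<close>)
    then show ?case using c by simp
  next
    case (Suc n)
    have "set_integrable lborel {l..b} (Z n)" for b
      using Suc ac_continuous_Icc by (intro borel_integrable_atLeastAtMost') blast
    then have c: "continuous_on {l..} (Y (Suc n))" unfolding YS using ac_continuous[OF prim] by blast
    have "ac l (Z (Suc n)) (\<lambda>t. p t * Y (Suc n) t)" unfolding Z_def
      by (rule prim, subst mult.commute, rule set_integrable_continuous_mult)
        (use c p in \<open>auto intro: continuous_on_subset\<close>)
    then show ?case using c by simp
  qed
  have Zi: "set_integrable lborel {l..b} (Z n)" for b n
    using both ac_continuous_Icc by (intro borel_integrable_atLeastAtMost') blast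
  have acY: "ac l (Y (Suc n)) (Z n)" for n unfolding YS by (rule prim[OF Zi])
  \<comment> \<open>The inner integral turns P^n |p| into a multiple of P^(n+1) / (n+1); the scale
    \<open>max 1 (b - l)\<close> pays for the outer integration over a length of at most b - l.
    Being at least 1, it also lets the same majorant serve for \<open>Z n\<close>.\<close>
  define P where "P = (\<lambda>b x. max 1 (b - l) * (LINT t:{l..x}|lborel. norm (p t)))"
  define M where "M = (\<lambda>b. norm A + norm B * max 1 (b - l))"
  have acP: "ac l (P b) (\<lambda>t. max 1 (b - l) * norm (p t))" for b
    unfolding P_def using ac_cmult[OF ac_primitive[of l "\<lambda>t. norm (p t)" 0]] p by (auto intro: set_integrable_norm)
  have Pmono: "P b s \<le> P b x" if "l \<le> s" "s \<le> x" for b s x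
  proof -
    have "P b x - P b s = (LINT t:{s..x}|lborel. max 1 (b - l) * norm (p t))"
      by (rule ac_diff[OF acP that])
    also have "\<dots> \<ge> 0" unfolding set_lebesgue_integral_def by (intro integral_nonneg_AE AE_I2) auto
    finally show ?thesis by simp
  qed
  have P0: "P b l = 0" for b
  proof -
    have "AE t in lborel. indicat_real {l..l} t *\<^sub>R norm (p t) = 0"
      by (rule AE_I'[of "{l}"]) (auto split: split_indicator)
    then have "(LINT t:{l..l}|lborel. norm (p t)) = 0"
      unfolding set_lebesgue_integral_def by (rule integral_eq_zero_AE)
    then show ?thesis by (simp add: P_def)
  qed
  have Pnn: "P b x \<ge> 0" if "x \<ge> l" for b x using Pmono[of l x b] P0 that by simp
  have Mnn: "M b \<ge> 0" for b by (simp add: M_def)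
  have Zb: "norm (Z n x) \<le> M b / max 1 (b-l) * (P b x ^ Suc n / fact (Suc n))"
    if Yb: "\<And>x. x \<in> {l..b} \<Longrightarrow> norm (Y n x) \<le> M b * P b x ^ n / fact n" and x: "x \<in> {l..b}" for n x b
  proof -
    define K where "K = M b / max 1 (b-l) / fact (Suc n)"
    have acp: "ac l (\<lambda>t. P b t ^ Suc n) (\<lambda>t. of_nat (Suc n) * P b t ^ n * (max 1 (b-l) * norm (p t)))"
      by (rule ac_power[OF acP])
    have "norm (Z n x) \<le> (LINT t:{l..x}|lborel. K * (of_nat (Suc n) * P b t ^ n * (max 1 (b-l) * norm (p t))))"
      unfolding Z_def
    proof (rule norm_set_integral_le)
      show "set_integrable lborel {l..x} (\<lambda>t. p t * Y n t)" using both ac_int by blast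
      show "set_integrable lborel {l..x} (\<lambda>t. K * (of_nat (Suc n) * P b t ^ n * (max 1 (b-l) * norm (p t))))"
        using ac_int[OF acp] by (intro set_integrable_mult_right) blast
      fix t assume t: "t \<in> {l..x}"
      have "norm (p t * Y n t) \<le> norm (p t) * (M b * P b t ^ n / fact n)"
        unfolding norm_mult by (rule mult_left_mono[OF Yb]) (use t x in auto)
      also have "\<dots> = K * (of_nat (Suc n) * P b t ^ n * (max 1 (b-l) * norm (p t)))"
      proof -
        define L N F where "L = max 1 (b-l)" and "N = real (Suc n)" and "F = (fact n :: real)"
        have "L > 0" "N > 0" "F > 0" by (auto simp: L_def N_def F_def)
        moreover have "fact (Suc n) = N * F" by (simp add: N_def F_def)
        ultimately show ?thesis
          unfolding K_def L_def[symmetric] N_def[symmetric] F_def[symmetric]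
          by (simp add: N_def[symmetric] F_def[symmetric] del: fact_Suc)
      qed
      finally show "norm (p t * Y n t) \<le> K * (of_nat (Suc n) * P b t ^ n * (max 1 (b-l) * norm (p t)))" .
    qed
    also have "\<dots> = K * (P b x ^ Suc n - P b l ^ Suc n)"
      using ac_eq[OF acp, of x] x unfolding set_integral_mult_right by simp
    finally show ?thesis by (simp add: P0 K_def)
  qed
  have YSb: "norm (Y (Suc n) x) \<le> M b * P b x ^ Suc n / fact (Suc n)"
    if Zb': "\<And>x. x \<in> {l..b} \<Longrightarrow> norm (Z n x) \<le> M b / max 1 (b-l) * (P b x ^ Suc n / fact (Suc n))"
      and x: "x \<in> {l..b}" for n x b
  proof -
    define K where "K = M b / max 1 (b-l) * (P b x ^ Suc n / fact (Suc n))"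
    have K: "K \<ge> 0" unfolding K_def using Mnn Pnn x by (intro mult_nonneg_nonneg divide_nonneg_nonneg) auto
    have ci: "set_integrable lborel {l..x} (\<lambda>t. K)" for K :: real
      by (intro borel_integrable_atLeastAtMost') auto
    have "norm (Y (Suc n) x) \<le> (LINT t:{l..x}|lborel. K)"
      unfolding YS
    proof (rule norm_set_integral_le[OF Zi ci])
      fix t assume t: "t \<in> {l..x}"
      have "norm (Z n t) \<le> M b / max 1 (b-l) * (P b t ^ Suc n / fact (Suc n))"
        using Zb' t x by auto
      also have "\<dots> \<le> K" unfolding K_def
        using Pmono[of t x b] Pnn[of t b] t Mnn[of b]
        by (intro mult_left_mono divide_right_mono power_mono) auto
      finally show "norm (Z n t) \<le> K" .
    qed
    also have "\<dots> = (x - l) * K"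
      using set_borel_integral_eq_integral(2)[OF ci] x by simp
    also have "\<dots> \<le> max 1 (b-l) * K" using x K by (intro mult_right_mono) auto
    also have "\<dots> = M b * P b x ^ Suc n / fact (Suc n)" by (simp add: K_def)
    finally show ?thesis .
  qed
  have Yb: "norm (Y n x) \<le> M b * P b x ^ n / fact n" if "x \<in> {l..b}" for n x b
    using that
  proof (induction n arbitrary: x)
    case (0 x)
    have "norm (Y 0 x) \<le> norm A + norm B * norm (complex_of_real (x - l))"
      unfolding Y0 by (metis norm_triangle_ineq norm_mult)
    also have "\<dots> \<le> M b" unfolding M_def
      using 0 by (intro add_left_mono mult_left_mono) (auto simp del: of_real_diff)
    finally show ?case by simp
  next
    case (Suc n x)
    show ?case by (rule YSb[OF Zb[OF Suc.IH] Suc.prems])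
  qed
  have sc: "summable (\<lambda>n. M b * P b b ^ n / fact n)" for b
    using summable_mult[OF summable_exp[of "P b b"], of "M b"] by (simp add: field_simps)
  have Yb': "norm (Y n x) \<le> M b * P b b ^ n / fact n" if "x \<in> {l..b}" for n x b
    by (rule order_trans[OF Yb[OF that]], intro divide_right_mono mult_left_mono power_mono)
      (use that Pmono Pnn Mnn in auto)
  have Zb': "norm (Z n x) \<le> M b * P b b ^ Suc n / fact (Suc n)" if "x \<in> {l..b}" for n x b
  proof -
    have "norm (Z n x) \<le> M b / max 1 (b-l) * (P b x ^ Suc n / fact (Suc n))"
      by (rule Zb[OF Yb that])
    also have "\<dots> \<le> M b / 1 * (P b b ^ Suc n / fact (Suc n))"
      using that Pmono[of x b b] Pnn[of x b] Mnn[of b]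
      by (intro mult_mono divide_left_mono divide_right_mono power_mono) auto
    finally show ?thesis by simp
  qed
  have bound1: "\<exists>c k. summable c \<and> set_integrable lborel {l..b} k
        \<and> (\<forall>n. \<forall>t\<in>{l..b}. norm (p t * Y n t) \<le> c n * (k t :: real))" for b
  proof (intro exI conjI allI ballI)
    show "summable (\<lambda>n. M b * P b b ^ n / fact n)" by (rule sc)
    show "set_integrable lborel {l..b} (\<lambda>t. norm (p t))" using p by (rule set_integrable_norm)
    show "norm (p t * Y n t) \<le> M b * P b b ^ n / fact n * norm (p t)" if "t \<in> {l..b}" for n t
      using mult_right_mono[OF Yb'[OF that, of n], of "norm (p t)"] by (simp add: norm_mult mult.commute)
  qed
  have bound2: "\<exists>c k. summable c \<and> set_integrable lborel {l..b} k
        \<and> (\<forall>n. \<forall>t\<in>{l..b}. norm (Z n t) \<le> c n * (k t :: real))" for b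
  proof (intro exI conjI allI ballI)
    show "summable (\<lambda>n. M b * P b b ^ Suc n / fact (Suc n))" using sc[of b] by (subst summable_Suc_iff)
    show "set_integrable lborel {l..b} (\<lambda>t. 1::real)" by (intro borel_integrable_atLeastAtMost') auto
    show "norm (Z n t) \<le> M b * P b b ^ Suc n / fact (Suc n) * 1" if "t \<in> {l..b}" for n t
      using Zb'[OF that, of n] by simp
  qed
  note S1 = ac_suminf[of l Z "\<lambda>n t. p t * Y n t", OF conjunct2[OF both] _ bound1]
  note S2 = ac_suminf[of l "\<lambda>n. Y (Suc n)" Z, OF acY _ bound2]
  have Z0: "Z n l = 0" "Y (Suc n) l = 0" for n unfolding Z_def YS by (rule prim0)+
  define y where "y = (\<lambda>x. Y 0 x + (\<Sum>n. Y (Suc n) x))"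
  define y1 where "y1 = (\<lambda>x. B + (\<Sum>n. Z n x))"
  have "ac l y y1" unfolding y_def y1_def by (rule ac_add[OF ac0 S2(1)[OF Z0(2)]])
  moreover have "ac l y1 (\<lambda>t. p t * y t)"
  proof (rule ac_cong)
    show "ac l y1 (\<lambda>t. 0 + (\<Sum>n. p t * Y n t))"
      unfolding y1_def by (rule ac_add[OF ac_const S1(1)[OF Z0(1)]])
    fix t assume t: "t \<ge> l"
    have s: "summable (\<lambda>n. Y n t)" using S2(2)[OF Z0(2) t] by (subst (asm) summable_Suc_iff)
    show "0 + (\<Sum>n. p t * Y n t) = p t * y t"
      using suminf_mult[OF s, of "p t"] suminf_split_head[OF s] by (simp add: y_def)
  qed simp
  moreover have "y l = A" "y1 l = B" by (simp_all add: y_def y1_def Z0 Y0)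
  ultimately show ?thesis by blast
qed

section \<open>Solutions of the differential equation and their Wronskians\<close>

lemma rep_iff_ac: "rep l y y1 y2 \<longleftrightarrow> ac l y1 y2 \<and> ac l y y1"
proof
  assume r: "rep l y y1 y2"
  then have a: "ac l y1 y2" unfolding rep_def by (intro acI) blast+
  have "ac l y y1"
  proof (rule acI)
    show "set_integrable lborel {l..b} y1" for b
      using ac_continuous_Icc[OF a order_refl] by (rule borel_integrable_atLeastAtMost')
  qed (use r in \<open>unfold rep_def, blast\<close>)
  with a show "ac l y1 y2 \<and> ac l y y1" by blast
next
  assume "ac l y1 y2 \<and> ac l y y1"
  then show "rep l y y1 y2" unfolding rep_def ac_def by blast
qed

lemma ac_wronskian:
  fixes y w :: "real \<Rightarrow> 'a::{euclidean_space,real_normed_field}"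
  assumes "ac l y y1" "ac l y1 y2" "ac l w w1" "ac l w1 w2"
  shows "ac l (\<lambda>x. y x * w1 x - y1 x * w x) (\<lambda>x. y x * w2 x - y2 x * w x)"
  by (rule ac_cong[OF ac_diff_fun[OF ac_mult[OF assms(1,4)] ac_mult[OF assms(2,3)]]])
    (auto simp: algebra_simps)

lemma ac_zero_deriv:
  assumes "ac l f (\<lambda>x. 0)" "x \<ge> l" shows "f x = f l"
  using ac_eq[OF assms] by simp

text \<open>The derivative \<open>y1\<close> is a separate argument so that solutions can be
  combined and conjugated without evaluating \<open>dl\<close>.\<close>

definition solves :: "(real \<Rightarrow> real) \<Rightarrow> real \<Rightarrow> complex \<Rightarrow> (real \<Rightarrow> complex) \<Rightarrow> (real \<Rightarrow> complex) \<Rightarrow> bool" where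
  "solves q l z y y1 \<longleftrightarrow> ac l y y1 \<and> ac l y1 (\<lambda>t. (complex_of_real (q t) - z) * y t)"

lemma solvesD:
  assumes "solves q l z y y1"
  shows "ac l y y1" "ac l y1 (\<lambda>t. (complex_of_real (q t) - z) * y t)"
  using assms by (auto simp: solves_def)

lemma solves_iff_sol:
  "sol q l z y \<longleftrightarrow> solves q l z y (dl l y)"
  by (auto simp: sol_def solves_def rep_iff_ac)

lemma solves_dl: "solves q l z y y1 \<Longrightarrow> x \<ge> l \<Longrightarrow> dl l y x = y1 x"
  by (rule ac_dl) (auto simp: solves_def intro: ac_continuous)

lemma solves_sol: "solves q l z y y1 \<Longrightarrow> sol q l z y"
proof -
  assume y: "solves q l z y y1"
  have "ac l y (dl l y)" "ac l (dl l y) (\<lambda>t. (complex_of_real (q t) - z) * y t)"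
    by (rule ac_cong[OF solvesD(1)[OF y]] ac_cong[OF solvesD(2)[OF y]]; simp add: solves_dl[OF y])+
  then show ?thesis by (simp add: solves_iff_sol solves_def)
qed

lemma solves_lincomb:
  assumes "solves q l z y y1" "solves q l z w w1"
  shows "solves q l z (\<lambda>x. a * y x + b * w x) (\<lambda>x. a * y1 x + b * w1 x)"
proof -
  have "ac l (\<lambda>x. a * y x + b * w x) (\<lambda>x. a * y1 x + b * w1 x)"
    using assms by (intro ac_add ac_cmult) (auto simp: solves_def)
  moreover have "ac l (\<lambda>x. a * y1 x + b * w1 x)
      (\<lambda>t. (complex_of_real (q t) - z) * (a * y t + b * w t))"
    by (rule ac_cong[OF ac_add[OF ac_cmult[OF solvesD(2)[OF assms(1)], of a] ac_cmult[OF solvesD(2)[OF assms(2)], of b]]])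
      (auto simp: algebra_simps)
  ultimately show ?thesis by (simp add: solves_def)
qed

lemma solves_cnj:
  assumes "solves q l z y y1"
  shows "solves q l (cnj z) (\<lambda>x. cnj (y x)) (\<lambda>x. cnj (y1 x))"
  using ac_cnj[OF solvesD(1)[OF assms]] ac_cnj[OF solvesD(2)[OF assms]] by (simp add: solves_def)

lemma wronskian_const:
  assumes "solves q l z y y1" "solves q l z w w1" "x \<ge> l"
  shows "y x * w1 x - y1 x * w x = y l * w1 l - y1 l * w l"
  by (rule ac_zero_deriv[OF ac_cong[OF ac_wronskian[OF solvesD[OF assms(1)] solvesD[OF assms(2)]]] assms(3)])
    (auto simp: algebra_simps)

lemma solves_exists:
  assumes "locsum l q"
  obtains y y1 where "solves q l z y y1" "y l = A" "y1 l = B"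
proof -
  have "set_integrable lborel {l..b} (\<lambda>t. complex_of_real (q t) - z)" for b
  proof (intro set_integral_diff)
    show "set_integrable lborel {l..b} (\<lambda>t. complex_of_real (q t))"
      using assms integrable_of_real unfolding locsum_def set_integrable_def
      by (simp add: scaleR_conv_of_real flip: of_real_mult)
    show "set_integrable lborel {l..b} (\<lambda>t. z)" by (intro borel_integrable_atLeastAtMost') auto
  qed
  from ivp_exists[OF this, of A B] that show ?thesis by (auto simp: solves_def)
qed

text \<open>No Gronwall estimate is needed: the difference has zero Cauchy data, hence zero
  Wronskian with both members \<open>u\<close>, \<open>v\<close> of a basis. At \<open>x\<close>
  this is a linear system for its value and its derivative with determinant of modulus 1.\<close>

lemma solves_unique:
  assumes q: "locsum l q" and y: "solves q l z y y1" and w: "solves q l z w w1"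
    and i: "y l = w l" "y1 l = w1 l" and x: "x \<ge> l"
  shows "y x = w x" "y1 x = w1 x"
proof -
  obtain u u1 where u: "solves q l z u u1" "u l = 0" "u1 l = 1" using solves_exists[OF q] .
  obtain v v1 where v: "solves q l z v v1" "v l = 1" "v1 l = 0" using solves_exists[OF q] .
  have d: "solves q l z (\<lambda>x. 1 * y x + (-1) * w x) (\<lambda>x. 1 * y1 x + (-1) * w1 x)"
    by (rule solves_lincomb[OF y w])
  define a b where "a = y x - w x" and "b = y1 x - w1 x"
  have 1: "a * u1 x - b * u x = 0" using wronskian_const[OF d u(1) x] i by (simp add: a_def b_def)
  have 2: "a * v1 x - b * v x = 0" using wronskian_const[OF d v(1) x] i by (simp add: a_def b_def)
  have 3: "u x * v1 x - u1 x * v x = -1" using wronskian_const[OF u(1) v(1) x] u v by simp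
  have "a * (u x * v1 x - u1 x * v x) = 0" "b * (u x * v1 x - u1 x * v x) = 0"
    using 1 2 by algebra+
  then show "y x = w x" "y1 x = w1 x" using 3 by (auto simp: a_def b_def)
qed

section \<open>Square integrable functions on a half-line\<close>

lemma set_borel_measurable_iff_restrict:
  fixes f :: "real \<Rightarrow> 'a::real_normed_vector"
  shows "set_borel_measurable lborel {l..} f \<longleftrightarrow> f \<in> borel_measurable (restrict_space lborel {l..})"
  unfolding set_borel_measurable_def by (subst borel_measurable_restrict_space_iff) auto

lemma set_borel_measurable_atLeastI:
  fixes f :: "real \<Rightarrow> 'a::{real_normed_vector,second_countable_topology}"
  assumes "\<And>b. set_integrable lborel {l..b} f"
  shows "set_borel_measurable lborel {l..} f"
  unfolding set_borel_measurable_def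
proof (rule borel_measurable_LIMSEQ_metric)
  show "(\<lambda>x. indicat_real {l..real n} x *\<^sub>R f x) \<in> borel_measurable lborel" for n
    using assms[of n] by (auto simp: set_integrable_def)
  fix x
  have "\<forall>\<^sub>F n in sequentially. indicat_real {l..real n} x *\<^sub>R f x = indicat_real {l..} x *\<^sub>R f x"
    using eventually_ge_at_top[of "nat \<lceil>x\<rceil>"]
    by eventually_elim (auto split: split_indicator simp: nat_le_iff ceiling_le_iff)
  then show "(\<lambda>n. indicat_real {l..real n} x *\<^sub>R f x) \<longlonglongrightarrow> indicat_real {l..} x *\<^sub>R f x"
    by (rule tendsto_eventually)
qed

lemma set_integral_Icc_le:
  fixes f :: "real \<Rightarrow> real"
  assumes "set_integrable lborel {a..} f" "\<And>x. x \<ge> a \<Longrightarrow> f x \<ge> 0" "a \<le> c"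
  shows "(LINT x:{c..b}|lborel. f x) \<le> (LINT x:{a..}|lborel. f x)"
  unfolding set_lebesgue_integral_def
proof (rule integral_mono)
  have "set_integrable lborel {c..b} f" by (rule set_integrable_subset[OF assms(1)]) (use assms in auto)
  then show "integrable lborel (\<lambda>x. indicat_real {c..b} x *\<^sub>R f x)" by (simp add: set_integrable_def)
  show "integrable lborel (\<lambda>x. indicat_real {a..} x *\<^sub>R f x)" using assms by (simp add: set_integrable_def)
qed (use assms in \<open>auto split: split_indicator\<close>)

lemma set_integral_Icc_mono:
  fixes f :: "real \<Rightarrow> real"
  assumes "set_integrable lborel {a..c} f" "\<And>x. x \<ge> a \<Longrightarrow> f x \<ge> 0" "b \<le> c"
  shows "(LINT x:{a..b}|lborel. f x) \<le> (LINT x:{a..c}|lborel. f x)"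
  unfolding set_lebesgue_integral_def
proof (rule integral_mono)
  have "set_integrable lborel {a..b} f" by (rule set_integrable_subset[OF assms(1)]) (use assms in auto)
  then show "integrable lborel (\<lambda>x. indicat_real {a..b} x *\<^sub>R f x)" by (simp add: set_integrable_def)
  show "integrable lborel (\<lambda>x. indicat_real {a..c} x *\<^sub>R f x)" using assms by (simp add: set_integrable_def)
qed (use assms in \<open>auto split: split_indicator\<close>)

lemma set_integral_nonneg':
  fixes f :: "real \<Rightarrow> real"
  assumes "\<And>x. x \<in> S \<Longrightarrow> f x \<ge> 0"
  shows "0 \<le> (LINT x:S|lborel. f x)"
  unfolding set_lebesgue_integral_def
  by (rule integral_nonneg_AE, rule AE_I2) (use assms in \<open>auto split: split_indicator\<close>)

lemma set_integrable_atLeast_bounded: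
  fixes f :: "real \<Rightarrow> real"
  assumes i: "\<And>b. set_integrable lborel {l..b} f" and nn: "\<And>x. x \<ge> l \<Longrightarrow> f x \<ge> 0"
    and B: "\<And>b. b \<ge> l \<Longrightarrow> (LINT x:{l..b}|lborel. f x) \<le> B"
  shows "set_integrable lborel {l..} f"
proof -
  define J where "J = (\<lambda>n::nat. LINT x:{l..l + real n}|lborel. f x)"
  have "incseq J" unfolding J_def
    by (rule incseq_SucI, rule set_integral_Icc_mono) (use i nn in auto)
  moreover have "J n \<le> B" for n unfolding J_def by (rule B) auto
  ultimately obtain L where L: "J \<longlonglongrightarrow> L" using incseq_convergent by blast
  have "set_integrable lborel (\<Union>n::nat. {l..l + real n}) f"
    by (rule pos_integrable_to_top[where l = L])
      (use i nn L in \<open>auto simp: J_def mono_def\<close>)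
  moreover have "(\<Union>n::nat. {l..l + real n}) = {l..}"
  proof -
    have "\<exists>n::nat. x \<le> l + real n" for x
      using real_arch_simple[of "x - l"] by (auto simp: algebra_simps)
    then show ?thesis by auto
  qed
  ultimately show ?thesis by simp
qed

lemma sqint_integrable: "sqint l f \<Longrightarrow> set_integrable lborel {l..} (\<lambda>x. (cmod (f x))\<^sup>2)"
  by (simp add: sqint_def)

lemma sqint_measurable:
  assumes "sqint l f"
  shows "f \<in> borel_measurable (restrict_space lborel {l..})"
  using assms set_borel_measurable_iff_restrict unfolding sqint_def by blast

lemma sqint_bound:
  assumes f: "f \<in> borel_measurable (restrict_space lborel {l..})"
    and g: "set_integrable lborel {l..} g"
    and le: "AE x in lborel. x \<ge> l \<longrightarrow> (cmod (f x))\<^sup>2 \<le> g x"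
  shows "sqint l f"
proof -
  have "set_integrable lborel {l..} (\<lambda>x. (cmod (f x))\<^sup>2)"
  proof (rule set_integrable_bound[OF g])
    show "set_borel_measurable lborel {l..} (\<lambda>x. (cmod (f x))\<^sup>2)"
      unfolding set_borel_measurable_iff_restrict using f by measurable
    show "AE x in lborel. x \<in> {l..} \<longrightarrow> norm ((cmod (f x))\<^sup>2) \<le> norm (g x)"
      using le by eventually_elim (auto intro: order_trans)
  qed
  then show ?thesis using f set_borel_measurable_iff_restrict unfolding sqint_def by blast
qed

lemma sqint_AE_cong:
  assumes "sqint l f" "AE x in lborel. x \<ge> l \<longrightarrow> f x = g x"
    "g \<in> borel_measurable (restrict_space lborel {l..})"
  shows "sqint l g"
  by (rule sqint_bound[OF assms(3) sqint_integrable[OF assms(1)]])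
    (use assms(2) in eventually_elim, auto)

lemma sqint_cong:
  assumes "sqint l f" "\<And>x. x \<ge> l \<Longrightarrow> f x = g x"
  shows "sqint l g"
proof -
  have "(\<lambda>x. indicat_real {l..} x *\<^sub>R f x) = (\<lambda>x. indicat_real {l..} x *\<^sub>R g x)"
    "(\<lambda>x. indicat_real {l..} x *\<^sub>R (cmod (f x))\<^sup>2) = (\<lambda>x. indicat_real {l..} x *\<^sub>R (cmod (g x))\<^sup>2)"
    using assms(2) by (auto split: split_indicator)
  then show ?thesis using assms(1) by (simp add: sqint_def set_borel_measurable_def set_integrable_def)
qed

lemma sqint_add:
  assumes "sqint l f" "sqint l g"
  shows "sqint l (\<lambda>x. f x + g x)"
proof (rule sqint_bound)
  show "set_integrable lborel {l..} (\<lambda>x. 2 * (cmod (f x))\<^sup>2 + 2 * (cmod (g x))\<^sup>2)"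
    using assms by (intro set_integral_add set_integrable_mult_right sqint_integrable)
  show "AE x in lborel. x \<ge> l \<longrightarrow> (cmod (f x + g x))\<^sup>2 \<le> 2 * (cmod (f x))\<^sup>2 + 2 * (cmod (g x))\<^sup>2"
  proof (intro AE_I2 impI)
    fix x
    have "(cmod (f x + g x))\<^sup>2 \<le> (cmod (f x) + cmod (g x))\<^sup>2"
      by (intro power_mono norm_triangle_ineq) auto
    also have "\<dots> \<le> 2 * (cmod (f x))\<^sup>2 + 2 * (cmod (g x))\<^sup>2"
      using sum_squares_bound[of "cmod (f x)" "cmod (g x)"] by (simp add: power2_sum)
    finally show "(cmod (f x + g x))\<^sup>2 \<le> 2 * (cmod (f x))\<^sup>2 + 2 * (cmod (g x))\<^sup>2" .
  qed
qed (use sqint_measurable assms in measurable)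

lemma sqint_cmult:
  assumes "sqint l f" shows "sqint l (\<lambda>x. c * f x)"
proof (rule sqint_bound)
  show "set_integrable lborel {l..} (\<lambda>x. (cmod c)\<^sup>2 * (cmod (f x))\<^sup>2)"
    using assms by (intro set_integrable_mult_right sqint_integrable)
qed (use sqint_measurable[OF assms] in \<open>auto simp: norm_mult power_mult_distrib\<close>)

lemma sqint_cnj:
  assumes "sqint l f" shows "sqint l (\<lambda>x. cnj (f x))"
proof (rule sqint_bound[OF _ sqint_integrable[OF assms]])
  show "(\<lambda>x. cnj (f x)) \<in> borel_measurable (restrict_space lborel {l..})"
    using measurable_compose[OF sqint_measurable[OF assms] borel_measurable_continuous_onI[OF continuous_on_cnj[OF continuous_on_id]]]
    by simp
qed auto

lemma sqint_norm:
  assumes "sqint l f" shows "sqint l (\<lambda>x. complex_of_real (cmod (f x)))"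
  by (rule sqint_bound[OF _ sqint_integrable[OF assms]]) (use sqint_measurable[OF assms] in auto)

lemma sqint_mult_integrable:
  assumes "sqint l f" "sqint l g"
  shows "set_integrable lborel {l..} (\<lambda>x. f x * g x)"
proof (rule set_integrable_bound)
  show "set_integrable lborel {l..} (\<lambda>x. (cmod (f x))\<^sup>2 + (cmod (g x))\<^sup>2)"
    using assms by (intro set_integral_add sqint_integrable)
  show "set_borel_measurable lborel {l..} (\<lambda>x. f x * g x)"
    unfolding set_borel_measurable_iff_restrict
    using sqint_measurable[OF assms(1)] sqint_measurable[OF assms(2)] by measurable
  show "AE x in lborel. x \<in> {l..} \<longrightarrow> cmod (f x * g x) \<le> norm ((cmod (f x))\<^sup>2 + (cmod (g x))\<^sup>2)"
  proof (intro AE_I2 impI)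
    fix x
    show "cmod (f x * g x) \<le> norm ((cmod (f x))\<^sup>2 + (cmod (g x))\<^sup>2)"
    proof -
      have "0 \<le> cmod (f x) * cmod (g x)" by simp
      then have "cmod (f x) * cmod (g x) \<le> (cmod (f x))\<^sup>2 + (cmod (g x))\<^sup>2"
        using sum_squares_bound[of "cmod (f x)" "cmod (g x)"] by linarith
      then show ?thesis by (simp add: norm_mult)
    qed
  qed
qed

lemma continuous_measurable_atLeast:
  fixes f :: "real \<Rightarrow> complex"
  assumes "continuous_on {l..} f"
  shows "f \<in> borel_measurable (restrict_space lborel {l..})"
  using set_measurable_continuous_on[of "{l..}" f] assms
  by (auto simp: set_borel_measurable_iff_restrict[symmetric] set_borel_measurable_def)

lemma continuous_norm_sq_integrable:
  fixes f :: "real \<Rightarrow> complex"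
  assumes "continuous_on {l..} f" "l \<le> a"
  shows "set_integrable lborel {a..b} (\<lambda>x. (cmod (f x))\<^sup>2)"
  by (intro borel_integrable_atLeastAtMost' continuous_intros continuous_on_subset[OF assms(1)])
    (use assms(2) in auto)

lemma sqint_continuousI:
  assumes c: "continuous_on {l..} f"
    and B: "\<And>b. b \<ge> l \<Longrightarrow> (LINT x:{l..b}|lborel. (cmod (f x))\<^sup>2) \<le> B"
  shows "sqint l f"
proof (rule sqint_bound)
  show "set_integrable lborel {l..} (\<lambda>x. (cmod (f x))\<^sup>2)"
    by (rule set_integrable_atLeast_bounded[OF continuous_norm_sq_integrable[OF c order_refl] _ B]) auto
qed (use continuous_measurable_atLeast[OF c] in auto)

lemma sqint_dominated:
  assumes c: "continuous_on {l..} f" and X: "X \<ge> l" and h: "sqint l h"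
    and le: "\<And>x. x \<ge> X \<Longrightarrow> cmod (f x) \<le> cmod (h x)"
  shows "sqint l f"
proof (rule sqint_bound)
  have 1: "set_integrable lborel {l..X} (\<lambda>x. (cmod (f x))\<^sup>2)"
    by (rule continuous_norm_sq_integrable[OF c order_refl])
  show "set_integrable lborel {l..} (\<lambda>x. indicat_real {l..X} x * (cmod (f x))\<^sup>2 + (cmod (h x))\<^sup>2)"
  proof (rule set_integral_add(1)[OF _ sqint_integrable[OF h]])
    have "(\<lambda>x. indicat_real {l..} x *\<^sub>R (indicat_real {l..X} x * (cmod (f x))\<^sup>2))
        = (\<lambda>x. indicat_real {l..X} x *\<^sub>R (cmod (f x))\<^sup>2)" by (auto split: split_indicator)
    then show "set_integrable lborel {l..} (\<lambda>x. indicat_real {l..X} x * (cmod (f x))\<^sup>2)"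
      using 1 by (simp add: set_integrable_def)
  qed
  show "AE x in lborel. x \<ge> l \<longrightarrow> (cmod (f x))\<^sup>2 \<le> indicat_real {l..X} x * (cmod (f x))\<^sup>2 + (cmod (h x))\<^sup>2"
  proof (intro AE_I2 impI)
    fix x assume "x \<ge> l"
    then show "(cmod (f x))\<^sup>2 \<le> indicat_real {l..X} x * (cmod (f x))\<^sup>2 + (cmod (h x))\<^sup>2"
      using le[of x] by (cases "x \<le> X") (auto intro: power_mono)
  qed
qed (rule continuous_measurable_atLeast[OF c])

text \<open>A substitute for Gronwall's inequality: beyond some \<open>X\<close> the integral of
  \<open>s\<close> is at most 1/2, so the term with the growing primitive is absorbed by the
  left-hand side. It yields square integrability of solutions written by variation of
  constants.\<close>

lemma integral_growth_bounded:
  fixes p r s :: "real \<Rightarrow> real"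
  assumes p: "\<And>b. set_integrable lborel {l..b} p" "\<And>x. x \<ge> l \<Longrightarrow> p x \<ge> 0"
    and r: "set_integrable lborel {l..} r" "\<And>x. x \<ge> l \<Longrightarrow> r x \<ge> 0"
    and s: "set_integrable lborel {l..} s" "\<And>x. x \<ge> l \<Longrightarrow> s x \<ge> 0"
    and X0: "X0 \<ge> l"
    and le: "\<And>x. x \<ge> X0 \<Longrightarrow> p x \<le> r x + s x * (LINT t:{l..x}|lborel. p t)"
  shows "\<exists>B\<ge>0. \<forall>x\<ge>l. (LINT t:{l..x}|lborel. p t) \<le> B"
proof -
  define G where "G = (\<lambda>x. LINT t:{l..x}|lborel. p t)"
  define R where "R = (LINT t:{l..}|lborel. r t)"
  have Gmono: "G x \<le> G y" if "x \<le> y" for x y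
    unfolding G_def by (rule set_integral_Icc_mono) (use p that in auto)
  have Gnn: "G x \<ge> 0" for x unfolding G_def by (rule set_integral_nonneg') (use p in auto)
  have Rnn: "R \<ge> 0" unfolding R_def by (rule set_integral_nonneg') (use r in auto)
  have "((\<lambda>b. LINT t:{l..b}|lborel. s t) \<longlongrightarrow> (LINT t:{l..}|lborel. s t)) at_top"
    by (rule tendsto_set_lebesgue_integral_at_top) (use s in auto)
  then have "\<forall>\<^sub>F b in at_top. (LINT t:{l..b}|lborel. s t) > (LINT t:{l..}|lborel. s t) - 1/2"
    by (rule order_tendstoD) simp
  then obtain X1 where X1: "\<And>b. b \<ge> X1 \<Longrightarrow> (LINT t:{l..b}|lborel. s t) > (LINT t:{l..}|lborel. s t) - 1/2"
    by (auto simp: eventually_at_top_linorder)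
  define X where "X = max X0 X1"
  have X: "X \<ge> X0" "X \<ge> l" "X \<ge> X1" using X0 by (auto simp: X_def)
  have si: "set_integrable lborel {a..b} s" "set_integrable lborel {a..b} r" if "a \<ge> l" for a b
    by (rule set_integrable_subset[OF s(1)] set_integrable_subset[OF r(1)]; use that in auto)+
  have tail: "(LINT t:{X..b}|lborel. s t) \<le> 1/2" if "b \<ge> X" for b
  proof -
    have "(LINT t:{l..b}|lborel. s t) = (LINT t:{l..X}|lborel. s t) + (LINT t:{X..b}|lborel. s t)"
      by (rule set_integral_split) (use si X that in auto)
    moreover have "(LINT t:{l..b}|lborel. s t) \<le> (LINT t:{l..}|lborel. s t)"
      by (rule set_integral_Icc_le) (use s in auto)
    ultimately show ?thesis using X1[of X] X by linarith
  qed
  have big: "G b \<le> 2 * (G X + R)" if b: "b \<ge> X" for b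
  proof -
    have pi: "set_integrable lborel {X..b} p"
      by (rule set_integrable_subset[OF p(1)[of b]]) (use X in auto)
    have "G b = G X + (LINT t:{X..b}|lborel. p t)"
      unfolding G_def by (rule set_integral_split) (use p X b in auto)
    also have "(LINT t:{X..b}|lborel. p t) \<le> (LINT t:{X..b}|lborel. r t + G b * s t)"
    proof (rule set_integral_mono[OF pi])
      show "set_integrable lborel {X..b} (\<lambda>t. r t + G b * s t)"
        using si X by (intro set_integral_add set_integrable_mult_right) auto
      fix t assume t: "t \<in> {X..b}"
      have "p t \<le> r t + s t * G t" using le[of t] t X by (simp add: G_def)
      also have "s t * G t \<le> s t * G b"
        using t X s(2) Gmono by (intro mult_left_mono) auto
      finally show "p t \<le> r t + G b * s t" by (simp add: mult.commute)
    qed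
    also have "\<dots> = (LINT t:{X..b}|lborel. r t) + G b * (LINT t:{X..b}|lborel. s t)"
      using si X by (subst set_integral_add) auto
    also have "\<dots> \<le> R + G b * (1/2)"
      using tail[OF b] Gnn[of b] set_integral_Icc_le[OF r X(2), of b] unfolding R_def
      by (intro add_mono mult_left_mono) auto
    finally show ?thesis by simp
  qed
  have "G x \<le> 2 * (G X + R)" for x
  proof (cases "x \<ge> X")
    case False
    then have "G x \<le> G X" using Gmono by auto
    then show ?thesis using Gnn[of X] Rnn by simp
  qed (use big in auto)
  then show ?thesis using Gnn[of X] Rnn unfolding G_def by (intro exI[of _ "2 * (G X + R)"]) (auto simp: G_def)
qed

section \<open>Weyl solutions\<close>

lemma solves_continuous:
  assumes "solves q l z y y1"
  shows "continuous_on {l..} y" "continuous_on {l..} y1"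
  using solvesD[OF assms] ac_continuous by blast+

text \<open>Lagrange's identity for \<open>y\<close> and its conjugate, which solves the equation at
  \<open>cnj z\<close>; their Wronskian is -2\<i> times the imaginary part on the left.\<close>

lemma green_im:
  assumes y: "solves q l z y y1" and x: "x \<ge> l"
  shows "Im (y1 x * cnj (y x)) = Im (y1 l * cnj (y l)) - Im z * (LINT t:{l..x}|lborel. (cmod (y t))\<^sup>2)"
proof -
  note c = solves_cnj[OF y]
  have "ac l (\<lambda>x. y x * cnj (y1 x) - y1 x * cnj (y x)) (\<lambda>t. (2 * \<i> * Im z) * complex_of_real ((cmod (y t))\<^sup>2))"
  proof (rule ac_cong[OF ac_wronskian[OF solvesD[OF y] solvesD[OF c]]])
    fix t
    have "y t * ((complex_of_real (q t) - cnj z) * cnj (y t)) - (complex_of_real (q t) - z) * y t * cnj (y t)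
       = (z - cnj z) * (y t * cnj (y t))" by (simp add: algebra_simps)
    also have "z - cnj z = 2 * \<i> * Im z" by (simp add: complex_eq_iff)
    also have "y t * cnj (y t) = complex_of_real ((cmod (y t))\<^sup>2)"
      by (simp only: complex_norm_square)
    finally show "y t * ((complex_of_real (q t) - cnj z) * cnj (y t)) - (complex_of_real (q t) - z) * y t * cnj (y t)
       = (2 * \<i> * Im z) * complex_of_real ((cmod (y t))\<^sup>2)" .
  qed simp
  from ac_eq[OF this x]
  have "y x * cnj (y1 x) - y1 x * cnj (y x) = y l * cnj (y1 l) - y1 l * cnj (y l)
     + 2 * \<i> * Im z * complex_of_real (LINT t:{l..x}|lborel. (cmod (y t))\<^sup>2)"
    by (simp only: set_integral_mult_right set_integral_complex_of_real)
  from arg_cong[OF this, of Im] show ?thesis by (simp add: algebra_simps)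
qed

text \<open>If the integral were zero, \<open>y\<close> would vanish on the interval,
  \<open>y1\<close> would be constant there, and \<open>y\<close> would be affine with slope
  \<open>y1 l\<close>; both initial values would then be zero.\<close>

lemma norm_sq_integral_pos:
  assumes y: "solves q l z y y1" and nz: "y l \<noteq> 0 \<or> y1 l \<noteq> 0" and x: "x > l"
  shows "(LINT t:{l..x}|lborel. (cmod (y t))\<^sup>2) > 0"
proof (rule ccontr)
  assume "\<not> ?thesis"
  moreover have "(LINT t:{l..x}|lborel. (cmod (y t))\<^sup>2) \<ge> 0" by (rule set_integral_nonneg') auto
  ultimately have "(LINT t:{l..x}|lborel. (cmod (y t))\<^sup>2) = 0" by linarith
  then have "integral {l..x} (\<lambda>t. (cmod (y t))\<^sup>2) = 0"
    using set_borel_integral_eq_integral(2)[OF continuous_norm_sq_integrable[OF solves_continuous(1)[OF y] order_refl, of x]]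
    by simp
  then have "\<forall>t\<in>{l..x}. (cmod (y t))\<^sup>2 = 0"
    by (subst (asm) integral_eq_0_iff)
      (use x solves_continuous(1)[OF y] in \<open>auto intro!: continuous_intros intro: continuous_on_subset\<close>)
  then have z': "y t = 0" if "t \<in> {l..x}" for t using that by simp
  have y1: "y1 t = y1 l" if "t \<in> {l..x}" for t
  proof -
    have "(LINT s:{l..t}|lborel. (complex_of_real (q s) - z) * y s) = (LINT s:{l..t}|lborel. 0)"
    proof (rule set_lebesgue_integral_cong)
      show "\<forall>s. s \<in> {l..t} \<longrightarrow> (complex_of_real (q s) - z) * y s = 0"
        using z' that by auto
    qed simp
    then show ?thesis using ac_eq[OF solvesD(2)[OF y], of t] that by (metis add.right_neutral atLeastAtMost_iff set_lebesgue_integral_zero)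
  qed
  have "(LINT s:{l..x}|lborel. y1 s) = (LINT s:{l..x}|lborel. y1 l)"
    by (rule set_lebesgue_integral_cong) (use y1 in \<open>simp, metis\<close>)
  also have "\<dots> = (x - l) * y1 l"
    using set_borel_integral_eq_integral(2)[of "{l..x}" "\<lambda>s. y1 l"] x
    by (simp add: borel_integrable_atLeastAtMost' scaleR_conv_of_real)
  finally have "0 = (x - l) * y1 l" using ac_eq[OF solvesD(1)[OF y], of x] z'[of x] z'[of l] x by simp
  then show False using x nz z'[of l] by simp
qed

text \<open>A nonreal \<open>z\<close> is no Dirichlet eigenvalue of {l..x}: with zeros at both ends
  the boundary terms of \<open>green_im\<close> vanish and force the norm integral to be
  zero.\<close>

lemma dirichlet_nonzero:
  assumes y: "solves q l z y y1" and i: "y l = 0" "y1 l \<noteq> 0" and z: "Im z \<noteq> 0" and x: "x > l"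
  shows "y x \<noteq> 0"
  using green_im[OF y, of x] norm_sq_integral_pos[OF y _ x] i z x by auto

text \<open>The sign of \<open>Im z\<close> treats both half-planes at once. This monotonicity is
  the nesting of the Weyl discs.\<close>

lemma green_im_sgn:
  assumes y: "solves q l z y y1" and x: "l \<le> x" "x \<le> b"
  shows "sgn (Im z) * Im (y1 b * cnj (y b)) \<le> sgn (Im z) * Im (y1 x * cnj (y x))"
proof -
  have "(LINT t:{l..x}|lborel. (cmod (y t))\<^sup>2) \<le> (LINT t:{l..b}|lborel. (cmod (y t))\<^sup>2)"
    by (rule set_integral_Icc_mono[OF continuous_norm_sq_integrable[OF solves_continuous(1)[OF y] order_refl]])
      (use x in auto)
  then have "\<bar>Im z\<bar> * (LINT t:{l..x}|lborel. (cmod (y t))\<^sup>2) \<le> \<bar>Im z\<bar> * (LINT t:{l..b}|lborel. (cmod (y t))\<^sup>2)"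
    by (intro mult_left_mono) auto
  moreover have "l \<le> b" using x by simp
  ultimately show ?thesis
    unfolding green_im[OF y x(1)] green_im[OF y \<open>l \<le> b\<close>] right_diff_distrib mult.assoc[symmetric] abs_sgn
    by (simp only: mult.commute[of "sgn (Im z)" "Im z"])
qed

text \<open>For \<open>y = th + m * ph\<close> the inequality at a point x > l says that
  \<open>m\<close> lies in the Weyl disc belonging to x, so this is membership in the intersection
  of all these discs.\<close>

definition weyl_cond :: "real \<Rightarrow> complex \<Rightarrow> (real \<Rightarrow> complex) \<Rightarrow> (real \<Rightarrow> complex) \<Rightarrow> bool" where
  "weyl_cond l z y y1 \<longleftrightarrow> (\<forall>x\<ge>l. sgn (Im z) * Im (y1 x * cnj (y x)) \<ge> 0)"

text \<open>The Weyl coefficient is a limit of the coefficients m with a Dirichlet condition at b, as b tends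
  to infinity.\<close>

lemma weyl_exists:
  assumes ph: "solves q l z ph ph1" "ph l = 0" "ph1 l = 1"
    and th: "solves q l z th th1" and z: "Im z \<noteq> 0"
  shows "\<exists>m. weyl_cond l z (\<lambda>x. th x + m * ph x) (\<lambda>x. th1 x + m * ph1 x)"
proof -
  define F where "F = (\<lambda>m x. sgn (Im z) * Im ((th1 x + m * ph1 x) * cnj (th x + m * ph x)))"
  have sv: "solves q l z (\<lambda>x. th x + m * ph x) (\<lambda>x. th1 x + m * ph1 x)" for m
    using solves_lincomb[OF th ph(1), of 1 m] by simp
  define mb where "mb = (\<lambda>n::nat. - th (l + 1 + real n) / ph (l + 1 + real n))"
  have mb: "th (l + 1 + real n) + mb n * ph (l + 1 + real n) = 0" for n
    using dirichlet_nonzero[OF ph(1,2) _ z, of "l + 1 + real n"] ph(3) by (simp add: mb_def)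
  \<comment> \<open>The form is zero where the Dirichlet condition holds and it is nonincreasing,
    hence nonnegative to the left of that point.\<close>
  have Fpos: "F (mb n) x \<ge> 0" if "x \<ge> l" "x \<le> l + 1 + real n" for n x
    using green_im_sgn[OF sv that, of "mb n"] mb[of n] by (simp add: F_def)
  \<comment> \<open>The bound on \<open>m\<close> needs a point where the coefficient of |m|^2 is
    strictly negative. At \<open>l\<close> it is zero because \<open>ph l = 0\<close>, so
    \<open>x0\<close> is taken to the right of \<open>l\<close>.\<close>
  define x0 where "x0 = l + 1"
  define d where "d = - (sgn (Im z) * Im (ph1 x0 * cnj (ph x0)))"
  have d: "d > 0"
    using green_im[OF ph(1), of x0] norm_sq_integral_pos[OF ph(1) _, of x0] ph z
    by (auto simp: d_def x0_def sgn_if mult_neg_pos)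
  define K where "K = cmod (th1 x0 * cnj (th x0))"
  define L where "L = cmod (ph1 x0) * cmod (th x0) + cmod (th1 x0) * cmod (ph x0)"
  have bnd: "cmod m \<le> 1 + (K + L) / d" if "F m x0 \<ge> 0" for m
  proof (cases "cmod m \<le> 1")
    case False
    have "(th1 x0 + m * ph1 x0) * cnj (th x0 + m * ph x0) = th1 x0 * cnj (th x0)
       + (m * ph1 x0 * cnj (th x0) + th1 x0 * cnj (m * ph x0)) + (m * cnj m) * (ph1 x0 * cnj (ph x0))"
      by (simp add: algebra_simps)
    also have "m * cnj m = of_real ((cmod m)\<^sup>2)" by (simp only: complex_norm_square)
    finally have e: "(th1 x0 + m * ph1 x0) * cnj (th x0 + m * ph x0) = th1 x0 * cnj (th x0)
       + (m * ph1 x0 * cnj (th x0) + th1 x0 * cnj (m * ph x0)) + of_real ((cmod m)\<^sup>2) * (ph1 x0 * cnj (ph x0))" .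
    have im: "s * Im (u + v + of_real r * w) = s * Im u + s * Im v - r * - (s * Im w)" for s u v r w
      by (simp add: algebra_simps)
    have "F m x0 = sgn (Im z) * Im (th1 x0 * cnj (th x0))
       + sgn (Im z) * Im (m * ph1 x0 * cnj (th x0) + th1 x0 * cnj (m * ph x0)) - (cmod m)\<^sup>2 * d"
      unfolding F_def d_def e by (rule im)
    moreover have s: "sgn (Im z) * Im w \<le> cmod w" for w
      using abs_Im_le_cmod[of w] by (auto simp: sgn_if)
    have "cmod (m * ph1 x0 * cnj (th x0) + th1 x0 * cnj (m * ph x0)) \<le> cmod m * L"
      using norm_triangle_ineq[of "m * ph1 x0 * cnj (th x0)" "th1 x0 * cnj (m * ph x0)"]
      by (simp add: L_def norm_mult algebra_simps)
    ultimately have "(cmod m)\<^sup>2 * d \<le> K + cmod m * L"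
      using that s[of "th1 x0 * cnj (th x0)"] s[of "m * ph1 x0 * cnj (th x0) + th1 x0 * cnj (m * ph x0)"]
      by (simp add: K_def)
    also have "\<dots> \<le> cmod m * (K + L)"
      using False mult_right_mono[of 1 "cmod m" K] by (simp add: K_def algebra_simps)
    finally have "cmod m * (cmod m * d) \<le> cmod m * (K + L)" by (simp add: power2_eq_square algebra_simps)
    then have "cmod m * d \<le> K + L" using False by (subst (asm) mult_le_cancel_left_pos) auto
    then have "cmod m \<le> (K + L) / d" using d by (simp add: field_simps)
    then show ?thesis by simp
  next
    case True
    have "(K + L) / d \<ge> 0" using d by (simp add: K_def L_def)
    then show ?thesis using True by simp
  qed
  have "bounded (range mb)"
    unfolding bounded_iff using bnd Fpos[of x0] by (auto simp: x0_def)
  then obtain m r where r: "strict_mono (r::nat \<Rightarrow> nat)" and lim: "(mb \<circ> r) \<longlonglongrightarrow> m"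
    using bounded_imp_convergent_subsequence by blast
  have "F m x \<ge> 0" if x: "x \<ge> l" for x
  proof (rule tendsto_lowerbound)
    show "(\<lambda>n. F ((mb \<circ> r) n) x) \<longlonglongrightarrow> F m x"
      unfolding F_def by (intro tendsto_intros lim)
    show "\<forall>\<^sub>F n in sequentially. 0 \<le> F ((mb \<circ> r) n) x"
      using eventually_ge_at_top[of "nat \<lceil>x - l\<rceil>"]
    proof eventually_elim
      case (elim n)
      have "x - l \<le> real n" using elim by linarith
      also have "real n \<le> real (r n)" using seq_suble[OF r] by simp
      finally show ?case using Fpos[OF x, of "r n"] by simp
    qed
  qed auto
  then show ?thesis unfolding weyl_cond_def F_def by blast
qed

lemma weyl_cond_bound:
  assumes y: "solves q l z y y1" and w: "weyl_cond l z y y1" and x: "x \<ge> l"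
  shows "\<bar>Im z\<bar> * (LINT t:{l..x}|lborel. (cmod (y t))\<^sup>2) \<le> sgn (Im z) * Im (y1 l * cnj (y l))"
proof -
  have "0 \<le> sgn (Im z) * Im (y1 x * cnj (y x))" using w x by (auto simp: weyl_cond_def)
  then show ?thesis unfolding green_im[OF y x] by (simp add: abs_sgn algebra_simps)
qed

lemma weyl_cond_sqint:
  assumes y: "solves q l z y y1" and w: "weyl_cond l z y y1" and z: "Im z \<noteq> 0"
  shows "sqint l y"
proof (rule sqint_continuousI[OF solves_continuous(1)[OF y]])
  fix b assume "b \<ge> l"
  from weyl_cond_bound[OF y w this]
  show "(LINT x:{l..b}|lborel. (cmod (y x))\<^sup>2) \<le> sgn (Im z) * Im (y1 l * cnj (y l)) / \<bar>Im z\<bar>"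
    using z by (simp add: field_simps)
qed

lemma norm_ac_le:
  assumes f: "ac l f f'" and x: "x \<ge> l"
  shows "cmod (f x) \<le> cmod (f l) + (LINT t:{l..x}|lborel. cmod (f' t))"
proof -
  have "cmod (f x) \<le> cmod (f l) + cmod (LINT t:{l..x}|lborel. f' t)"
    unfolding ac_eq[OF f x] by (rule norm_triangle_ineq)
  also have "cmod (LINT t:{l..x}|lborel. f' t) \<le> (LINT t:{l..x}|lborel. cmod (f' t))"
    by (rule set_integral_norm_bound[OF ac_int[OF f]])
  finally show ?thesis by simp
qed

text \<open>Variation of constants: \<open>y\<close> is a combination of \<open>th\<close> and
  \<open>ph\<close> with coefficients built from \<open>a\<close> and \<open>b\<close>, whose
  derivatives are \<open>\<zeta> - z\<close> times products of \<open>y\<close> with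
  \<open>ph\<close> and \<open>th\<close>. Hence \<open>p\<close> satisfies the inequality of
  \<open>integral_growth_bounded\<close>, and \<open>y\<close> is dominated by a multiple of the
  square integrable \<open>g\<close>.\<close>

lemma sqint_transfer:
  assumes ph: "solves q l z ph ph1" "sqint l ph" and th: "solves q l z th th1" "sqint l th"
    and W: "th l * ph1 l - th1 l * ph l \<noteq> 0"
    and y: "solves q l \<zeta> y y1"
  shows "sqint l y"
proof -
  define k where "k = th l * ph1 l - th1 l * ph l"
  define g where "g = (\<lambda>t. cmod (ph t) + cmod (th t))"
  define a where "a = (\<lambda>x. y x * ph1 x - y1 x * ph x)"
  define b where "b = (\<lambda>x. y x * th1 x - y1 x * th x)"
  note cy = solves_continuous(1)[OF y] note cph = solves_continuous(1)[OF ph(1)]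
  note cth = solves_continuous(1)[OF th(1)]
  have aca: "ac l a (\<lambda>t. (\<zeta> - z) * (y t * ph t))" unfolding a_def
    by (rule ac_cong[OF ac_wronskian[OF solvesD[OF y] solvesD[OF ph(1)]]]) (auto simp: algebra_simps)
  have acb: "ac l b (\<lambda>t. (\<zeta> - z) * (y t * th t))" unfolding b_def
    by (rule ac_cong[OF ac_wronskian[OF solvesD[OF y] solvesD[OF th(1)]]]) (auto simp: algebra_simps)
  define K where "K = cmod (\<zeta> - z)"
  define p where "p = (\<lambda>t. g t * cmod (y t))"
  have cg: "continuous_on {l..} g" unfolding g_def by (intro continuous_intros cph cth)
  have gnn: "g t \<ge> 0" for t by (simp add: g_def)
  have pi: "set_integrable lborel {l..x} p" for x
    unfolding p_def by (intro borel_integrable_atLeastAtMost' continuous_intros continuous_on_subset[OF cg] continuous_on_subset[OF cy]) auto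
  have abb: "cmod (f x) \<le> cmod (f l) + K * (LINT t:{l..x}|lborel. p t)"
    if f: "ac l f (\<lambda>t. (\<zeta> - z) * (y t * w t))" and w: "\<And>t. cmod (w t) \<le> g t" and x: "x \<ge> l" for f w x
  proof -
    have "(LINT t:{l..x}|lborel. cmod ((\<zeta> - z) * (y t * w t))) \<le> (LINT t:{l..x}|lborel. K * p t)"
    proof (rule set_integral_mono[OF set_integrable_norm[OF ac_int[OF f]]])
      show "set_integrable lborel {l..x} (\<lambda>t. K * p t)" using pi by simp
      show "cmod ((\<zeta> - z) * (y t * w t)) \<le> K * p t" for t
        using mult_left_mono[OF w[of t], of "K * cmod (y t)"] by (simp add: norm_mult K_def p_def mult.commute mult.left_commute)
    qed
    then show ?thesis using norm_ac_le[OF f x] by simp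
  qed
  define C where "C = cmod (a l) + cmod (b l)"
  have yle: "cmod (y x) \<le> g x * (C + 2 * K * (LINT t:{l..x}|lborel. p t)) / cmod k" if x: "x \<ge> l" for x
  proof -
    have "k = th x * ph1 x - th1 x * ph x" unfolding k_def using wronskian_const[OF th(1) ph(1) x] by simp
    then have "k * y x = a x * th x - b x * ph x" unfolding a_def b_def by algebra
    then have "cmod k * cmod (y x) \<le> cmod (a x) * cmod (th x) + cmod (b x) * cmod (ph x)"
      by (metis norm_mult norm_triangle_ineq4)
    also have "\<dots> \<le> cmod (a x) * g x + cmod (b x) * g x"
      by (intro add_mono mult_left_mono) (auto simp: g_def)
    also have "\<dots> \<le> (cmod (a l) + K * (LINT t:{l..x}|lborel. p t)) * g x
        + (cmod (b l) + K * (LINT t:{l..x}|lborel. p t)) * g x"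
      by (intro add_mono mult_right_mono abb[OF aca _ x] abb[OF acb _ x] gnn) (auto simp: g_def)
    finally have "cmod k * cmod (y x) \<le> g x * (C + 2 * K * (LINT t:{l..x}|lborel. p t))"
      by (simp add: C_def algebra_simps)
    moreover have "cmod k > 0" using W by (simp add: k_def)
    ultimately show ?thesis by (simp add: pos_le_divide_eq mult.commute)
  qed
  have gsq: "set_integrable lborel {l..} (\<lambda>t. (g t)\<^sup>2)"
  proof -
    have "sqint l (\<lambda>t. complex_of_real (cmod (ph t)) + complex_of_real (cmod (th t)))"
      by (intro sqint_add sqint_norm ph th)
    from sqint_integrable[OF this] show ?thesis
      unfolding g_def of_real_add[symmetric] norm_of_real power2_abs .
  qed
  have "\<exists>B\<ge>0. \<forall>x\<ge>l. (LINT t:{l..x}|lborel. p t) \<le> B"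
  proof (rule integral_growth_bounded[OF pi])
    show "set_integrable lborel {l..} (\<lambda>t. C / cmod k * (g t)\<^sup>2)"
      "set_integrable lborel {l..} (\<lambda>t. 2 * K / cmod k * (g t)\<^sup>2)"
      using gsq by simp_all
    fix x assume x: "x \<ge> l"
    have "p x \<le> g x * (g x * (C + 2 * K * (LINT t:{l..x}|lborel. p t)) / cmod k)"
      unfolding p_def by (rule mult_left_mono[OF yle[OF x, unfolded p_def] gnn])
    then show "p x \<le> C / cmod k * (g x)\<^sup>2 + 2 * K / cmod k * (g x)\<^sup>2 * (LINT t:{l..x}|lborel. p t)"
      by (simp add: power2_eq_square algebra_simps add_divide_distrib)
  qed (auto simp: p_def gnn C_def K_def)
  then obtain B where B: "B \<ge> 0" "\<And>x. x \<ge> l \<Longrightarrow> (LINT t:{l..x}|lborel. p t) \<le> B" by auto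
  show ?thesis
  proof (rule sqint_dominated[OF cy order_refl])
    show "sqint l (\<lambda>t. complex_of_real ((C + 2 * K * B) / cmod k) * (complex_of_real (cmod (ph t)) + complex_of_real (cmod (th t))))"
      by (intro sqint_cmult sqint_add sqint_norm ph th)
    fix x assume x: "x \<ge> l"
    have "cmod (y x) \<le> g x * (C + 2 * K * (LINT t:{l..x}|lborel. p t)) / cmod k" by (rule yle[OF x])
    also have "\<dots> \<le> g x * (C + 2 * K * B) / cmod k"
      using gnn B(2)[OF x] by (intro divide_right_mono mult_left_mono add_left_mono) (auto simp: K_def)
    also have "\<dots> = cmod (complex_of_real ((C + 2 * K * B) / cmod k) * (complex_of_real (cmod (ph x)) + complex_of_real (cmod (th x))))"
      unfolding of_real_add[symmetric] norm_mult norm_of_real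
      using B(1) by (simp add: g_def C_def K_def)
    finally show "cmod (y x) \<le> \<dots>" .
  qed
qed

section \<open>The maximal domain and the limit point case\<close>

text \<open>\<open>sec\<close> is an arbitrary choice, but the first derivative that goes with it is
  forced by continuity and \<open>dl\<close>, and the second one almost everywhere by
  \<open>ac_AE_unique\<close>. So any concrete second derivative may stand in for it.\<close>

lemma sec_ac:
  assumes y: "ac l y y1" and y1: "ac l y1 y2"
  shows "ac l y1 (sec l y)" and "AE x in lborel. x \<ge> l \<longrightarrow> sec l y x = y2 x"
proof -
  have "\<exists>y2 y1. rep l y y1 y2" using assms by (auto simp: rep_iff_ac)
  then have "\<exists>y1. rep l y y1 (sec l y)" unfolding sec_def by (rule someI_ex)
  then obtain u1 where u: "ac l y u1" "ac l u1 (sec l y)" by (auto simp: rep_iff_ac)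
  have "u1 x = y1 x" if "x \<ge> l" for x
    using ac_dl[OF u(1) ac_continuous[OF u(2)] that] ac_dl[OF y ac_continuous[OF y1] that] by simp
  then show a: "ac l y1 (sec l y)" by (intro ac_cong[OF u(2)]) auto
  show "AE x in lborel. x \<ge> l \<longrightarrow> sec l y x = y2 x" by (rule ac_AE_unique[OF a y1])
qed

lemma HplusD:
  assumes "y \<in> Hplus q l"
  shows "ac l y (dl l y)" "ac l (dl l y) (sec l y)" "sqint l y" "sqint l (lq q l y)"
proof -
  obtain y1 y2 where y: "ac l y y1" "ac l y1 y2"
    using assms by (auto simp: Hplus_def rep_iff_ac)
  have d: "dl l y x = y1 x" if "x \<ge> l" for x
    by (rule ac_dl[OF y(1) ac_continuous[OF y(2)] that])
  show "ac l y (dl l y)" by (rule ac_cong[OF y(1)]) (auto simp: d)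
  show "ac l (dl l y) (sec l y)" by (rule ac_cong[OF sec_ac(1)[OF y]]) (auto simp: d)
  show "sqint l y" "sqint l (lq q l y)" using assms by (auto simp: Hplus_def)
qed

lemma locsum_measurable:
  assumes "locsum l q" shows "q \<in> borel_measurable (restrict_space lborel {l..})"
  using assms set_borel_measurable_atLeastI[of l q]
  by (simp add: locsum_def set_borel_measurable_iff_restrict)

lemma lq_measurable:
  assumes q: "locsum l q" and y: "ac l y y1" and y1: "ac l y1 y2"
  shows "lq q l y \<in> borel_measurable (restrict_space lborel {l..})"
proof -
  have "sec l y \<in> borel_measurable (restrict_space lborel {l..})"
    using set_borel_measurable_atLeastI[OF ac_int[OF sec_ac(1)[OF y y1]]]
    by (simp add: set_borel_measurable_iff_restrict)
  moreover have "y \<in> borel_measurable (restrict_space lborel {l..})"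
    by (rule continuous_measurable_atLeast[OF ac_continuous[OF y]])
  ultimately show ?thesis
    unfolding lq_def using locsum_measurable[OF q] by measurable
qed

text \<open>Elements of \<open>Hplus\<close> are normalised to vanish left of \<open>l\<close>,
  whereas solutions are unrestricted there.\<close>

definition trunc :: "real \<Rightarrow> (real \<Rightarrow> complex) \<Rightarrow> real \<Rightarrow> complex" where
  "trunc l y x = (if x < l then 0 else y x)"

lemma trunc_eq [simp]: "x \<ge> l \<Longrightarrow> trunc l y x = y x"
  by (simp add: trunc_def)

lemma trunc_solves: "solves q l z y y1 \<Longrightarrow> solves q l z (trunc l y) y1"
  unfolding solves_def using ac_cong[of l y y1 "trunc l y" y1]
    ac_cong[of l y1 "\<lambda>t. (complex_of_real (q t) - z) * y t" y1 "\<lambda>t. (complex_of_real (q t) - z) * trunc l y t"]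
  by auto

lemma trunc_Hplus:
  assumes q: "locsum l q" and y: "solves q l z y y1" and s: "sqint l y"
  shows "trunc l y \<in> Hplus q l"
    and "AE x in lborel. x \<ge> l \<longrightarrow> lq q l (trunc l y) x = z * y x"
    and "dl l (trunc l y) l = y1 l"
proof -
  note t = solvesD[OF trunc_solves[OF y]]
  have e: "AE x in lborel. x \<ge> l \<longrightarrow> z * y x = lq q l (trunc l y) x"
    using sec_ac(2)[OF t] by eventually_elim (auto simp: lq_def algebra_simps)
  then show "AE x in lborel. x \<ge> l \<longrightarrow> lq q l (trunc l y) x = z * y x"
    by eventually_elim auto
  have "sqint l (lq q l (trunc l y))"
    by (rule sqint_AE_cong[OF sqint_cmult[OF s] e lq_measurable[OF q t]])
  moreover have "sqint l (trunc l y)" by (rule sqint_cong[OF s]) auto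
  moreover have "\<exists>y1 y2. rep l (trunc l y) y1 y2" unfolding rep_iff_ac using t by blast
  moreover have "trunc l y x = 0" if "x < l" for x using that by (simp add: trunc_def)
  ultimately show "trunc l y \<in> Hplus q l" unfolding Hplus_def by blast
  show "dl l (trunc l y) l = y1 l" by (rule solves_dl[OF trunc_solves[OF y] order_refl])
qed

text \<open>By \<open>sqint_transfer\<close>, two square integrable solutions at \<open>z\<close>
  put both basis solutions \<open>u\<close>, \<open>v\<close> at \<i> into the kernel. If that
  kernel is one-dimensional, both are multiples of one function, which is nonzero at
  \<open>l\<close> because \<open>v\<close> is. Then \<open>u\<close>, zero at \<open>l\<close>,
  vanishes on the half-line, against \<open>dirichlet_nonzero\<close>.\<close>

lemma def11_limit_point:
  assumes q: "locsum l q" and d: "def11 q l"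
    and ph: "solves q l z ph ph1" and th: "solves q l z th th1"
    and W: "th l * ph1 l - th1 l * ph l \<noteq> 0"
  shows "\<not> (sqint l ph \<and> sqint l th)"
proof
  assume L2: "sqint l ph \<and> sqint l th"
  obtain u u1 where u: "solves q l \<i> u u1" "u l = 0" "u1 l = 1" using solves_exists[OF q] .
  obtain v v1 where v: "solves q l \<i> v v1" "v l = 1" "v1 l = 0" using solves_exists[OF q] .
  have "sqint l u" "sqint l v" using sqint_transfer[OF ph _ th _ W] L2 u v by blast+
  then have k: "trunc l u \<in> kerset q l \<i>" "trunc l v \<in> kerset q l \<i>"
    using trunc_Hplus[OF q u(1)] trunc_Hplus[OF q v(1)] by (auto simp: kerset_def elim: eventually_mono)
  obtain y0 where y0: "\<And>y. y \<in> kerset q l \<i> \<Longrightarrow> \<exists>c. \<forall>x\<ge>l. y x = c * y0 x"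
    using d unfolding def11_def dim_one_def by blast
  obtain a b where a: "\<And>x. x \<ge> l \<Longrightarrow> trunc l u x = a * y0 x" and b: "\<And>x. x \<ge> l \<Longrightarrow> trunc l v x = b * y0 x"
    using y0[OF k(1)] y0[OF k(2)] by blast
  have "y0 l \<noteq> 0" using b[of l] v by auto
  then have "a = 0" using a[of l] u by auto
  then have "u (l+1) = 0" using a[of "l+1"] by auto
  then show False using dirichlet_nonzero[OF u(1), of "l+1"] u by auto
qed

text \<open>A coefficient exists by \<open>weyl_exists\<close>. Two different ones would make a
  nonzero multiple of \<open>ph\<close> square integrable, and then \<open>th\<close> as well. So
  the definite description in \<open>m_inf\<close> denotes, and it denotes the coefficient with the
  Weyl condition.\<close>

lemma m_inf_weyl:
  assumes q: "locsum l q" and d: "def11 q l" and z: "Im z \<noteq> 0"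
    and ph: "solves q l z ph ph1" "ph l = 0" "ph1 l = 1"
    and th: "solves q l z th th1" "th l = -1" "th1 l = 0"
  shows "weyl_cond l z (\<lambda>x. th x + m_inf q l z * ph x) (\<lambda>x. th1 x + m_inf q l z * ph1 x)"
    and "\<not> sqint l ph"
proof -
  obtain m where m: "weyl_cond l z (\<lambda>x. th x + m * ph x) (\<lambda>x. th1 x + m * ph1 x)"
    using weyl_exists[OF ph th(1) z] by blast
  have sv: "solves q l z (\<lambda>x. th x + m * ph x) (\<lambda>x. th1 x + m * ph1 x)"
    using solves_lincomb[OF th(1) ph(1), of 1 m] by simp
  have s: "sqint l (\<lambda>x. th x + m * ph x)" by (rule weyl_cond_sqint[OF sv m z])
  show ns: "\<not> sqint l ph"
  proof
    assume p: "sqint l ph"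
    have "sqint l (\<lambda>x. (th x + m * ph x) + (-m) * ph x)"
      by (intro sqint_add sqint_cmult s p)
    then have "sqint l th" by simp
    then show False using def11_limit_point[OF q d ph(1) th(1)] p ph th by simp
  qed
  have "m_inf q l z = m"
    unfolding m_inf_def
  proof (rule the_equality)
    show "\<forall>phi1 phi2. sol q l z phi1 \<and> phi1 l = 0 \<and> dl l phi1 l = 1 \<and>
        sol q l z phi2 \<and> phi2 l = - 1 \<and> dl l phi2 l = 0 \<longrightarrow> sqint l (\<lambda>x. phi2 x + m * phi1 x)"
    proof (intro allI impI, elim conjE)
      fix u v assume u: "sol q l z u" "u l = 0" "dl l u l = 1" and v: "sol q l z v" "v l = -1" "dl l v l = 0"
      have "u x = ph x" if "x \<ge> l" for x
        using solves_unique(1)[OF q _ ph(1) _ _ that, of u "dl l u"] u ph by (simp add: solves_iff_sol)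
      moreover have "v x = th x" if "x \<ge> l" for x
        using solves_unique(1)[OF q _ th(1) _ _ that, of v "dl l v"] v th by (simp add: solves_iff_sol)
      ultimately show "sqint l (\<lambda>x. v x + m * u x)" by (intro sqint_cong[OF s]) auto
    qed
  next
    fix m' assume "\<forall>phi1 phi2. sol q l z phi1 \<and> phi1 l = 0 \<and> dl l phi1 l = 1 \<and>
        sol q l z phi2 \<and> phi2 l = - 1 \<and> dl l phi2 l = 0 \<longrightarrow> sqint l (\<lambda>x. phi2 x + m' * phi1 x)"
    then have s': "sqint l (\<lambda>x. th x + m' * ph x)"
      using solves_sol[OF ph(1)] solves_sol[OF th(1)] solves_dl[OF ph(1), of l] solves_dl[OF th(1), of l] ph th by simp
    show "m' = m"
    proof (rule ccontr)
      assume ne: "m' \<noteq> m"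
      have "sqint l (\<lambda>x. 1/(m' - m) * ((th x + m' * ph x) + (-1) * (th x + m * ph x)))"
        by (intro sqint_cmult sqint_add s s')
      moreover have "1/(m' - m) * ((th x + m' * ph x) + (-1) * (th x + m * ph x)) = ph x" for x
        using ne by (simp add: field_simps)
      ultimately show False using ns by simp
    qed
  qed
  then show "weyl_cond l z (\<lambda>x. th x + m_inf q l z * ph x) (\<lambda>x. th1 x + m_inf q l z * ph1 x)"
    using m by simp
qed

text \<open>If the boundary form had a nonzero limit, the Dirichlet solution could be expressed through
  \<open>w\<close> and \<open>\<psi>\<close> by variation of constants, and would be square integrable by \<open>integral_growth_bounded\<close>.\<close>

lemma boundary_form_vanishes:
  assumes q: "locsum l q" and w: "w \<in> Hplus q l"
    and ps: "solves q l z ps ps1" "sqint l ps"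
    and ph: "solves q l z ph ph1" "\<not> sqint l ph"
    and W: "ps l * ph1 l - ps1 l * ph l \<noteq> 0"
  shows "((\<lambda>x. w x * ps1 x - dl l w x * ps x) \<longlongrightarrow> 0) at_top"
proof -
  define k where "k = ps l * ph1 l - ps1 l * ph l"
  define f where "f = (\<lambda>x. lq q l w x + (-z) * w x)"
  note wd = HplusD[OF w]
  have fs: "sqint l f" unfolding f_def by (intro sqint_add sqint_cmult wd)
  define a where "a = (\<lambda>x. w x * ph1 x - dl l w x * ph x)"
  define b where "b = (\<lambda>x. w x * ps1 x - dl l w x * ps x)"
  have acg: "ac l (\<lambda>x. w x * u1 x - dl l w x * u x) (\<lambda>t. f t * u t)" if "solves q l z u u1" for u u1
    by (rule ac_cong[OF ac_wronskian[OF wd(1,2) solvesD[OF that]]])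
      (auto simp: f_def lq_def algebra_simps)
  have aca: "ac l a (\<lambda>t. f t * ph t)" and acb: "ac l b (\<lambda>t. f t * ps t)"
    unfolding a_def b_def using acg ps ph by blast+
  have "((\<lambda>x. b l + (LINT t:{l..x}|lborel. f t * ps t)) \<longlongrightarrow> b l + (LINT t:{l..}|lborel. f t * ps t)) at_top"
    by (intro tendsto_add tendsto_const tendsto_set_lebesgue_integral_at_top sqint_mult_integrable fs ps) auto
  moreover have "\<forall>\<^sub>F x in at_top. b l + (LINT t:{l..x}|lborel. f t * ps t) = b x"
    using eventually_ge_at_top[of l] by eventually_elim (use ac_eq[OF acb] in metis)
  ultimately obtain c where c: "(b \<longlongrightarrow> c) at_top" using Lim_transform_eventually by blast
  have "c = 0"
  proof (rule ccontr)
    assume c0: "c \<noteq> 0"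
    have "\<forall>\<^sub>F x in at_top. cmod (b x) > cmod c / 2"
      by (rule order_tendstoD(1)[OF tendsto_norm[OF c]]) (use c0 in auto)
    then obtain X1 where X1: "\<And>x. x \<ge> X1 \<Longrightarrow> cmod (b x) > cmod c / 2"
      by (auto simp: eventually_at_top_linorder)
    define X where "X = max l X1"
    define g where "g = 2 / cmod c"
    have g: "g > 0" using c0 by (simp add: g_def)
    define p where "p = (\<lambda>t. cmod (f t) * cmod (ph t))"
    have pi: "set_integrable lborel {l..x} p" for x
      using set_integrable_norm[OF ac_int[OF aca, of x]] by (simp add: p_def norm_mult)
    have ab: "cmod (a x) \<le> cmod (a l) + (LINT t:{l..x}|lborel. p t)" if "x \<ge> l" for x
      using norm_ac_le[OF aca that] by (simp add: p_def norm_mult)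
    have phle: "cmod (ph x) \<le> g * (cmod (ps x) * (cmod (a l) + (LINT t:{l..x}|lborel. p t)) + cmod k * cmod (w x))"
      if x: "x \<ge> X" for x
    proof -
      have xl: "x \<ge> l" using x by (simp add: X_def)
      have "k = ps x * ph1 x - ps1 x * ph x" unfolding k_def using wronskian_const[OF ps(1) ph(1) xl] by simp
      \<comment> \<open>A three-term identity between Wronskians. Beyond \<open>X\<close> the factor
        \<open>b\<close> stays away from zero, so the identity can be solved for
        \<open>ph\<close>.\<close>
      then have "b x * ph x = ps x * a x - k * w x" unfolding a_def b_def by algebra
      then have "cmod (b x) * cmod (ph x) \<le> cmod (ps x) * cmod (a x) + cmod k * cmod (w x)"
        by (metis norm_mult norm_triangle_ineq4)
      also have "\<dots> \<le> cmod (ps x) * (cmod (a l) + (LINT t:{l..x}|lborel. p t)) + cmod k * cmod (w x)"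
        by (intro add_right_mono mult_left_mono ab xl) auto
      finally have 1: "cmod (b x) * cmod (ph x) \<le> cmod (ps x) * (cmod (a l) + (LINT t:{l..x}|lborel. p t)) + cmod k * cmod (w x)" .
      have "cmod c / 2 * cmod (ph x) \<le> cmod (b x) * cmod (ph x)"
        using X1[of x] x by (intro mult_right_mono) (auto simp: X_def)
      with 1 have "cmod c / 2 * cmod (ph x) \<le> cmod (ps x) * (cmod (a l) + (LINT t:{l..x}|lborel. p t)) + cmod k * cmod (w x)"
        by linarith
      from mult_left_mono[OF this, of g] show ?thesis using c0 by (simp add: g_def)
    qed
    have fps: "set_integrable lborel {l..} (\<lambda>t. cmod (f t) * cmod (ps t))"
      "set_integrable lborel {l..} (\<lambda>t. cmod (f t) * cmod (w t))"
      using set_integrable_norm[OF sqint_mult_integrable[OF fs ps(2)]]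
        set_integrable_norm[OF sqint_mult_integrable[OF fs wd(3)]] by (simp_all add: norm_mult)
    have "\<exists>B\<ge>0. \<forall>x\<ge>l. (LINT t:{l..x}|lborel. p t) \<le> B"
    proof (rule integral_growth_bounded[OF pi])
      show "set_integrable lborel {l..} (\<lambda>t. g * (cmod (a l) * (cmod (f t) * cmod (ps t)) + cmod k * (cmod (f t) * cmod (w t))))"
        using fps by (intro set_integrable_mult_right set_integral_add) auto
      show "set_integrable lborel {l..} (\<lambda>t. g * (cmod (f t) * cmod (ps t)))"
        using fps by simp
      show "X \<ge> l" by (simp add: X_def)
      fix x assume x: "x \<ge> X"
      have "p x \<le> cmod (f x) * (g * (cmod (ps x) * (cmod (a l) + (LINT t:{l..x}|lborel. p t)) + cmod k * cmod (w x)))"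
        unfolding p_def by (rule mult_left_mono[OF phle[OF x, unfolded p_def]]) auto
      then show "p x \<le> g * (cmod (a l) * (cmod (f x) * cmod (ps x)) + cmod k * (cmod (f x) * cmod (w x)))
         + g * (cmod (f x) * cmod (ps x)) * (LINT t:{l..x}|lborel. p t)"
        by (simp add: algebra_simps)
    qed (use g in \<open>auto simp: p_def\<close>)
    then obtain B where B: "B \<ge> 0" "\<And>x. x \<ge> l \<Longrightarrow> (LINT t:{l..x}|lborel. p t) \<le> B" by auto
    have "sqint l ph"
    proof (rule sqint_dominated[OF solves_continuous(1)[OF ph(1)]])
      show "X \<ge> l" by (simp add: X_def)
      show "sqint l (\<lambda>x. complex_of_real (g * (cmod (a l) + B)) * complex_of_real (cmod (ps x))
          + complex_of_real (g * cmod k) * complex_of_real (cmod (w x)))"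
        by (intro sqint_add sqint_cmult sqint_norm ps wd)
      fix x assume x: "x \<ge> X"
      have xl: "x \<ge> l" using x by (simp add: X_def)
      have "cmod (ph x) \<le> g * (cmod (ps x) * (cmod (a l) + (LINT t:{l..x}|lborel. p t)) + cmod k * cmod (w x))"
        by (rule phle[OF x])
      also have "\<dots> \<le> g * (cmod (ps x) * (cmod (a l) + B) + cmod k * cmod (w x))"
        using g B(2)[OF xl] by (intro mult_left_mono add_right_mono add_left_mono) auto
      also have "\<dots> = cmod (complex_of_real (g * (cmod (a l) + B)) * complex_of_real (cmod (ps x))
          + complex_of_real (g * cmod k) * complex_of_real (cmod (w x)))"
        unfolding of_real_mult[symmetric] of_real_add[symmetric] norm_of_real
        using g B(1) by (simp add: algebra_simps)
      finally show "cmod (ph x) \<le> \<dots>" .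
    qed
    then show False using ph by simp
  qed
  then show ?thesis using c by (simp add: b_def)
qed

section \<open>The impedance function\<close>

lemma l2ip_cnj: "cnj (l2ip l f g) = l2ip l g f"
  by (simp add: l2ip_def set_integral_cnj[symmetric] mult.commute)

lemma weyl_solution_exists:
  assumes q: "locsum l q" and d: "def11 q l" and z: "Im z \<noteq> 0"
  obtains ph ph1 ps ps1 where
    "solves q l z ph ph1" "ph l = 0" "ph1 l = 1" "\<not> sqint l ph"
    "solves q l z ps ps1" "ps l = -1" "ps1 l = m_inf q l z" "weyl_cond l z ps ps1" "sqint l ps"
proof -
  obtain ph ph1 where ph: "solves q l z ph ph1" "ph l = 0" "ph1 l = 1" using solves_exists[OF q] .
  obtain th th1 where th: "solves q l z th th1" "th l = -1" "th1 l = 0" using solves_exists[OF q] .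
  note w = m_inf_weyl[OF q d z ph th]
  have sv: "solves q l z (\<lambda>x. th x + m_inf q l z * ph x) (\<lambda>x. th1 x + m_inf q l z * ph1 x)"
    using solves_lincomb[OF th(1) ph(1), of 1 "m_inf q l z"] by simp
  show ?thesis
    by (rule that[OF ph w(2) sv _ _ w(1) weyl_cond_sqint[OF sv w(1) z]]) (use ph th in auto)
qed

text \<open>At \<open>l\<close> the Weyl form of \<open>ps\<close> is minus \<open>Im m\<close>
  times the sign of \<open>Im z\<close>, and it dominates a positive norm integral. This is the
  Herglotz property of -m; it is what permits division by m and by r m - 1 for real r.\<close>

lemma m_inf_nonreal:
  assumes q: "locsum l q" and d: "def11 q l" and z: "Im z \<noteq> 0"
  shows "Im (m_inf q l z) \<noteq> 0"
proof -
  obtain ph ph1 ps ps1 where ps: "solves q l z ps ps1" "ps l = -1" "ps1 l = m_inf q l z" "weyl_cond l z ps ps1"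
    using weyl_solution_exists[OF q d z] .
  have "\<bar>Im z\<bar> * (LINT t:{l..l+1}|lborel. (cmod (ps t))\<^sup>2) \<le> sgn (Im z) * Im (ps1 l * cnj (ps l))"
    by (rule weyl_cond_bound[OF ps(1,4)]) simp
  moreover have "(LINT t:{l..l+1}|lborel. (cmod (ps t))\<^sup>2) > 0"
    by (rule norm_sq_integral_pos[OF ps(1)]) (use ps in auto)
  ultimately have "0 < sgn (Im z) * Im (ps1 l * cnj (ps l))"
    using z by (metis mult_pos_pos zero_less_abs_iff order_less_le_trans)
  then show ?thesis using ps by auto
qed

text \<open>Green's formula on the half-line: the boundary term at infinity disappears and the one
  at \<open>l\<close> survives. The first identity is just the equation for \<open>y\<close>;
  truncation is there because only the truncated solution belongs to \<open>Hplus\<close>.\<close>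

lemma green_weyl:
  assumes q: "locsum l q" and d: "def11 q l" and z: "Im z \<noteq> 0"
    and y: "solves q l z y y1" "sqint l y" and w: "w \<in> Hplus q l"
  shows "l2ip l w (lq q l (trunc l y)) = cnj z * l2ip l w (trunc l y)"
    and "l2ip l (lq q l w) (trunc l y) = cnj z * l2ip l w (trunc l y) - (w l * cnj (y1 l) - dl l w l * cnj (y l))"
proof -
  note wd = HplusD[OF w] note t = trunc_Hplus[OF q y]
  have Y: "l2ip l f (trunc l y) = (LINT x:{l..}|lborel. f x * cnj (y x))" for f
    unfolding l2ip_def by (rule set_lebesgue_integral_cong) auto
  have "l2ip l w (lq q l (trunc l y)) = (LINT x:{l..}|lborel. cnj z * (w x * cnj (y x)))"
    unfolding l2ip_def set_lebesgue_integral_def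
  proof (rule integral_cong_AE)
    show "(\<lambda>x. indicat_real {l..} x *\<^sub>R (w x * cnj (lq q l (trunc l y) x))) \<in> borel_measurable lborel"
      using sqint_mult_integrable[OF wd(3) sqint_cnj[OF HplusD(4)[OF t(1)]]] by (auto simp: set_integrable_def)
    have "set_integrable lborel {l..} (\<lambda>x. cnj z * (w x * cnj (y x)))"
      by (intro set_integrable_mult_right sqint_mult_integrable[OF wd(3) sqint_cnj[OF y(2)]])
    then show "(\<lambda>x. indicat_real {l..} x *\<^sub>R (cnj z * (w x * cnj (y x)))) \<in> borel_measurable lborel"
      by (auto simp: set_integrable_def)
    show "AE x in lborel. indicat_real {l..} x *\<^sub>R (w x * cnj (lq q l (trunc l y) x)) =
        indicat_real {l..} x *\<^sub>R (cnj z * (w x * cnj (y x)))"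
      using t(2) by eventually_elim (auto split: split_indicator)
  qed
  also have "\<dots> = cnj z * l2ip l w (trunc l y)" by (simp add: Y)
  finally show "l2ip l w (lq q l (trunc l y)) = cnj z * l2ip l w (trunc l y)" .
  obtain ph ph1 ps ps1 where ph: "solves q l z ph ph1" "ph l = 0" "ph1 l = 1" "\<not> sqint l ph"
    and ps: "solves q l z ps ps1" "ps l = -1" "ps1 l = m_inf q l z" "sqint l ps"
    using weyl_solution_exists[OF q d z] .
  define b where "b = (\<lambda>x. w x * cnj (y1 x) - dl l w x * cnj (y x))"
  define f where "f = (\<lambda>x. lq q l w x + (- cnj z) * w x)"
  have fs: "sqint l f" unfolding f_def by (intro sqint_add sqint_cmult wd)
  have acb: "ac l b (\<lambda>t. f t * cnj (y t))" unfolding b_def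
    by (rule ac_cong[OF ac_wronskian[OF wd(1,2) solvesD[OF solves_cnj[OF y(1)]]]])
      (auto simp: f_def lq_def algebra_simps)
  have lim: "(b \<longlongrightarrow> 0) at_top"
  proof (cases "y l = 0 \<and> y1 l = 0")
    case True
    have zs: "solves q l z (\<lambda>x. 0) (\<lambda>x. 0)" by (simp add: solves_def)
    have "y x = 0" "y1 x = 0" if "x \<ge> l" for x
      using solves_unique[OF q y(1) zs _ _ that] True by auto
    then have "\<forall>\<^sub>F x in at_top. b x = 0"
      using eventually_ge_at_top[of l] by (elim eventually_mono) (simp add: b_def)
    then show ?thesis by (rule tendsto_eventually)
  next
    case False
    \<comment> \<open>If \<open>y l\<close> were zero, \<open>y\<close> would be a multiple of
      \<open>ph\<close>, which is not square integrable. So the conjugates of \<open>y\<close> and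
      \<open>ph\<close> have a nonzero Wronskian, and \<open>boundary_form_vanishes\<close> applies
      at \<open>cnj z\<close>.\<close>
    have n: "y l \<noteq> 0"
    proof
      assume y0: "y l = 0"
      have sc: "solves q l z (\<lambda>x. y1 l * ph x + 0 * ph x) (\<lambda>x. y1 l * ph1 x + 0 * ph1 x)"
        by (rule solves_lincomb[OF ph(1) ph(1)])
      have "y x = y1 l * ph x" if "x \<ge> l" for x
        using solves_unique(1)[OF q y(1) sc _ _ that] y0 ph by simp
      then have "1 / y1 l * y x = ph x" if "x \<ge> l" for x using that False y0 by simp
      then have "sqint l ph" using sqint_cong[OF sqint_cmult[OF y(2), of "1 / y1 l"]] by blast
      then show False using ph by simp
    qed
    show ?thesis unfolding b_def
    proof (rule boundary_form_vanishes[OF q w solves_cnj[OF y(1)] sqint_cnj[OF y(2)] solves_cnj[OF ph(1)]])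
      show "\<not> sqint l (\<lambda>x. cnj (ph x))" using sqint_cnj[of l "\<lambda>x. cnj (ph x)"] ph by auto
      show "cnj (y l) * cnj (ph1 l) - cnj (y1 l) * cnj (ph l) \<noteq> 0" using n ph by simp
    qed
  qed
  have "((\<lambda>x. b l + (LINT t:{l..x}|lborel. f t * cnj (y t))) \<longlongrightarrow> b l + (LINT t:{l..}|lborel. f t * cnj (y t))) at_top"
    by (intro tendsto_add tendsto_const tendsto_set_lebesgue_integral_at_top sqint_mult_integrable fs sqint_cnj y) auto
  moreover have "\<forall>\<^sub>F x in at_top. b l + (LINT t:{l..x}|lborel. f t * cnj (y t)) = b x"
    using eventually_ge_at_top[of l] by eventually_elim (use ac_eq[OF acb] in metis)
  ultimately have "(b \<longlongrightarrow> b l + (LINT t:{l..}|lborel. f t * cnj (y t))) at_top" using Lim_transform_eventually by blast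
  then have 0: "b l + (LINT t:{l..}|lborel. f t * cnj (y t)) = 0"
    using lim tendsto_unique trivial_limit_at_top_linorder by blast
  have "(LINT t:{l..}|lborel. f t * cnj (y t)) = (LINT t:{l..}|lborel. lq q l w t * cnj (y t) - cnj z * (w t * cnj (y t)))"
    by (simp add: f_def algebra_simps)
  also have "\<dots> = l2ip l (lq q l w) (trunc l y) - cnj z * l2ip l w (trunc l y)"
    unfolding Y using sqint_mult_integrable[OF wd(4) sqint_cnj[OF y(2)]]
      sqint_mult_integrable[OF wd(3) sqint_cnj[OF y(2)]] by (subst set_integral_diff) auto
  finally have "l2ip l (lq q l w) (trunc l y) = cnj z * l2ip l w (trunc l y) + (LINT t:{l..}|lborel. f t * cnj (y t))"
    by simp
  also have "(LINT t:{l..}|lborel. f t * cnj (y t)) = - b l" using 0 by (simp add: add_eq_0_iff)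
  finally show "l2ip l (lq q l w) (trunc l y) = cnj z * l2ip l w (trunc l y) - (w l * cnj (y1 l) - dl l w l * cnj (y l))"
    by (simp add: b_def)
qed

text \<open>The general impedance formula at h = \<i>, where Re h = 0 and |h| = 1; the value for
  infinite mu is the limit as r tends to infinity.\<close>

definition impedance_value :: "real option \<Rightarrow> complex \<Rightarrow> complex" where
  "impedance_value mu m = (case mu of None \<Rightarrow> 1 / m
     | Some r \<Rightarrow> (m + complex_of_real r) / (complex_of_real r * m - 1))"

text \<open>The pairing \<open>(w, (Re A - z) y)\<close> of the definition of the impedance.\<close>

definition re_form :: "(real \<Rightarrow> real) \<Rightarrow> real \<Rightarrow> real option \<Rightarrow> complex \<Rightarrow> (real \<Rightarrow> complex) \<Rightarrow> (real \<Rightarrow> complex) \<Rightarrow> complex" where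
  "re_form q l mu z y w = (schr_stateop q l mu \<i> y w + cnj (schr_stateop q l mu \<i> w y)) / 2 - cnj z * l2ip l w y"

text \<open>Symmetry of the real part of the state-space operator. It replaces an injectivity
  argument when the impedance value is shown to be unique.\<close>

lemma re_form_cnj: "cnj (re_form q l mu z y w) = re_form q l mu (cnj z) w y"
  by (simp add: re_form_def l2ip_cnj algebra_simps add_divide_distrib)

text \<open>Here \<open>w\<close>, \<open>w1\<close> are the boundary data of the test function and
  \<open>Y\<close>, \<open>Y1\<close> the conjugated data of the solution. All boundary terms of the
  symmetrised operator factor through \<open>r * w - w1\<close>, the functional behind
  \<open>schr_g\<close>, so that the equation for y becomes one scalar condition.\<close>

lemma boundary_identity:
  fixes r :: real and w w1 Y Y1 :: complex
  shows "(w1 * Y - w * Y1) / 2 - ((Y1 + \<i> * Y) / (r + \<i>) * (r * w - w1) + (w1 - \<i> * w) / (r - \<i>) * (r * Y - Y1)) / 2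
     = - (r * w - w1) * (r * Y1 + Y) / (r\<^sup>2 + 1)"
proof -
  have nz: "complex_of_real r + \<i> \<noteq> 0" "complex_of_real r - \<i> \<noteq> 0"
    by (auto simp: complex_eq_iff)
  have D: "complex_of_real r ^ 2 + 1 = (r + \<i>) * (r - \<i>)"
    by (simp add: algebra_simps power2_eq_square)
  then have Dn: "complex_of_real r ^ 2 + 1 \<noteq> 0" using nz by simp
  have 1: "a / (r + \<i>) * b = a * (r - \<i>) * b / (complex_of_real r ^ 2 + 1)"
    "a / (r - \<i>) * b = a * (r + \<i>) * b / (complex_of_real r ^ 2 + 1)" for a b
    using nz unfolding D by simp_all
  have gen: "A / 2 - (N / E + N' / E) / 2 = F / E" if "E \<noteq> 0" "E * A - (N + N') = 2 * F" for A N N' E F :: complex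
    using that by (simp add: field_simps)
  have ii: "\<i> * \<i> = -1" by simp
  have "(complex_of_real r ^ 2 + 1) * (w1 * Y - w * Y1)
     - ((Y1 + \<i> * Y) * (r - \<i>) * (r * w - w1) + (w1 - \<i> * w) * (r + \<i>) * (r * Y - Y1))
     = 2 * (- (r * w - w1) * (r * Y1 + Y))"
    using ii by algebra
  from gen[OF Dn this] show ?thesis unfolding 1 by simp
qed

lemma re_form_weyl:
  assumes q: "locsum l q" and d: "def11 q l" and z: "Im z \<noteq> 0"
  obtains y where "y \<in> Hplus q l" "\<And>w. w \<in> Hplus q l \<Longrightarrow> re_form q l mu z y w = schr_g l mu \<i> w"
    "schr_g l mu \<i> y = impedance_value mu (m_inf q l z)"
proof -
  obtain ph ph1 ps ps1 where ph: "solves q l z ph ph1" "ph l = 0" "ph1 l = 1" "\<not> sqint l ph"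
    and ps: "solves q l z ps ps1" "ps l = -1" "ps1 l = m_inf q l z" "sqint l ps"
    using weyl_solution_exists[OF q d z] .
  define m where "m = m_inf q l z"
  have m: "Im m \<noteq> 0" unfolding m_def by (rule m_inf_nonreal[OF q d z])
  \<comment> \<open>The data of \<open>y\<close> at \<open>l\<close> are \<open>- c\<close> and
    \<open>c * m\<close>. The scalar condition left over is c (r m - 1) = -|r - \<i>|, and c m = -1
    for infinite mu; both are solvable since \<open>m\<close> is not real.\<close>
  define c where "c = (case mu of None \<Rightarrow> - 1 / m | Some r \<Rightarrow> - complex_of_real (sqrt (r\<^sup>2 + 1)) / (r * m - 1))"
  have sc: "solves q l z (\<lambda>x. c * ps x) (\<lambda>x. c * ps1 x)"
    using solves_lincomb[OF ps(1) ps(1), of c 0] by simp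
  have s: "sqint l (\<lambda>x. c * ps x)" by (rule sqint_cmult[OF ps(4)])
  define y where "y = trunc l (\<lambda>x. c * ps x)"
  note t = trunc_Hplus[OF q sc s, folded y_def]
  have yl: "y l = - c" "dl l y l = c * m" using t(3) ps by (simp_all add: y_def m_def)
  show ?thesis
  proof (rule that[OF t(1)])
    fix w assume w: "w \<in> Hplus q l"
    note g = green_weyl[OF q d z sc s w, folded y_def]
    have G: "(l2ip l w (lq q l y) + l2ip l (lq q l w) y) / 2 - cnj z * l2ip l w y
       = (dl l w l * cnj (y l) - w l * cnj (dl l y l)) / 2"
      unfolding g using yl ps by (simp add: m_def field_simps)
    show "re_form q l mu z y w = schr_g l mu \<i> w"
    proof (cases mu)
      case None
      have "re_form q l mu z y w = (l2ip l w (lq q l y) + l2ip l (lq q l w) y) / 2 - cnj z * l2ip l w y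
        - (cnj (dl l y l - \<i> * y l) * w l + (dl l w l - \<i> * w l) * cnj (y l)) / 2"
        by (simp add: re_form_def schr_stateop_def None l2ip_cnj field_simps)
      also have "\<dots> = - w l * cnj (dl l y l)"
        unfolding G by (simp add: field_simps)
      also have "\<dots> = w l" using m by (auto simp: yl None c_def)
      finally show ?thesis by (simp add: schr_g_def None)
    next
      case (Some r)
      define R where "R = sqrt (r\<^sup>2 + 1)"
      have R: "R > 0" "R\<^sup>2 = r\<^sup>2 + 1" by (auto simp: R_def add_nonneg_pos)
      have cm: "cmod (complex_of_real r - \<i>) = R" by (simp add: R_def cmod_def)
      have nz: "complex_of_real r * m - 1 \<noteq> 0"
        using m by (cases "r = 0") (auto simp: complex_eq_iff)
      have "re_form q l mu z y w = (l2ip l w (lq q l y) + l2ip l (lq q l w) y) / 2 - cnj z * l2ip l w y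
        - (cnj ((dl l y l - \<i> * y l) / (r - \<i>)) * (r * w l - dl l w l)
           + (dl l w l - \<i> * w l) / (r - \<i>) * cnj (r * y l - dl l y l)) / 2"
        by (simp add: re_form_def schr_stateop_def Some l2ip_cnj diff_divide_distrib add_divide_distrib)
      also have "\<dots> = - (r * w l - dl l w l) * (r * cnj (dl l y l) + cnj (y l)) / (r\<^sup>2 + 1)"
        unfolding G using boundary_identity[of "dl l w l" "cnj (y l)" "w l" "cnj (dl l y l)" r] by simp
      also have "r * cnj (dl l y l) + cnj (y l) = - R"
      proof -
        have "r * dl l y l + y l = c * (r * m - 1)" by (simp add: yl algebra_simps)
        also have "\<dots> = - R" using nz by (simp add: c_def Some R_def)
        finally have "cnj (r * dl l y l + y l) = cnj (- R)" by simp
        then show ?thesis by simp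
      qed
      also have "- (r * w l - dl l w l) * complex_of_real (- R) / (r\<^sup>2 + 1) = (r * w l - dl l w l) / R"
      proof -
        have "complex_of_real (r\<^sup>2 + 1) = complex_of_real R * complex_of_real R"
          using R(2) by (simp add: power2_eq_square flip: of_real_mult)
        then show ?thesis using R(1) by (simp add: diff_divide_distrib)
      qed
      finally show ?thesis by (simp add: schr_g_def Some cm)
    qed
  next
    show "schr_g l mu \<i> y = impedance_value mu (m_inf q l z)"
    proof (cases mu)
      case None
      then show ?thesis by (simp add: schr_g_def yl c_def impedance_value_def m_def)
    next
      case (Some r)
      define R where "R = sqrt (r\<^sup>2 + 1)"
      have R: "R > 0" by (auto simp: R_def add_nonneg_pos)
      have cm: "cmod (complex_of_real r - \<i>) = R" by (simp add: R_def cmod_def)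
      have nz: "complex_of_real r * m - 1 \<noteq> 0"
        using m by (cases "r = 0") (auto simp: complex_eq_iff)
      have "schr_g l mu \<i> y = - c * (m + r) / R"
        by (simp add: schr_g_def Some cm yl algebra_simps diff_divide_distrib add_divide_distrib)
      also have "c = - R / (r * m - 1)" by (simp add: c_def Some R_def)
      finally show ?thesis using R nz by (simp add: impedance_value_def Some m_def[symmetric])
    qed
  qed
qed

text \<open>Only the number \<open>schr_g l mu \<i> y\<close> has to be unique, not
  \<open>y\<close>: pairing any solution with a solution \<open>w0\<close> at \<open>cnj z\<close>
  and applying \<open>re_form_cnj\<close> expresses this number through \<open>w0\<close>
  alone.\<close>

theorem impedance_schr:
  assumes q: "locsum l q" and d: "def11 q l" and z: "Im z \<noteq> 0"
  shows "impedance (schr_lsys q l mu \<i>) z = impedance_value mu (m_inf q l z)"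
proof -
  obtain y where y: "y \<in> Hplus q l" "\<And>w. w \<in> Hplus q l \<Longrightarrow> re_form q l mu z y w = schr_g l mu \<i> w"
    "schr_g l mu \<i> y = impedance_value mu (m_inf q l z)" using re_form_weyl[OF q d z] by blast
  have z': "Im (cnj z) \<noteq> 0" using z by simp
  obtain w0 where w0: "w0 \<in> Hplus q l" "\<And>w. w \<in> Hplus q l \<Longrightarrow> re_form q l mu (cnj z) w0 w = schr_g l mu \<i> w"
    using re_form_weyl[OF q d z'] by blast
  have u: "schr_g l mu \<i> y' = cnj (schr_g l mu \<i> w0)"
    if "y' \<in> Hplus q l" "\<And>w. w \<in> Hplus q l \<Longrightarrow> re_form q l mu z y' w = schr_g l mu \<i> w" for y'
    using w0(2)[OF that(1)] that(2)[OF w0(1)] re_form_cnj[of q l mu z y' w0] by metis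
  have "impedance (schr_lsys q l mu \<i>) z = (THE v. \<exists>y\<in>Hplus q l.
      (\<forall>w\<in>Hplus q l. re_form q l mu z y w = schr_g l mu \<i> w) \<and> v = schr_g l mu \<i> y)"
    by (simp add: impedance_def schr_lsys_def re_form_def)
  also have "\<dots> = schr_g l mu \<i> y"
    by (rule the_equality) (use y(1,2) u in \<open>auto, metis\<close>)
  finally show ?thesis using y(3) by simp
qed

text \<open>Equal values at finite parameters r and s mean (s - r) (m^2 + 1) = 0; at a finite and
  the infinite one they mean m^2 + 1 = 0. At m = \<i> and m = -\<i> the value is independent of the
  parameter.\<close>

lemma impedance_value_inj:
  assumes m: "Im m \<noteq> 0" "m\<^sup>2 \<noteq> -1" and e: "impedance_value mu m = impedance_value nu m"
  shows "mu = nu"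
proof -
  have nz: "complex_of_real r * m - 1 \<noteq> 0" for r :: real
    using m by (cases "r = 0") (auto simp: complex_eq_iff)
  have m0: "m \<noteq> 0" using m by auto
  have *: False if "impedance_value None m = impedance_value (Some r) m" for r
  proof -
    have "m * (m + r) = r * m - 1"
      using that nz[of r] m0 by (simp add: impedance_value_def field_simps)
    then have "m\<^sup>2 = -1" by algebra
    then show False using m by simp
  qed
  show ?thesis
  proof (cases mu)
    case None then show ?thesis using * e by (cases nu) auto
  next
    case (Some r)
    show ?thesis
    proof (cases nu)
      case None then show ?thesis using * e Some by metis
    next
      case (Some s)
      have "(m + r) * (s * m - 1) = (m + s) * (r * m - 1)"
        using e nz[of r] nz[of s] \<open>mu = Some r\<close> Some by (simp add: impedance_value_def frac_eq_eq)
      then have "(complex_of_real s - r) * (m\<^sup>2 + 1) = 0" by algebra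
      moreover have "m\<^sup>2 + 1 \<noteq> 0" using m by (simp add: add_eq_0_iff2)
      ultimately show ?thesis using Some \<open>mu = Some r\<close> by simp
    qed
  qed
qed

section \<open>Asymptotics and analyticity in the spectral parameter\<close>

lemma ac_exp:
  "ac l (\<lambda>t. exp (c * complex_of_real (t - l))) (\<lambda>t. c * exp (c * complex_of_real (t - l)))"
proof (rule ac_C1)
  fix x
  have "((\<lambda>w. exp (c * (w - complex_of_real l))) has_field_derivative
      c * exp (c * (complex_of_real x - complex_of_real l))) (at (complex_of_real x))"
    by (auto intro!: derivative_eq_intros)
  from has_vector_derivative_real_field[OF this]
  show "((\<lambda>t. exp (c * complex_of_real (t - l))) has_vector_derivative c * exp (c * complex_of_real (x - l)))
      (at x within {l..})" by simp
qed (intro continuous_intros)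

text \<open>As k^2 = -z, the combinations y' + k y and y' - k y satisfy first-order equations with
  inhomogeneity q y, solved with the integrating factors exp(-k t) and exp(k t). Their difference is
  2 k y, which bounds the maximum \<open>S\<close> of |e y| in terms of itself.\<close>

lemma exp_bounds:
  assumes q: "locsum l q" and y: "solves q l z y y1" and k: "k\<^sup>2 = - z" "Re k \<ge> 0"
    and x: "x \<ge> l" and Q: "2 * (LINT t:{l..x}|lborel. \<bar>q t\<bar>) \<le> cmod k" and k0: "k \<noteq> 0"
  defines "e \<equiv> \<lambda>t. exp (- k * complex_of_real (t - l))"
    and "P \<equiv> y1 l + k * y l" and "N \<equiv> y1 l - k * y l"
  defines "M \<equiv> (cmod P + cmod N) / cmod k"
  shows "cmod (e x * y x) \<le> M"
    and "cmod (e x * (y1 x + k * y x) - P) \<le> (LINT t:{l..x}|lborel. \<bar>q t\<bar>) * M"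
    and "cmod (e x * (y1 x - k * y x)) \<le> cmod N * exp (- 2 * Re k * (x - l)) + (LINT t:{l..x}|lborel. \<bar>q t\<bar>) * M"
proof -
  define J where "J = (LINT t:{l..x}|lborel. \<bar>q t\<bar>)"
  define e' where "e' = (\<lambda>t. exp (k * complex_of_real (t - l)))"
  have qi: "set_integrable lborel {l..b} (\<lambda>t. \<bar>q t\<bar>)" for b
    using q by (auto simp: locsum_def intro: set_integrable_abs)
  have Jnn: "J \<ge> 0" unfolding J_def by (rule set_integral_nonneg') auto
  have zk: "z = - (k * k)" using k(1) by (simp add: power2_eq_square)
  have ee: "e t * e' t = 1" for t by (simp add: e_def e'_def flip: exp_add)
  have acU: "ac l (\<lambda>t. e t * (y1 t + k * y t)) (\<lambda>t. e t * (q t * y t))"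
    unfolding e_def
    by (rule ac_cong[OF ac_mult[OF ac_exp[of l "- k"] ac_add[OF solvesD(2)[OF y] ac_cmult[OF solvesD(1)[OF y], of k]]]])
      (auto simp: zk algebra_simps)
  have acV: "ac l (\<lambda>t. e' t * (y1 t - k * y t)) (\<lambda>t. e' t * (q t * y t))"
    unfolding e'_def
    by (rule ac_cong[OF ac_mult[OF ac_exp[of l k] ac_diff_fun[OF solvesD(2)[OF y] ac_cmult[OF solvesD(1)[OF y], of k]]]])
      (auto simp: zk algebra_simps)
  have cu: "continuous_on {l..x} (\<lambda>t. cmod (e t * y t))"
    unfolding e_def by (intro continuous_intros continuous_on_subset[OF solves_continuous(1)[OF y]]) auto
  obtain t0 where t0: "t0 \<in> {l..x}" "\<And>t. t \<in> {l..x} \<Longrightarrow> cmod (e t * y t) \<le> cmod (e t0 * y t0)"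
    using continuous_attains_sup[OF _ _ cu] x by auto
  define S where "S = cmod (e t0 * y t0)"
  have S: "cmod (e t * y t) \<le> S" if "t \<in> {l..x}" for t using t0(2)[OF that] by (simp add: S_def)
  have Snn: "S \<ge> 0" by (simp add: S_def)
  have U: "cmod (e t * (y1 t + k * y t) - P) \<le> J * S" if t: "t \<in> {l..x}" for t
  proof -
    have "e t * (y1 t + k * y t) - P = (LINT s:{l..t}|lborel. e s * (q s * y s))"
      using ac_eq[OF acU, of t] t by (simp add: P_def e_def)
    also have "cmod \<dots> \<le> (LINT s:{l..t}|lborel. S * \<bar>q s\<bar>)"
    proof (rule norm_set_integral_le[OF ac_int[OF acU]])
      show "set_integrable lborel {l..t} (\<lambda>s. S * \<bar>q s\<bar>)" using qi by simp
      fix s assume "s \<in> {l..t}"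
      then have "cmod (e s * y s) * \<bar>q s\<bar> \<le> S * \<bar>q s\<bar>" using t by (intro mult_right_mono S) auto
      then show "cmod (e s * (q s * y s)) \<le> S * \<bar>q s\<bar>" by (simp add: norm_mult algebra_simps)
    qed
    also have "\<dots> = S * (LINT s:{l..t}|lborel. \<bar>q s\<bar>)" by simp
    also have "\<dots> \<le> S * J" unfolding J_def
      by (intro mult_left_mono set_integral_Icc_mono qi Snn) (use t in auto)
    finally show ?thesis by (simp add: mult.commute)
  qed
  have V: "cmod (e t * (y1 t - k * y t)) \<le> cmod N * exp (- 2 * Re k * (t - l)) + J * S" if t: "t \<in> {l..x}" for t
  proof -
    have "e' t * (y1 t - k * y t) = N + (LINT s:{l..t}|lborel. e' s * (q s * y s))"
      using ac_eq[OF acV, of t] t by (simp add: N_def e'_def)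
    \<comment> \<open>The square of \<open>e t\<close> supplies the decay of the initial value
      \<open>N\<close> and exactly compensates the growth of the integral.\<close>
    moreover have "e t * (y1 t - k * y t) = (e t)\<^sup>2 * (e' t * (y1 t - k * y t))"
      using ee[of t] by algebra
    ultimately have "cmod (e t * (y1 t - k * y t)) = (cmod (e t))\<^sup>2 * cmod (N + (LINT s:{l..t}|lborel. e' s * (q s * y s)))"
      by (simp add: norm_mult norm_power)
    also have "\<dots> \<le> (cmod (e t))\<^sup>2 * (cmod N + cmod (LINT s:{l..t}|lborel. e' s * (q s * y s)))"
      by (intro mult_left_mono norm_triangle_ineq) auto
    also have "cmod (LINT s:{l..t}|lborel. e' s * (q s * y s)) \<le> (LINT s:{l..t}|lborel. (exp (2 * Re k * (t - l)) * S) * \<bar>q s\<bar>)"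
    proof (rule norm_set_integral_le[OF ac_int[OF acV]])
      show "set_integrable lborel {l..t} (\<lambda>s. (exp (2 * Re k * (t - l)) * S) * \<bar>q s\<bar>)" using qi by simp
      fix s assume s: "s \<in> {l..t}"
      have "e' s * (q s * y s) = (e' s)\<^sup>2 * (e s * y s) * q s"
        using ee[of s] by (simp add: power2_eq_square algebra_simps)
      then have "cmod (e' s * (q s * y s)) = cmod ((e' s)\<^sup>2 * (e s * y s) * q s)" by (rule arg_cong)
      also have "\<dots> = (cmod (e' s))\<^sup>2 * cmod (e s * y s) * \<bar>q s\<bar>"
        by (simp only: norm_mult norm_power norm_of_real)
      also have "(cmod (e' s))\<^sup>2 = exp (2 * Re k * (s - l))"
        by (simp add: e'_def norm_exp_eq_Re power2_eq_square algebra_simps flip: exp_add)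
      also have "exp (2 * Re k * (s - l)) * cmod (e s * y s) * \<bar>q s\<bar> \<le> exp (2 * Re k * (t - l)) * S * \<bar>q s\<bar>"
        using s t k(2) Snn by (intro mult_right_mono mult_mono S) (auto intro: mult_left_mono)
      finally show "cmod (e' s * (q s * y s)) \<le> (exp (2 * Re k * (t - l)) * S) * \<bar>q s\<bar>" .
    qed
    also have "\<dots> = exp (2 * Re k * (t - l)) * S * (LINT s:{l..t}|lborel. \<bar>q s\<bar>)" by simp
    also have "\<dots> \<le> exp (2 * Re k * (t - l)) * S * J" unfolding J_def
      by (intro mult_left_mono set_integral_Icc_mono qi mult_nonneg_nonneg Snn) (use t in auto)
    also have "(cmod (e t))\<^sup>2 = exp (- 2 * Re k * (t - l))"
      by (simp add: e_def norm_exp_eq_Re power2_eq_square algebra_simps flip: exp_add)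
    finally have "cmod (e t * (y1 t - k * y t)) \<le> exp (- 2 * Re k * (t - l)) * (cmod N + exp (2 * Re k * (t - l)) * S * J)"
      by (simp add: mult_left_mono)
    also have "\<dots> = cmod N * exp (- 2 * Re k * (t - l)) + (exp (- 2 * Re k * (t - l)) * exp (2 * Re k * (t - l))) * (J * S)"
      by (simp add: algebra_simps)
    finally show ?thesis by (simp flip: exp_add)
  qed
  \<comment> \<open>The two error terms \<open>J * S\<close> add up to at most
    \<open>cmod k * S\<close>, half of the left-hand side \<open>2 * cmod k * S\<close>.\<close>
  have SM: "S \<le> M"
  proof -
    have "2 * k * (e t0 * y t0) = P + (e t0 * (y1 t0 + k * y t0) - P) - e t0 * (y1 t0 - k * y t0)"
      by (simp add: algebra_simps)
    then have "cmod (2 * k * (e t0 * y t0)) = cmod (P + (e t0 * (y1 t0 + k * y t0) - P) - e t0 * (y1 t0 - k * y t0))"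
      by (rule arg_cong)
    also have "\<dots> \<le> cmod (P + (e t0 * (y1 t0 + k * y t0) - P)) + cmod (e t0 * (y1 t0 - k * y t0))"
      by (rule norm_triangle_ineq4)
    also have "\<dots> \<le> cmod P + cmod (e t0 * (y1 t0 + k * y t0) - P) + cmod (e t0 * (y1 t0 - k * y t0))"
      by (rule add_right_mono[OF norm_triangle_ineq])
    also have "\<dots> \<le> cmod P + J * S + (cmod N * exp (- 2 * Re k * (t0 - l)) + J * S)"
      by (intro add_mono U V t0) auto
    also have "\<dots> \<le> cmod P + J * S + (cmod N * 1 + J * S)"
      using k(2) t0(1) by (intro add_left_mono add_right_mono mult_left_mono) (auto simp: mult_nonneg_nonneg)
    also have "\<dots> \<le> cmod P + cmod N + cmod k * S"
      using mult_right_mono[OF Q Snn] by (simp add: J_def mult_ac)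
    finally have "cmod k * S \<le> cmod P + cmod N" by (simp add: norm_mult S_def)
    then show ?thesis unfolding M_def using k0 by (simp add: pos_le_divide_eq mult.commute)
  qed
  have JS: "J * S \<le> J * M" using SM Jnn by (rule mult_left_mono)
  show "cmod (e x * y x) \<le> M" using S[of x] SM x by auto
  show "cmod (e x * (y1 x + k * y x) - P) \<le> (LINT t:{l..x}|lborel. \<bar>q t\<bar>) * M"
    using U[of x] JS x by (auto simp: J_def)
  show "cmod (e x * (y1 x - k * y x)) \<le> cmod N * exp (- 2 * Re k * (x - l)) + (LINT t:{l..x}|lborel. \<bar>q t\<bar>) * M"
    using V[of x] JS x by (auto simp: J_def)
qed

lemma solves_growth:
  assumes q: "locsum l q" and x: "x \<ge> l"
  shows "\<exists>R C. \<forall>z y y1. solves q l z y y1 \<and> y l = A \<and> y1 l = B \<and> cmod z \<ge> R \<longrightarrow>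
     cmod (y x) \<le> C * exp ((x - l) * sqrt (cmod z))"
proof -
  define J where "J = (LINT t:{l..x}|lborel. \<bar>q t\<bar>)"
  have Jnn: "J \<ge> 0" unfolding J_def by (rule set_integral_nonneg') auto
  \<comment> \<open>The threshold makes \<open>cmod k\<close> at least \<open>2 * J + 1\<close>:
    large enough for \<open>exp_bounds\<close>, and at least 1, so that dividing the initial
    derivative by k costs nothing.\<close>
  have "cmod (y x) \<le> 2 * (cmod A + cmod B) * exp ((x - l) * sqrt (cmod z))"
    if y: "solves q l z y y1" "y l = A" "y1 l = B" and z: "cmod z \<ge> (2 * J + 1)\<^sup>2" for z y y1
  proof -
    define k where "k = csqrt (- z)"
    have k2: "k\<^sup>2 = - z" "Re k \<ge> 0" unfolding k_def using csqrt_principal[of "-z"] by auto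
    have "(cmod k)\<^sup>2 = cmod z" using k2(1) by (metis norm_power norm_minus_cancel)
    then have ck: "cmod k = sqrt (cmod z)" by (metis norm_ge_zero real_sqrt_unique)
    have "2 * J + 1 \<le> cmod k" unfolding ck using z Jnn by (intro real_le_rsqrt) auto
    then have k1: "2 * J \<le> cmod k" "1 \<le> cmod k" "k \<noteq> 0" using Jnn by auto
    have "cmod (exp (- k * complex_of_real (x - l)) * y x) \<le> (cmod (y1 l + k * y l) + cmod (y1 l - k * y l)) / cmod k"
      by (rule exp_bounds(1)[OF q y(1) k2 x]) (use k1 in \<open>auto simp: J_def\<close>)
    also have "\<dots> \<le> ((cmod B + cmod k * cmod A) + (cmod B + cmod k * cmod A)) / cmod k"
      using norm_triangle_ineq[of "y1 l" "k * y l"] norm_triangle_ineq4[of "y1 l" "k * y l"] y(2,3)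
      by (intro divide_right_mono add_mono) (auto simp: norm_mult)
    also have "\<dots> = 2 * (cmod B / cmod k + cmod A)" using k1 by (simp add: field_simps)
    also have "\<dots> \<le> 2 * (cmod B / 1 + cmod A)" using k1 by (intro mult_left_mono add_right_mono divide_left_mono) auto
    finally have 1: "exp (- (Re k * (x - l))) * cmod (y x) \<le> 2 * (cmod A + cmod B)"
      by (simp add: norm_mult norm_exp_eq_Re)
    have "cmod (y x) = exp (Re k * (x - l)) * (exp (- (Re k * (x - l))) * cmod (y x))"
      by (simp add: exp_minus)
    also have "\<dots> \<le> exp ((x - l) * sqrt (cmod z)) * (2 * (cmod A + cmod B))"
    proof (rule mult_mono)
      show "exp (Re k * (x - l)) \<le> exp ((x - l) * sqrt (cmod z))"
        using x complex_Re_le_cmod[of k] unfolding ck[symmetric] by (simp add: mult.commute[of "Re k"] mult_left_mono)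
    qed (use 1 in auto)
    finally show ?thesis by (simp add: mult.commute)
  qed
  then show ?thesis by blast
qed

text \<open>The normaliser \<open>n\<close> lets one statement cover the Dirichlet solution (n = 1)
  and solutions with nonzero value at \<open>l\<close> (n = k). As Re k tends to infinity, the
  influence of \<open>q\<close> and the decaying combination vanish; y and y' come back as half the
  difference (divided by k) and half the sum of the two combinations.\<close>

lemma solves_asymptotics:
  fixes k n :: "real \<Rightarrow> complex" and y y1 :: "real \<Rightarrow> real \<Rightarrow> complex"
  assumes q: "locsum l q" and x: "x > l"
    and y: "\<And>s. solves q l (- (k s)\<^sup>2) (y s) (y1 s)"
    and Rek: "LIM s F. Re (k s) :> at_top"
    and n: "\<And>s. n s \<noteq> 0"
    and P: "((\<lambda>s. (y1 s l + k s * y s l) / n s) \<longlongrightarrow> p) F"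
    and N: "\<And>s. cmod (y1 s l - k s * y s l) \<le> C * cmod (n s)"
  shows "((\<lambda>s. 2 * k s * (exp (- k s * complex_of_real (x - l)) * y s x) / n s) \<longlongrightarrow> p) F"
    and "((\<lambda>s. 2 * (exp (- k s * complex_of_real (x - l)) * y1 s x) / n s) \<longlongrightarrow> p) F"
proof -
  define J where "J = (LINT t:{l..x}|lborel. \<bar>q t\<bar>)"
  have Jnn: "J \<ge> 0" unfolding J_def by (rule set_integral_nonneg') auto
  define e where "e = (\<lambda>s. exp (- k s * complex_of_real (x - l)))"
  define P where "P = (\<lambda>s. y1 s l + k s * y s l)"
  define N' where "N' = (\<lambda>s. y1 s l - k s * y s l)"
  define U where "U = (\<lambda>s. e s * (y1 s x + k s * y s x))"
  define V where "V = (\<lambda>s. e s * (y1 s x - k s * y s x))"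
  define h where "h = (\<lambda>s. (cmod (P s / n s) + C) / Re (k s))"
  have ev: "\<forall>\<^sub>F s in F. Re (k s) \<ge> 2 * J + 1"
    using Rek by (auto simp: filterlim_at_top)
  have est: "\<forall>\<^sub>F s in F. cmod (U s / n s - P s / n s) \<le> J * h s \<and> cmod (V s / n s) \<le> C * exp (- 2 * Re (k s) * (x - l)) + J * h s"
    using ev
  proof eventually_elim
    case (elim s)
    have k1: "2 * J \<le> cmod (k s)" "k s \<noteq> 0" "Re (k s) \<ge> 0" "0 < Re (k s)" "Re (k s) \<le> cmod (k s)"
      using elim Jnn complex_Re_le_cmod[of "k s"] by auto
    define M where "M = (cmod (P s) + cmod (N' s)) / cmod (k s)"
    have kz: "(k s)\<^sup>2 = - (- (k s)\<^sup>2)" by simp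
    have Q: "2 * (LINT t:{l..x}|lborel. \<bar>q t\<bar>) \<le> cmod (k s)" using k1 by (simp add: J_def)
    have 1: "cmod (U s - P s) \<le> J * M" "cmod (V s) \<le> cmod (N' s) * exp (- 2 * Re (k s) * (x - l)) + J * M"
      using exp_bounds(2,3)[OF q y kz k1(3) less_imp_le[OF x] Q k1(2)]
      by (simp_all add: U_def V_def P_def N'_def M_def J_def e_def)
    have Mle: "M / cmod (n s) \<le> h s"
    proof -
      have "M / cmod (n s) = (cmod (P s / n s) + cmod (N' s) / cmod (n s)) / cmod (k s)"
        by (simp add: M_def norm_divide add_divide_distrib mult.commute)
      also have "\<dots> \<le> (cmod (P s / n s) + C) / Re (k s)"
      proof (rule frac_le)
        have "cmod (N' s) / cmod (n s) \<le> C" using N[of s] n[of s] by (simp add: N'_def divide_le_eq)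
        then show "cmod (P s / n s) + cmod (N' s) / cmod (n s) \<le> cmod (P s / n s) + C" by simp
        then show "0 \<le> cmod (P s / n s) + C"
          by (meson add_nonneg_nonneg divide_nonneg_nonneg norm_ge_zero order_trans)
      qed (use k1 in auto)
      finally show ?thesis by (simp add: h_def)
    qed
    have JM: "J * M / cmod (n s) \<le> J * h s" using mult_left_mono[OF Mle Jnn] by simp
    have "cmod (U s / n s - P s / n s) = cmod (U s - P s) / cmod (n s)"
      by (simp add: norm_divide flip: diff_divide_distrib)
    also have "\<dots> \<le> J * M / cmod (n s)" by (intro divide_right_mono 1) auto
    finally have a: "cmod (U s / n s - P s / n s) \<le> J * h s" using JM by simp
    have "cmod (V s / n s) \<le> (cmod (N' s) * exp (- 2 * Re (k s) * (x - l)) + J * M) / cmod (n s)"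
      unfolding norm_divide by (intro divide_right_mono 1) auto
    also have "\<dots> = cmod (N' s) / cmod (n s) * exp (- 2 * Re (k s) * (x - l)) + J * M / cmod (n s)"
      by (simp add: add_divide_distrib)
    also have "\<dots> \<le> C * exp (- 2 * Re (k s) * (x - l)) + J * h s"
      using JM N[of s] n[of s] by (intro add_mono mult_right_mono) (auto simp: N'_def divide_le_eq)
    finally show ?case using a by simp
  qed
  have Pl: "((\<lambda>s. P s / n s) \<longlongrightarrow> p) F" using P by (simp add: P_def)
  have hl: "(h \<longlongrightarrow> 0) F"
    unfolding h_def
    by (rule tendsto_divide_0[OF tendsto_add[OF tendsto_norm[OF Pl] tendsto_const] filterlim_at_top_imp_at_infinity[OF Rek]])
  then have Jh: "((\<lambda>s. J * h s) \<longlongrightarrow> 0) F" using tendsto_mult_right_zero by blast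
  have exl: "((\<lambda>s. exp (- 2 * Re (k s) * (x - l))) \<longlongrightarrow> 0) F"
  proof -
    have "LIM s F. (2 * (x - l)) * Re (k s) :> at_top"
      by (rule filterlim_tendsto_pos_mult_at_top[OF tendsto_const _ Rek]) (use x in auto)
    then have "LIM s F. - ((2 * (x - l)) * Re (k s)) :> at_bot"
      by (simp add: filterlim_uminus_at_top)
    from filterlim_compose[OF exp_at_bot this] show ?thesis by (simp add: algebra_simps)
  qed
  have UP: "((\<lambda>s. U s / n s - P s / n s) \<longlongrightarrow> 0) F"
    by (rule Lim_null_comparison[OF _ Jh]) (use est in \<open>auto elim: eventually_mono\<close>)
  have Ul: "((\<lambda>s. U s / n s) \<longlongrightarrow> p) F"
    using tendsto_add[OF UP Pl] by simp
  have Vl: "((\<lambda>s. V s / n s) \<longlongrightarrow> 0) F"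
  proof (rule Lim_null_comparison)
    show "\<forall>\<^sub>F s in F. cmod (V s / n s) \<le> C * exp (- 2 * Re (k s) * (x - l)) + J * h s"
      using est by (auto elim: eventually_mono)
    show "((\<lambda>s. C * exp (- 2 * Re (k s) * (x - l)) + J * h s) \<longlongrightarrow> 0) F"
      using tendsto_add[OF tendsto_mult_right_zero[OF exl, of C] Jh] by simp
  qed
  have "((\<lambda>s. U s / n s - V s / n s) \<longlongrightarrow> p) F" using tendsto_diff[OF Ul Vl] by simp
  moreover have "U s / n s - V s / n s = 2 * k s * (e s * y s x) / n s" for s
    by (simp add: U_def V_def algebra_simps flip: diff_divide_distrib)
  ultimately show "((\<lambda>s. 2 * k s * (exp (- k s * complex_of_real (x - l)) * y s x) / n s) \<longlongrightarrow> p) F"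
    by (simp add: e_def)
  have "((\<lambda>s. U s / n s + V s / n s) \<longlongrightarrow> p) F" using tendsto_add[OF Ul Vl] by simp
  moreover have "U s / n s + V s / n s = 2 * (e s * y1 s x) / n s" for s
    by (simp add: U_def V_def algebra_simps flip: add_divide_distrib)
  ultimately show "((\<lambda>s. 2 * (exp (- k s * complex_of_real (x - l)) * y1 s x) / n s) \<longlongrightarrow> p) F"
    by (simp add: e_def)
qed

text \<open>Wronskians with a basis \<open>u\<close>, \<open>v\<close> at \<open>z0\<close> give y z
  - y z0 = (z - z0) T z, where \<open>T\<close> is built from integrals of y z. By Caratheodory's
  criterion it remains to show continuity of \<open>T\<close> at \<open>z0\<close>, which follows
  once y z is uniformly close to y z0 on {l..x}.\<close>

lemma solves_holomorphic:
  assumes q: "locsum l q" and y: "\<And>z. solves q l z (y z) (y1 z)"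
    and i: "\<And>z. y z l = A" "\<And>z. y1 z l = B" and x: "x \<ge> l"
  shows "(\<lambda>z. y z x) holomorphic_on UNIV"
proof -
  have "\<exists>D. ((\<lambda>z. y z x) has_field_derivative D) (at z0)" for z0
  proof -
    obtain u u1 where u: "solves q l z0 u u1" "u l = 0" "u1 l = 1" using solves_exists[OF q] .
    obtain v v1 where v: "solves q l z0 v v1" "v l = 1" "v1 l = 0" using solves_exists[OF q] .
    define I where "I = (\<lambda>z w t. LINT s:{l..t}|lborel. y z s * w s :: complex)"
    have acI: "ac l (\<lambda>t. y z t * w1 t - y1 z t * w t) (\<lambda>t. (z - z0) * (y z t * w t))"
      if "solves q l z0 w w1" for z w w1
      by (rule ac_cong[OF ac_wronskian[OF solvesD[OF y] solvesD[OF that]]]) (auto simp: algebra_simps)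
    have W: "(y z t - y z0 t) * w1 t - (y1 z t - y1 z0 t) * w t = (z - z0) * I z w t"
      if w: "solves q l z0 w w1" and t: "t \<ge> l" for z w w1 t
    proof -
      have "y z t * w1 t - y1 z t * w t = A * w1 l - B * w l + (z - z0) * I z w t"
        using ac_eq[OF acI[OF w] t, of z] by (simp add: i I_def)
      moreover have "y z0 t * w1 t - y1 z0 t * w t = A * w1 l - B * w l"
        using wronskian_const[OF y w t] by (simp add: i)
      ultimately show ?thesis by algebra
    qed
    define T where "T = (\<lambda>z t. v t * I z u t - u t * I z v t)"
    have dT: "y z t - y z0 t = (z - z0) * T z t" if t: "t \<ge> l" for z t
    proof -
      have "v t * u1 t - v1 t * u t = 1" using wronskian_const[OF v(1) u(1) t] u v by simp
      then show ?thesis using W[OF u(1) t, of z] W[OF v(1) t, of z] unfolding T_def by algebra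
    qed
    have cont: "continuous_on {l..x} f" if "solves q l z f f1" for z f f1
      using continuous_on_subset[OF solves_continuous(1)[OF that]] by auto
    have bd: "\<exists>G\<ge>0. \<forall>t\<in>{l..x}. cmod (f t) \<le> G" if "solves q l z f f1" for z f f1
    proof -
      have "compact (f ` {l..x})" using cont[OF that] by (intro compact_continuous_image) auto
      then obtain G where "\<forall>w\<in>f ` {l..x}. cmod w \<le> G" using compact_imp_bounded bounded_iff by blast
      then show ?thesis by (intro exI[of _ "max 0 G"]) (auto simp: le_max_iff_disj)
    qed
    obtain Gu where Gu: "Gu \<ge> 0" "\<And>t. t \<in> {l..x} \<Longrightarrow> cmod (u t) \<le> Gu" using bd[OF u(1)] by auto
    obtain Gv where Gv: "Gv \<ge> 0" "\<And>t. t \<in> {l..x} \<Longrightarrow> cmod (v t) \<le> Gv" using bd[OF v(1)] by auto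
    obtain S0 where S0: "S0 \<ge> 0" "\<And>t. t \<in> {l..x} \<Longrightarrow> cmod (y z0 t) \<le> S0" using bd[OF y, of z0] by auto
    define K where "K = 2 * Gu * Gv * (x - l)"
    have K: "K \<ge> 0" using Gu Gv x by (simp add: K_def)
    have ii: "set_integrable lborel {l..t} (\<lambda>s. y z s * w s)" if "t \<in> {l..x}" "solves q l z0 w w1" for z w w1 t
      by (intro borel_integrable_atLeastAtMost' continuous_intros continuous_on_subset[OF cont[OF y]]
          continuous_on_subset[OF cont[OF that(2)]]) (use that in auto)
    have Ile: "cmod (LINT s:{l..t}|lborel. f s * w s) \<le> (x - l) * (D * G)"
      if t: "t \<in> {l..x}" and fi: "set_integrable lborel {l..t} (\<lambda>s. f s * w s)"
        and D: "\<And>s. s \<in> {l..x} \<Longrightarrow> cmod (f s) \<le> D" and G: "\<And>s. s \<in> {l..x} \<Longrightarrow> cmod (w s) \<le> G" "G \<ge> 0" "D \<ge> 0"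
      for f w :: "real \<Rightarrow> complex" and t D G
    proof -
      have ci: "set_integrable lborel {l..t} (\<lambda>s. D * G)" by (intro borel_integrable_atLeastAtMost') auto
      have "cmod (LINT s:{l..t}|lborel. f s * w s) \<le> (LINT s:{l..t}|lborel. D * G)"
      proof (rule norm_set_integral_le[OF fi ci])
        fix s assume "s \<in> {l..t}"
        then show "cmod (f s * w s) \<le> D * G" unfolding norm_mult using t G D by (intro mult_mono) auto
      qed
      also have "\<dots> = integral {l..t} (\<lambda>s. D * G)" by (rule set_borel_integral_eq_integral(2)[OF ci])
      also have "\<dots> = (t - l) * (D * G)" using t by simp
      also have "\<dots> \<le> (x - l) * (D * G)" using t G by (intro mult_right_mono) auto
      finally show ?thesis .
    qed
    have Tle: "cmod (v t * (LINT s:{l..t}|lborel. f s * u s) - u t * (LINT s:{l..t}|lborel. f s * v s)) \<le> K * D"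
      if t: "t \<in> {l..x}" and fi: "set_integrable lborel {l..t} (\<lambda>s. f s * u s)" "set_integrable lborel {l..t} (\<lambda>s. f s * v s)"
        and D: "\<And>s. s \<in> {l..x} \<Longrightarrow> cmod (f s) \<le> D" "D \<ge> 0"
      for f t D
    proof -
      have "cmod (v t * (LINT s:{l..t}|lborel. f s * u s) - u t * (LINT s:{l..t}|lborel. f s * v s))
        \<le> cmod (v t) * cmod (LINT s:{l..t}|lborel. f s * u s) + cmod (u t) * cmod (LINT s:{l..t}|lborel. f s * v s)"
        unfolding norm_mult[symmetric] by (rule norm_triangle_ineq4)
      also have "\<dots> \<le> Gv * ((x - l) * (D * Gu)) + Gu * ((x - l) * (D * Gv))"
        by (intro add_mono mult_mono Gv Gu Ile t fi D) auto
      finally show ?thesis by (simp add: K_def algebra_simps)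
    qed
    \<comment> \<open>A self-improving estimate: the maximal deviation \<open>D\<close> occurs on
      both sides, and near \<open>z0\<close> its factor on the right is at most 1/2.\<close>
    have close: "cmod (y z t - y z0 t) \<le> 2 * K * S0 * cmod (z - z0)"
      if z: "K * cmod (z - z0) \<le> 1/2" and t: "t \<in> {l..x}" for z t
    proof -
      have cd: "continuous_on {l..x} (\<lambda>t. cmod (y z t - y z0 t))" by (intro continuous_intros cont[OF y])
      obtain t0 where t0: "t0 \<in> {l..x}" "\<And>t. t \<in> {l..x} \<Longrightarrow> cmod (y z t - y z0 t) \<le> cmod (y z t0 - y z0 t0)"
        using continuous_attains_sup[OF _ _ cd] x by auto
      define D where "D = cmod (y z t0 - y z0 t0)"
      have yb: "cmod (y z s) \<le> S0 + D" if "s \<in> {l..x}" for s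
        using S0(2)[OF that] t0(2)[OF that] norm_triangle_ineq2[of "y z s" "y z0 s"] by (simp add: D_def)
      have "D = cmod (z - z0) * cmod (T z t0)"
        unfolding D_def using dT[of t0 z] t0 by (simp add: norm_mult)
      also have "\<dots> \<le> cmod (z - z0) * (K * (S0 + D))"
        unfolding T_def I_def
        by (intro mult_left_mono Tle t0 ii[OF t0(1) u(1)] ii[OF t0(1) v(1)] yb) (use S0 in \<open>auto simp: D_def\<close>)
      also have "\<dots> = K * cmod (z - z0) * S0 + (K * cmod (z - z0)) * D" by (simp add: algebra_simps)
      also have "\<dots> \<le> K * cmod (z - z0) * S0 + (1/2) * D"
        using z by (intro add_left_mono mult_right_mono) (auto simp: D_def)
      finally have "D \<le> 2 * (K * cmod (z - z0) * S0)" by linarith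
      then have "D \<le> 2 * K * S0 * cmod (z - z0)" by (simp add: mult_ac)
      then show ?thesis using t0(2)[OF t] by (simp add: D_def)
    qed
    have "isCont (\<lambda>z. T z x) z0"
      unfolding isCont_def
    proof (rule Lim_transform_bound[of _ "\<lambda>z. K * (2 * K * S0 * cmod (z - z0))", THEN Lim_null[THEN iffD2]])
      show "((\<lambda>z. K * (2 * K * S0 * cmod (z - z0))) \<longlongrightarrow> 0) (at z0)"
        by (auto intro!: tendsto_eq_intros)
      have "\<forall>\<^sub>F z in at z0. dist z z0 < 1 / (2 * (K + 1))"
        unfolding eventually_at using K by (intro exI[of _ "1 / (2 * (K + 1))"]) auto
      then show "\<forall>\<^sub>F z in at z0. norm (T z x - T z0 x) \<le> norm (K * (2 * K * S0 * cmod (z - z0)))"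
      proof eventually_elim
        case (elim z)
        have "K * cmod (z - z0) \<le> (K + 1) * (1 / (2 * (K + 1)))"
          using elim K by (intro mult_mono) (auto simp: dist_norm)
        also have "\<dots> = 1/2" using K by (simp add: field_simps)
        finally have c: "cmod (y z t - y z0 t) \<le> 2 * K * S0 * cmod (z - z0)" if "t \<in> {l..x}" for t
          using close that by blast
        have xx: "x \<in> {l..x}" using x by simp
        have I: "I z w x - I z0 w x = (LINT s:{l..x}|lborel. (y z s - y z0 s) * w s)"
          "set_integrable lborel {l..x} (\<lambda>s. (y z s - y z0 s) * w s)" if "solves q l z0 w w1" for w w1
          using set_integral_diff[OF ii[OF xx that, of z] ii[OF xx that, of z0]]
          by (simp_all add: I_def left_diff_distrib)
        have "T z x - T z0 x = v x * (I z u x - I z0 u x) - u x * (I z v x - I z0 v x)"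
          by (simp add: T_def algebra_simps)
        also have "cmod \<dots> \<le> K * (2 * K * S0 * cmod (z - z0))"
          unfolding I(1)[OF u(1)] I(1)[OF v(1)]
          by (rule Tle[OF xx I(2)[OF u(1)] I(2)[OF v(1)] c]) (use K S0 in auto)
        finally show ?case by simp
      qed
    qed
    then have "((\<lambda>z. y z x) has_field_derivative T z0 x) (at z0)"
      unfolding CARAT_DERIV using dT[OF x] by (intro exI[of _ "\<lambda>z. T z x"]) (auto simp: mult.commute)
    then show ?thesis by blast
  qed
  then show ?thesis by (auto simp: holomorphic_on_def field_differentiable_def)
qed

section \<open>A Phragmen-Lindelof argument\<close>

text \<open>The comparison factor exp(-e z^(3/4)) works because 1/2 < 3/4 < 1: it beats growth of
  order 1/2 on large arcs, and on the half-plane the argument of z^(3/4) is at most 3 pi / 8 in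
  modulus, so the factor is bounded by 1. The unit disc is cut out to avoid the branch point at
  0.\<close>

lemma phragmen_lindelof_half_plane:
  fixes f :: "complex \<Rightarrow> complex"
  assumes hol: "f holomorphic_on UNIV" and K: "K \<ge> 0" and C: "C \<ge> 0"
    and growth: "\<And>z. cmod z \<ge> R0 \<Longrightarrow> cmod (f z) \<le> C * exp (K * sqrt (cmod z))"
    and B: "B \<ge> 1" and axis: "\<And>z. Re z = 0 \<Longrightarrow> cmod (f z) \<le> B"
    and disc: "\<And>z. cmod z \<le> 1 \<Longrightarrow> cmod (f z) \<le> B" and z0: "Re z0 \<ge> 0"
  shows "cmod (f z0) \<le> B"
proof (cases "cmod z0 \<le> 1")
  case False
  define c where "c = cos (3/4 * (pi/2))"
  have c: "c > 0" unfolding c_def by (rule cos_gt_zero) auto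
  have Re34: "Re (exp (3/4 * Ln z)) \<ge> c * exp (3/4 * ln (cmod z))" if "Re z \<ge> 0" "z \<noteq> 0" for z
  proof -
    have im: "\<bar>Im (Ln z)\<bar> \<le> pi/2" using Re_Ln_pos_le[OF that(2)] that(1) by simp
    have "c \<le> cos \<bar>3/4 * Im (Ln z)\<bar>"
      unfolding c_def by (rule cos_monotone_0_pi_le) (use im in auto)
    then have "c \<le> cos (3/4 * Im (Ln z))" by (simp only: cos_abs_real)
    then have "c * exp (3/4 * ln (cmod z)) \<le> cos (3/4 * Im (Ln z)) * exp (3/4 * ln (cmod z))"
      by (intro mult_right_mono) auto
    then show ?thesis using that by (simp add: Re_exp mult.commute)
  qed
  have main: "cmod (f z0 * exp (- complex_of_real e * exp (3/4 * Ln z0))) \<le> B" if e: "e > 0" for e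
  proof -
    define g where "g = (\<lambda>z. f z * exp (- complex_of_real e * exp (3/4 * Ln z)))"
    have gn: "cmod (g z) = cmod (f z) * exp (- e * Re (exp (3/4 * Ln z)))" for z
      by (simp add: g_def norm_mult norm_exp_eq_Re)
    have gle: "cmod (g z) \<le> cmod (f z)" if "Re z \<ge> 0" "z \<noteq> 0" for z
    proof -
      have "Re (exp (3/4 * Ln z)) \<ge> 0"
        using Re34[OF that] c by (meson exp_ge_zero less_imp_le mult_nonneg_nonneg order_trans)
      then have "exp (- e * Re (exp (3/4 * Ln z))) \<le> 1" using e by (simp add: mult_nonneg_nonneg)
      then show ?thesis unfolding gn by (simp add: mult_left_le)
    qed
    \<comment> \<open>With \<open>R = w ^ 4\<close> the powers R^(1/2) and R^(3/4) become w^2 and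
      w^3. The bound \<open>(K + 1) / (e * c)\<close> makes the total exponent on the arc at most
      -w, and then \<open>w \<ge> C\<close> outweighs the constant factor.\<close>
    define w where "w = max (max 1 (cmod z0)) (max \<bar>R0\<bar> (max ((K + 1) / (e * c)) C))"
    have w: "w \<ge> 1" "w \<ge> cmod z0" "w \<ge> R0" "w \<ge> (K + 1) / (e * c)" "w \<ge> C" by (auto simp: w_def)
    define R where "R = w ^ 4"
    have wR: "w \<le> R" unfolding R_def using w(1) by (rule self_le_power) simp
    define S where "S = {z. Re z \<ge> 0} \<inter> {z. 1 \<le> cmod z} \<inter> cball 0 R"
    have nS: "z \<notin> \<real>\<^sub>\<le>\<^sub>0" if "z \<in> S" for z
    proof
      assume "z \<in> \<real>\<^sub>\<le>\<^sub>0"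
      then have "z = 0" using that by (auto simp: S_def complex_nonpos_Reals_iff complex_eq_iff)
      then show False using that by (auto simp: S_def)
    qed
    have cl: "closed S" unfolding S_def
      by (intro closed_Int closed_cball closed_halfspace_Re_ge closed_Collect_le continuous_intros)
    have holg: "g holomorphic_on S" unfolding g_def
      by (intro holomorphic_intros holomorphic_on_subset[OF hol]) (use nS in auto)
    have "cmod (g z0) \<le> B"
    proof (rule maximum_modulus_frontier[of g S])
      show "g holomorphic_on interior S" using holg holomorphic_on_subset interior_subset by blast
      show "continuous_on (closure S) g" using holomorphic_on_imp_continuous_on[OF holg] cl by simp
      show "bounded S" by (rule bounded_subset[OF bounded_cball[of 0 R]]) (auto simp: S_def)
      show "z0 \<in> S" using z0 False w wR by (auto simp: S_def)
      fix z assume zf: "z \<in> frontier S"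
      then have zS: "z \<in> S" using cl by (simp add: frontier_def)
      then have z: "Re z \<ge> 0" "1 \<le> cmod z" "cmod z \<le> R" "z \<noteq> 0" by (auto simp: S_def)
      have zi: "z \<notin> interior S" using zf by (simp add: frontier_def)
      have "Re z = 0 \<or> cmod z = 1 \<or> cmod z = R"
      proof (rule ccontr)
        assume "\<not> ?thesis"
        then have zin: "z \<in> {z. Re z > 0} \<inter> {z. 1 < cmod z} \<inter> ball 0 R" using z by auto
        have "open ({z. Re z > 0} \<inter> {z. 1 < cmod z} \<inter> ball 0 R)"
          by (intro open_Int open_ball open_halfspace_Re_gt open_Collect_less continuous_intros)
        then have "z \<in> interior S" using zin by (rule interiorI) (auto simp: S_def)
        then show False using zi by simp
      qed
      then show "cmod (g z) \<le> B"
      proof (elim disjE)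
        assume "Re z = 0" then show ?thesis using axis gle[OF z(1,4)] by (meson order_trans)
      next
        assume "cmod z = 1" then show ?thesis using disc[of z] gle[OF z(1,4)] by auto
      next
        assume zR: "cmod z = R"
        have "sqrt R = w\<^sup>2" unfolding R_def using w(1) by (intro real_sqrt_unique) (auto simp flip: power_mult)
        moreover have "exp (3/4 * ln R) = w ^ 3"
        proof -
          have "3/4 * ln R = real 3 * ln w" using w(1) by (simp add: R_def ln_realpow)
          then show ?thesis using w(1) by (simp only: exp_of_nat_mult) simp
        qed
        ultimately have s: "sqrt (cmod z) = w\<^sup>2" "exp (3/4 * ln (cmod z)) = w ^ 3" using zR by simp_all
        have "cmod (f z) \<le> C * exp (K * w\<^sup>2)" using growth[of z] zR wR w(3) s by simp
        moreover have "exp (- e * Re (exp (3/4 * Ln z))) \<le> exp (- e * (c * w ^ 3))"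
          using Re34[OF z(1,4)] e s by simp
        ultimately have "cmod (g z) \<le> C * exp (K * w\<^sup>2) * exp (- e * (c * w ^ 3))"
          unfolding gn using C by (intro mult_mono) auto
        also have "\<dots> = C * exp (w\<^sup>2 * (K - e * c * w))"
          by (simp add: exp_add[symmetric] algebra_simps power2_eq_square power3_eq_cube)
        also have "\<dots> \<le> C * exp (- w)"
        proof -
          have "K + 1 \<le> e * c * w" using w(4) e c by (simp add: pos_divide_le_eq mult_ac)
          then have "w\<^sup>2 * (K - e * c * w) \<le> w\<^sup>2 * (-1)" by (intro mult_left_mono) auto
          also have "\<dots> \<le> - w" using w(1) by (simp add: self_le_power)
          finally show ?thesis using C by (intro mult_left_mono) auto
        qed
        also have "\<dots> \<le> 1"
        proof -
          have "C \<le> exp w" using w(5) exp_ge_add_one_self[of w] by linarith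
          then show ?thesis by (simp add: exp_minus divide_simps)
        qed
        finally show ?thesis using B by simp
      qed
    qed
    then show ?thesis by (simp add: g_def)
  qed
  \<comment> \<open>With \<open>z0\<close> fixed, the comparison factor tends to 1 as
    \<open>e\<close> tends to 0 from the right.\<close>
  define v where "v = exp (3/4 * Ln z0)"
  have "((\<lambda>e. cmod (f z0 * exp (- complex_of_real e * v))) \<longlongrightarrow> cmod (f z0 * exp (- complex_of_real 0 * v))) (at_right 0)"
    by (intro tendsto_intros)
  moreover have "\<forall>\<^sub>F e in at_right 0. cmod (f z0 * exp (- complex_of_real e * v)) \<le> B"
    using eventually_at_right_less[of 0] by eventually_elim (use main in \<open>auto simp: v_def\<close>)
  ultimately have "cmod (f z0 * exp (- complex_of_real 0 * v)) \<le> B"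
    by (rule tendsto_upperbound) simp
  then show ?thesis by simp
qed (use disc in auto)

lemma entire_zero_if_axis_limits_zero:
  fixes f :: "complex \<Rightarrow> complex"
  assumes hol: "f holomorphic_on UNIV" and K: "K \<ge> 0" and C: "C \<ge> 0"
    and growth: "\<And>z. cmod z \<ge> R0 \<Longrightarrow> cmod (f z) \<le> C * exp (K * sqrt (cmod z))"
    and lim: "((\<lambda>t. f (\<i> * complex_of_real t)) \<longlongrightarrow> 0) at_top" "((\<lambda>t. f (- \<i> * complex_of_real t)) \<longlongrightarrow> 0) at_top"
  shows "f z = 0"
proof -
  have "\<forall>\<^sub>F t in at_top. cmod (f (\<i> * complex_of_real t)) < 1"
    "\<forall>\<^sub>F t in at_top. cmod (f (- \<i> * complex_of_real t)) < 1"
    using order_tendstoD(2)[OF tendsto_norm[OF lim(1)], of 1] order_tendstoD(2)[OF tendsto_norm[OF lim(2)], of 1]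
    by simp_all
  then obtain T1 T2 where T: "\<And>t. t \<ge> T1 \<Longrightarrow> cmod (f (\<i> * complex_of_real t)) < 1"
    "\<And>t. t \<ge> T2 \<Longrightarrow> cmod (f (- \<i> * complex_of_real t)) < 1"
    unfolding eventually_at_top_linorder by blast
  define T where "T = max 1 (max T1 T2)"
  have "compact (f ` cball 0 T)"
    by (intro compact_continuous_image holomorphic_on_imp_continuous_on holomorphic_on_subset[OF hol]) auto
  then obtain B0 where B0: "\<forall>w\<in>f ` cball 0 T. cmod w \<le> B0" using compact_imp_bounded bounded_iff by blast
  define B where "B = max 1 B0"
  have B1: "B \<ge> 1" by (simp add: B_def)
  have in_disc: "cmod (f z) \<le> B" if "cmod z \<le> T" for z
    using B0 that by (auto simp: B_def le_max_iff_disj)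
  have disc: "cmod (f z) \<le> B" if "cmod z \<le> 1" for z using in_disc that by (simp add: T_def)
  have axis: "cmod (f z) \<le> B" if "Re z = 0" for z
  proof (cases "cmod z \<le> T")
    case False
    have z: "z = \<i> * complex_of_real (Im z)" using that by (simp add: complex_eq_iff)
    have "cmod z = \<bar>Im z\<bar>" by (subst z) (simp add: norm_mult)
    then have "Im z \<ge> T1 \<or> - Im z \<ge> T2" using False by (auto simp: T_def)
    then have "cmod (f z) < 1"
    proof
      assume "T1 \<le> Im z" from T(1)[OF this] show ?thesis using z by simp
    next
      assume "T2 \<le> - Im z" from T(2)[OF this] show ?thesis using z by simp
    qed
    then show ?thesis using B1 by simp
  qed (use in_disc in auto)
  have bd: "cmod (f z) \<le> B" for z
  proof (cases "Re z \<ge> 0")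
    case True
    show ?thesis by (rule phragmen_lindelof_half_plane[OF hol K C growth B1 axis disc True])
  next
    case False
    \<comment> \<open>Reflection at 0 carries the left half-plane to the right one and preserves the
      axis, the disc and the growth bound.\<close>
    have "(f \<circ> uminus) holomorphic_on UNIV"
      by (rule holomorphic_on_compose_gen[where t = UNIV]) (use hol in \<open>auto intro: holomorphic_intros\<close>)
    then have "cmod ((f \<circ> uminus) (- z)) \<le> B"
    proof (rule phragmen_lindelof_half_plane[OF _ K C _ B1])
      show "cmod ((f \<circ> uminus) w) \<le> C * exp (K * sqrt (cmod w))" if "cmod w \<ge> R0" for w
        using growth[of "- w"] that by simp
      show "cmod ((f \<circ> uminus) w) \<le> B" if "Re w = 0" for w using axis[of "- w"] that by simp
      show "cmod ((f \<circ> uminus) w) \<le> B" if "cmod w \<le> 1" for w using disc[of "- w"] that by simp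
    qed (use False in simp)
    then show ?thesis by simp
  qed
  then have "f constant_on UNIV" using Liouville_theorem[OF hol] by (auto simp: bounded_iff)
  then obtain c where c: "\<And>z. f z = c" by (auto simp: constant_on_def)
  have "c = 0" using lim(1) unfolding c by (simp add: tendsto_const_iff)
  then show ?thesis using c by simp
qed

section \<open>The Borg-Marchenko theorem\<close>

lemma solves_family:
  assumes "locsum l q"
  obtains y y1 where "\<And>z. solves q l z (y z) (y1 z)" "\<And>z. y z l = A" "\<And>z. y1 z l = B"
proof -
  have "\<forall>z. \<exists>f. solves q l z (fst f) (snd f) \<and> fst f l = A \<and> snd f l = B"
  proof
    fix z
    obtain y y1 where "solves q l z y y1" "y l = A" "y1 l = B" using solves_exists[OF assms] .
    then show "\<exists>f. solves q l z (fst f) (snd f) \<and> fst f l = A \<and> snd f l = B"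
      by (intro exI[of _ "(y, y1)"]) simp
  qed
  then obtain f where "\<And>z. solves q l z (fst (f z)) (snd (f z)) \<and> fst (f z) l = A \<and> snd (f z) l = B" by metis
  then show ?thesis by (intro that[of "\<lambda>z. fst (f z)" "\<lambda>z. snd (f z)"]) auto
qed

text \<open>The logarithmic derivatives of the Dirichlet solution and of the Weyl solution have
  imaginary parts of opposite signs, and their difference is the reciprocal of the product.\<close>

lemma green_diag_bound:
  assumes ph: "solves q l z ph ph1" "ph l = 0" "ph1 l = 1"
    and ps: "solves q l z ps ps1" "ps l = -1" "weyl_cond l z ps ps1"
    and z: "Im z \<noteq> 0" and x: "x > l"
  shows "cmod (ps x * ph x) * \<bar>Im (ph1 x / ph x)\<bar> \<le> 1"
proof (cases "ps x = 0")
  case False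
  have p0: "ph x \<noteq> 0" using dirichlet_nonzero[OF ph(1,2) _ z x] ph(3) by simp
  have W: "ps x * ph1 x - ps1 x * ph x = -1" using wronskian_const[OF ps(1) ph(1), of x] x ph ps by simp
  define u v where "u = ph1 x / ph x" and "v = ps1 x / ps x"
  have uv: "u - v = - 1 / (ps x * ph x)"
    using p0 False W by (simp add: u_def v_def divide_simps) algebra
  have "Im v = Im (ps1 x * cnj (ps x)) / (cmod (ps x))\<^sup>2" "Im u = Im (ph1 x * cnj (ph x)) / (cmod (ph x))\<^sup>2"
    unfolding u_def v_def by (simp_all only: complex_div_cnj[of "ps1 x"] complex_div_cnj[of "ph1 x"] Im_divide_of_real flip: of_real_power)
  moreover have "sgn (Im z) * Im (ps1 x * cnj (ps x)) \<ge> 0" using ps(3) x by (simp add: weyl_cond_def)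
  moreover have "sgn (Im z) * Im (ph1 x * cnj (ph x)) \<le> 0"
    using green_im_sgn[OF ph(1), of l x] x ph by simp
  moreover have "0 \<le> s * p \<Longrightarrow> 0 \<le> s * (p / r\<^sup>2)" "s * p \<le> 0 \<Longrightarrow> s * (p / r\<^sup>2) \<le> 0" for s p r :: real
    unfolding times_divide_eq_right by (auto simp: divide_le_0_iff zero_le_divide_iff)
  ultimately have "sgn (Im z) * Im v \<ge> 0" "sgn (Im z) * Im u \<le> 0" by (simp_all only:)
  then have "\<bar>Im u\<bar> \<le> \<bar>Im (u - v)\<bar>" using z by (auto simp: sgn_if split: if_splits)
  also have "\<dots> \<le> cmod (u - v)" by (rule abs_Im_le_cmod)
  also have "\<dots> = 1 / cmod (ps x * ph x)" unfolding uv by (simp add: norm_divide)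
  finally show ?thesis using p0 False by (simp add: u_def field_simps)
qed simp

text \<open>The square roots \<open>k = (1 - \<sigma> \<i>) max(1, s)\<close> of \<open>-z\<close> for \<open>z\<close> on the imaginary axis.\<close>

definition ray :: "real \<Rightarrow> real \<Rightarrow> complex" where
  "ray \<sigma> s = Complex (max 1 s) (- \<sigma> * max 1 s)"

lemma ray_simps:
  assumes "\<sigma> = 1 \<or> \<sigma> = -1"
  shows "Re (ray \<sigma> s) = max 1 s" "ray \<sigma> s \<noteq> 0" "1 \<le> cmod (ray \<sigma> s)"
    "- (ray \<sigma> s)\<^sup>2 = complex_of_real \<sigma> * \<i> * complex_of_real (2 * (max 1 s)\<^sup>2)" "Im (- (ray \<sigma> s)\<^sup>2) \<noteq> 0"
proof -
  show r: "Re (ray \<sigma> s) = max 1 s" by (simp add: ray_def)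
  show "ray \<sigma> s \<noteq> 0" by (auto simp: ray_def complex_eq_iff)
  show "1 \<le> cmod (ray \<sigma> s)" using complex_Re_le_cmod[of "ray \<sigma> s"] r by linarith
  have e: "(Complex r (- \<sigma> * r))\<^sup>2 = - (complex_of_real \<sigma> * \<i> * complex_of_real (2 * r\<^sup>2))" for r
    using assms by (auto simp: complex_eq_iff power2_eq_square)
  show *: "- (ray \<sigma> s)\<^sup>2 = complex_of_real \<sigma> * \<i> * complex_of_real (2 * (max 1 s)\<^sup>2)"
    unfolding ray_def e by simp
  show "Im (- (ray \<sigma> s)\<^sup>2) \<noteq> 0" unfolding * using assms by auto
qed

lemma max_at_top: "LIM s at_top. max 1 s :> (at_top :: real filter)"
  by (rule filterlim_at_top_mono[OF filterlim_ident]) auto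

lemma ray_Re_at_top:
  assumes "\<sigma> = 1 \<or> \<sigma> = -1" shows "LIM s at_top. Re (ray \<sigma> s) :> at_top"
  using max_at_top ray_simps(1)[OF assms] by simp

lemma dirichlet_asymptotics:
  assumes q: "locsum l q" and x: "x > l" and \<sigma>: "\<sigma> = 1 \<or> \<sigma> = -1"
    and ph: "\<And>z. solves q l z (ph z) (ph1 z)" "\<And>z. ph z l = 0" "\<And>z. ph1 z l = 1"
  shows "((\<lambda>s. 2 * ray \<sigma> s * (exp (- ray \<sigma> s * complex_of_real (x - l)) * ph (- (ray \<sigma> s)\<^sup>2) x)) \<longlongrightarrow> 1) at_top"
    and "((\<lambda>s. 2 * (exp (- ray \<sigma> s * complex_of_real (x - l)) * ph1 (- (ray \<sigma> s)\<^sup>2) x)) \<longlongrightarrow> 1) at_top"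
  using solves_asymptotics[OF q x ph(1) ray_Re_at_top[OF \<sigma>], of "\<lambda>s. 1" 1 1] ph(2,3) by simp_all

text \<open>The logarithmic derivative of the Dirichlet solution is asymptotic to the ray itself,
  whose imaginary part grows linearly; \<open>green_diag_bound\<close> turns this into decay like
  1/s.\<close>

lemma green_diag_tendsto:
  assumes q: "locsum l q" and x: "x > l" and \<sigma>: "\<sigma> = 1 \<or> \<sigma> = -1"
    and ph: "\<And>z. solves q l z (ph z) (ph1 z)" "\<And>z. ph z l = 0" "\<And>z. ph1 z l = 1"
    and ps: "\<And>z. Im z \<noteq> 0 \<Longrightarrow> solves q l z (ps z) (ps1 z)" "\<And>z. Im z \<noteq> 0 \<Longrightarrow> ps z l = -1"
      "\<And>z. Im z \<noteq> 0 \<Longrightarrow> weyl_cond l z (ps z) (ps1 z)"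
  shows "((\<lambda>s. ps (- (ray \<sigma> s)\<^sup>2) x * ph (- (ray \<sigma> s)\<^sup>2) x) \<longlongrightarrow> 0) at_top"
proof -
  define Z where "Z = (\<lambda>s. - (ray \<sigma> s)\<^sup>2)"
  note rs = ray_simps[OF \<sigma>]
  define e where "e = (\<lambda>s. exp (- ray \<sigma> s * complex_of_real (x - l)))"
  define r where "r = (\<lambda>s. 2 * (e s * ph1 (Z s) x) / (2 * ray \<sigma> s * (e s * ph (Z s) x)))"
  have "(r \<longlongrightarrow> 1 / 1) at_top"
    unfolding r_def e_def Z_def by (intro tendsto_divide dirichlet_asymptotics[OF q x \<sigma> ph]) auto
  then have "((\<lambda>s. \<bar>Im (Complex 1 (- \<sigma>) * r s)\<bar>) \<longlongrightarrow> \<bar>Im (Complex 1 (- \<sigma>) * 1)\<bar>) at_top"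
    by (intro tendsto_intros) simp
  moreover have "\<bar>Im (Complex 1 (- \<sigma>) * 1)\<bar> > 1/2" using \<sigma> by auto
  ultimately have "\<forall>\<^sub>F s in at_top. \<bar>Im (Complex 1 (- \<sigma>) * r s)\<bar> > 1/2" by (rule order_tendstoD)
  then have bound: "\<forall>\<^sub>F s in at_top. cmod (ps (Z s) x * ph (Z s) x) \<le> 2 / max 1 s"
  proof eventually_elim
    case (elim s)
    have z: "Im (Z s) \<noteq> 0" using rs(5) by (simp add: Z_def)
    have p0: "ph (Z s) x \<noteq> 0" using dirichlet_nonzero[OF ph(1,2) _ z x] ph(3) by simp
    have "ph1 (Z s) x / ph (Z s) x = ray \<sigma> s * r s"
      using p0 rs(2)[of s] by (simp add: r_def e_def)
    moreover have "ray \<sigma> s = complex_of_real (max 1 s) * Complex 1 (- \<sigma>)" by (simp add: ray_def complex_eq_iff)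
    moreover have imr: "Im (complex_of_real t * w) = t * Im w" for t w by simp
    ultimately have "Im (ph1 (Z s) x / ph (Z s) x) = max 1 s * Im (Complex 1 (- \<sigma>) * r s)"
      by (simp only: mult.assoc imr)
    then have "\<bar>Im (ph1 (Z s) x / ph (Z s) x)\<bar> = max 1 s * \<bar>Im (Complex 1 (- \<sigma>) * r s)\<bar>"
      by (simp only: abs_mult)
    moreover have "max 1 s * (1/2) \<le> max 1 s * \<bar>Im (Complex 1 (- \<sigma>) * r s)\<bar>"
      using elim by (intro mult_left_mono) auto
    ultimately have "cmod (ps (Z s) x * ph (Z s) x) * (max 1 s * (1/2)) \<le> cmod (ps (Z s) x * ph (Z s) x) * \<bar>Im (ph1 (Z s) x / ph (Z s) x)\<bar>"
      by (intro mult_left_mono) auto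
    also have "\<dots> \<le> 1"
      by (rule green_diag_bound[OF ph(1-3) ps(1)[OF z] ps(2)[OF z] ps(3)[OF z] z x])
    finally have "cmod (ps (Z s) x * ph (Z s) x) * max 1 s \<le> 2" by simp
    then show ?case by (simp add: pos_le_divide_eq)
  qed
  have "((\<lambda>s::real. 2 / max 1 s) \<longlongrightarrow> 0) at_top"
    by (rule tendsto_divide_0[OF tendsto_const filterlim_at_top_imp_at_infinity[OF max_at_top]])
  from Lim_null_comparison[OF bound this] show ?thesis by (simp add: Z_def)
qed

lemma weyl_family:
  assumes q: "locsum l q" and d: "def11 q l"
    and ph: "\<And>z. solves q l z (ph z) (ph1 z)" "\<And>z. ph z l = 0" "\<And>z. ph1 z l = 1"
    and th: "\<And>z. solves q l z (th z) (th1 z)" "\<And>z. th z l = -1" "\<And>z. th1 z l = 0"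
    and z: "Im z \<noteq> 0"
  shows "solves q l z (\<lambda>x. th z x + m_inf q l z * ph z x) (\<lambda>x. th1 z x + m_inf q l z * ph1 z x)"
    and "th z l + m_inf q l z * ph z l = -1"
    and "weyl_cond l z (\<lambda>x. th z x + m_inf q l z * ph z x) (\<lambda>x. th1 z x + m_inf q l z * ph1 z x)"
  using solves_lincomb[OF th(1)[of z] ph(1)[of z], of 1 "m_inf q l z"]
    m_inf_weyl(1)[OF q d z ph(1-3) th(1-3)] ph(2)[of z] th(2)[of z] by simp_all

text \<open>If m^2 = -1 held throughout, m would be bounded and m / k would tend to 0. The Weyl
  solution, with data (-1, m), would then grow like -exp(k (x - l)) / 2, and its product with the
  growing Dirichlet solution could not tend to 0 as \<open>green_diag_tendsto\<close>
  demands.\<close>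

lemma m_inf_not_imaginary_unit:
  assumes q: "locsum l q" and d: "def11 q l"
  shows "\<exists>z. Im z \<noteq> 0 \<and> (m_inf q l z)\<^sup>2 \<noteq> -1"
proof (rule ccontr)
  assume "\<not> ?thesis"
  then have m2: "(m_inf q l z)\<^sup>2 = -1" if "Im z \<noteq> 0" for z using that by blast
  then have m1: "cmod (m_inf q l z) = 1" if "Im z \<noteq> 0" for z
    using that by (metis norm_minus_cancel norm_one norm_power norm_ge_zero power_eq_1_iff zero_neq_numeral abs_of_nonneg real_norm_def)
  obtain ph ph1 where ph: "\<And>z. solves q l z (ph z) (ph1 z)" "\<And>z. ph z l = 0" "\<And>z. ph1 z l = 1"
    by (rule solves_family[OF q, where A = 0 and B = 1]) blast
  obtain th th1 where th: "\<And>z. solves q l z (th z) (th1 z)" "\<And>z. th z l = -1" "\<And>z. th1 z l = 0"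
    by (rule solves_family[OF q, where A = "-1" and B = 0]) blast
  define x where "x = l + 1"
  have x: "x > l" by (simp add: x_def)
  define k where "k = ray 1"
  define Z where "Z = (\<lambda>s. - (k s)\<^sup>2)"
  have one: "(1::real) = 1 \<or> (1::real) = -1" by simp
  note rs = ray_simps[OF one, folded k_def, folded Z_def]
  define ps where "ps = (\<lambda>z x. th z x + m_inf q l z * ph z x)"
  define ps1 where "ps1 = (\<lambda>z x. th1 z x + m_inf q l z * ph1 z x)"
  have wf: "solves q l z (ps z) (ps1 z)" "ps z l = -1" "weyl_cond l z (ps z) (ps1 z)" if "Im z \<noteq> 0" for z
    using weyl_family[OF q d ph th that] unfolding ps_def ps1_def by blast+
  have zi: "Im (Z s) \<noteq> 0" for s using rs(5) by (simp add: Z_def)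
  have p1l: "ps1 (Z s) l = m_inf q l (Z s)" for s by (simp add: ps1_def ph th)
  define e where "e = (\<lambda>s. exp (- k s * complex_of_real (x - l)))"
  have A: "((\<lambda>s. 2 * k s * (e s * ph (Z s) x)) \<longlongrightarrow> 1) at_top"
    unfolding e_def Z_def k_def by (rule dirichlet_asymptotics(1)[OF q x one ph])
  have kinf: "filterlim k at_infinity at_top"
    unfolding filterlim_at_infinity[OF order_refl]
  proof (intro allI impI)
    fix r :: real assume "r > 0"
    show "\<forall>\<^sub>F s in at_top. r \<le> norm (k s)"
      using eventually_ge_at_top[of r]
    proof eventually_elim
      case (elim s)
      then show ?case using complex_Re_le_cmod[of "k s"] rs(1)[of s] by linarith
    qed
  qed
  have B: "((\<lambda>s. 2 * k s * (exp (- k s * complex_of_real (x - l)) * ps (Z s) x) / k s) \<longlongrightarrow> -1) at_top"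
  proof (rule solves_asymptotics(1)[OF q x])
    show "solves q l (- (k s)\<^sup>2) (ps (Z s)) (ps1 (Z s))" for s
      using wf(1)[OF zi[of s]] unfolding Z_def .
    show "LIM s at_top. Re (k s) :> at_top" unfolding k_def by (rule ray_Re_at_top[OF one])
    show "k s \<noteq> 0" for s by (rule rs(2))
    have "((\<lambda>s. m_inf q l (Z s) / k s) \<longlongrightarrow> 0) at_top"
    proof (rule Lim_null_comparison)
      show "\<forall>\<^sub>F s in at_top. cmod (m_inf q l (Z s) / k s) \<le> 1 / max 1 s"
      proof (rule always_eventually, rule allI)
        fix s
        show "cmod (m_inf q l (Z s) / k s) \<le> 1 / max 1 s"
          using complex_Re_le_cmod[of "k s"] rs(1)[of s] m1[OF zi] by (simp add: norm_divide frac_le)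
      qed
      show "((\<lambda>s::real. 1 / max 1 s) \<longlongrightarrow> 0) at_top"
        by (rule tendsto_divide_0[OF tendsto_const filterlim_at_top_imp_at_infinity[OF max_at_top]])
    qed
    then have "((\<lambda>s. m_inf q l (Z s) / k s - 1) \<longlongrightarrow> 0 - 1) at_top" by (intro tendsto_intros)
    moreover have "m_inf q l (Z s) / k s - 1 = (ps1 (Z s) l + k s * ps (Z s) l) / k s" for s
      using rs(2)[of s] wf(2)[OF zi[of s]] p1l[of s] by (simp add: diff_divide_distrib)
    ultimately show "((\<lambda>s. (ps1 (Z s) l + k s * ps (Z s) l) / k s) \<longlongrightarrow> - 1) at_top" by simp
    show "cmod (ps1 (Z s) l - k s * ps (Z s) l) \<le> 2 * cmod (k s)" for s
    proof -
      have "ps (Z s) l = -1" by (rule wf(2)[OF zi])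
      then have "cmod (ps1 (Z s) l - k s * ps (Z s) l) \<le> cmod (m_inf q l (Z s)) + cmod (k s)"
        using norm_triangle_ineq[of "m_inf q l (Z s)" "k s"] by (simp add: p1l)
      then show ?thesis using m1[OF zi] rs(3)[of s] by simp
    qed
  qed
  have AB: "((\<lambda>s. (2 * k s * (e s * ph (Z s) x)) * (2 * k s * (e s * ps (Z s) x) / k s)) \<longlongrightarrow> 1 * -1) at_top"
    using tendsto_mult[OF A B] by (simp add: e_def)
  have eq: "(2 * k s * (e s * ph (Z s) x)) * (2 * k s * (e s * ps (Z s) x) / k s)
       = 4 * (k s * (e s)\<^sup>2) * (ps (Z s) x * ph (Z s) x)" for s
    using rs(2)[of s] by (simp add: power2_eq_square)
  have P0: "((\<lambda>s. ps (Z s) x * ph (Z s) x) \<longlongrightarrow> 0) at_top"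
    unfolding Z_def k_def
    by (rule green_diag_tendsto[OF q x one ph wf])
  have "((\<lambda>s. 4 * (k s * (e s)\<^sup>2) * (ps (Z s) x * ph (Z s) x)) \<longlongrightarrow> 0) at_top"
  proof (rule Lim_null_comparison)
    show "\<forall>\<^sub>F s in at_top. cmod (4 * (k s * (e s)\<^sup>2) * (ps (Z s) x * ph (Z s) x)) \<le> 4 * cmod (ps (Z s) x * ph (Z s) x)"
    proof (rule always_eventually, rule allI)
      fix s :: real
      define r where "r = max 1 s"
      \<comment> \<open>The choice x = l + 1 makes the modulus of (e s)^2 equal to exp(-2 r), which
        outweighs \<open>cmod (k s)\<close>; so the rescaled product still tends to 0.\<close>
      have "cmod (k s) \<le> \<bar>Re (k s)\<bar> + \<bar>Im (k s)\<bar>" by (rule cmod_le)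
      also have "\<dots> = 2 * r" by (simp add: k_def ray_def r_def)
      also have "\<dots> \<le> exp (2 * r)" using exp_ge_add_one_self[of "2 * r"] by linarith
      finally have "cmod (k s) * exp (- (2 * r)) \<le> exp (2 * r) * exp (- (2 * r))" by (intro mult_right_mono) auto
      moreover have "cmod ((e s)\<^sup>2) = exp (- (2 * r))"
        using rs(1)[of s] by (simp add: e_def norm_power norm_exp_eq_Re x_def r_def power2_eq_square flip: exp_add)
      ultimately have "cmod (k s * (e s)\<^sup>2) \<le> 1" by (simp add: norm_mult flip: exp_add)
      then have "cmod (k s * (e s)\<^sup>2) * cmod (ps (Z s) x * ph (Z s) x) \<le> 1 * cmod (ps (Z s) x * ph (Z s) x)"
        by (intro mult_right_mono) auto
      then show "cmod (4 * (k s * (e s)\<^sup>2) * (ps (Z s) x * ph (Z s) x)) \<le> 4 * cmod (ps (Z s) x * ph (Z s) x)"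
        by (simp add: norm_mult)
    qed
    show "((\<lambda>s. 4 * cmod (ps (Z s) x * ph (Z s) x)) \<longlongrightarrow> 0) at_top"
      by (rule tendsto_mult_right_zero[OF tendsto_norm_zero[OF P0]])
  qed
  with AB[unfolded eq] have "(1 * -1 :: complex) = 0" by (rule tendsto_unique[rotated]) simp
  then show False by simp
qed

lemma cross_wronskian_zero:
  assumes q: "locsum l q1" "locsum l q2" and d: "def11 q1 l" "def11 q2 l"
    and m: "\<And>z. Im z \<noteq> 0 \<Longrightarrow> m_inf q1 l z = m_inf q2 l z"
    and ph: "\<And>z. solves q1 l z (ph z) (ph1 z)" "\<And>z. ph z l = 0" "\<And>z. ph1 z l = 1"
    and th: "\<And>z. solves q1 l z (th z) (th1 z)" "\<And>z. th z l = -1" "\<And>z. th1 z l = 0"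
    and ph': "\<And>z. solves q2 l z (ph' z) (ph1' z)" "\<And>z. ph' z l = 0" "\<And>z. ph1' z l = 1"
    and th': "\<And>z. solves q2 l z (th' z) (th1' z)" "\<And>z. th' z l = -1" "\<And>z. th1' z l = 0"
    and x: "x > l"
  shows "th z x * ph' z x = ph z x * th' z x"
proof -
  define D where "D = (\<lambda>z. th z x * ph' z x - ph z x * th' z x)"
  have xl: "x \<ge> l" using x by simp
  have hol: "D holomorphic_on UNIV" unfolding D_def
    by (intro holomorphic_intros solves_holomorphic[OF q(1) ph xl] solves_holomorphic[OF q(1) th xl]
        solves_holomorphic[OF q(2) ph' xl] solves_holomorphic[OF q(2) th' xl])
  define E where "E = (\<lambda>z. exp ((x - l) * sqrt (cmod z)))"
  have gr: "\<exists>R C. C \<ge> 0 \<and> (\<forall>z. cmod z \<ge> R \<longrightarrow> cmod (y z x) \<le> C * E z)"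
    if q: "locsum l q" and y: "\<And>z. solves q l z (y z) (y1 z)" "\<And>z. y z l = A" "\<And>z. y1 z l = B" for q y y1 A B
  proof -
    obtain R C where "\<And>z. cmod z \<ge> R \<Longrightarrow> cmod (y z x) \<le> C * E z"
      using solves_growth[OF q xl, of A B] y unfolding E_def by metis
    moreover have "C * E z \<le> max 0 C * E z" for z by (intro mult_right_mono) (auto simp: E_def)
    ultimately have "\<And>z. cmod z \<ge> R \<Longrightarrow> cmod (y z x) \<le> max 0 C * E z" by (meson order_trans)
    then show ?thesis by (intro exI[of _ R] exI[of _ "max 0 C"]) auto
  qed
  obtain R1 C1 where 1: "C1 \<ge> 0" "\<And>z. cmod z \<ge> R1 \<Longrightarrow> cmod (th z x) \<le> C1 * E z" using gr[OF q(1) th] by blast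
  obtain R2 C2 where 2: "C2 \<ge> 0" "\<And>z. cmod z \<ge> R2 \<Longrightarrow> cmod (ph z x) \<le> C2 * E z" using gr[OF q(1) ph] by blast
  obtain R3 C3 where 3: "C3 \<ge> 0" "\<And>z. cmod z \<ge> R3 \<Longrightarrow> cmod (th' z x) \<le> C3 * E z" using gr[OF q(2) th'] by blast
  obtain R4 C4 where 4: "C4 \<ge> 0" "\<And>z. cmod z \<ge> R4 \<Longrightarrow> cmod (ph' z x) \<le> C4 * E z" using gr[OF q(2) ph'] by blast
  define R where "R = max (max R1 R2) (max R3 R4)"
  have growth: "cmod (D z) \<le> (C1 * C4 + C2 * C3) * exp ((2 * (x - l)) * sqrt (cmod z))" if "cmod z \<ge> R" for z
  proof -
    have "cmod (D z) \<le> cmod (th z x) * cmod (ph' z x) + cmod (ph z x) * cmod (th' z x)"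
      unfolding D_def norm_mult[symmetric] by (rule norm_triangle_ineq4)
    also have "\<dots> \<le> (C1 * E z) * (C4 * E z) + (C2 * E z) * (C3 * E z)"
      using that by (intro add_mono mult_mono 1 2 3 4 mult_nonneg_nonneg) (auto simp: R_def E_def)
    also have "\<dots> = (C1 * C4 + C2 * C3) * (E z * E z)" by (simp add: algebra_simps)
    also have "E z * E z = exp ((2 * (x - l)) * sqrt (cmod z))" by (simp add: E_def algebra_simps flip: exp_add)
    finally show ?thesis .
  qed
  define ps where "ps = (\<lambda>z x. th z x + m_inf q1 l z * ph z x)"
  define ps' where "ps' = (\<lambda>z x. th' z x + m_inf q2 l z * ph' z x)"
  have lim: "((\<lambda>s. D (- (ray \<sigma> s)\<^sup>2)) \<longlongrightarrow> 0) at_top" if \<sigma>: "\<sigma> = 1 \<or> \<sigma> = -1" for \<sigma>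
  proof -
    define Z where "Z = (\<lambda>s. - (ray \<sigma> s)\<^sup>2)"
    have zi: "Im (Z s) \<noteq> 0" for s using ray_simps(5)[OF \<sigma>] by (simp add: Z_def)
    define e where "e = (\<lambda>s. exp (- ray \<sigma> s * complex_of_real (x - l)))"
    define u where "u = (\<lambda>s. 2 * ray \<sigma> s * (e s * ph (Z s) x))"
    define u' where "u' = (\<lambda>s. 2 * ray \<sigma> s * (e s * ph' (Z s) x))"
    have u: "(u \<longlongrightarrow> 1) at_top" unfolding u_def e_def Z_def by (rule dirichlet_asymptotics(1)[OF q(1) x \<sigma> ph])
    have u': "(u' \<longlongrightarrow> 1) at_top" unfolding u'_def e_def Z_def by (rule dirichlet_asymptotics(1)[OF q(2) x \<sigma> ph'])
    have g: "((\<lambda>s. ps (Z s) x * ph (Z s) x) \<longlongrightarrow> 0) at_top"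
      unfolding Z_def ps_def
      by (rule green_diag_tendsto[OF q(1) x \<sigma> ph weyl_family[OF q(1) d(1) ph th]])
    have g': "((\<lambda>s. ps' (Z s) x * ph' (Z s) x) \<longlongrightarrow> 0) at_top"
      unfolding Z_def ps'_def
      by (rule green_diag_tendsto[OF q(2) x \<sigma> ph' weyl_family[OF q(2) d(2) ph' th']])
    \<comment> \<open>Each mixed product of a Weyl and a Dirichlet solution is a diagonal Green
      function times a ratio of Dirichlet solutions; in the ratio the exponentials cancel, so its
      limit is 1.\<close>
    have "((\<lambda>s. (ps (Z s) x * ph (Z s) x) * (u' s / u s) - (ps' (Z s) x * ph' (Z s) x) * (u s / u' s))
        \<longlongrightarrow> 0 * (1/1) - 0 * (1/1)) at_top"
      by (intro tendsto_diff tendsto_mult tendsto_divide u u' g g') auto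
    moreover have "(ps (Z s) x * ph (Z s) x) * (u' s / u s) - (ps' (Z s) x * ph' (Z s) x) * (u s / u' s) = D (Z s)" for s
    proof -
      have n: "ph (Z s) x \<noteq> 0" "ph' (Z s) x \<noteq> 0"
        using dirichlet_nonzero[OF ph(1,2) _ zi x] dirichlet_nonzero[OF ph'(1,2) _ zi x] ph(3) ph'(3) by auto
      have "u' s / u s = ph' (Z s) x / ph (Z s) x" "u s / u' s = ph (Z s) x / ph' (Z s) x"
        using ray_simps(2)[OF \<sigma>, of s] by (simp_all add: u_def u'_def e_def)
      then have "(ps (Z s) x * ph (Z s) x) * (u' s / u s) - (ps' (Z s) x * ph' (Z s) x) * (u s / u' s)
        = ps (Z s) x * ph' (Z s) x - ps' (Z s) x * ph (Z s) x" using n by simp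
      \<comment> \<open>The equality of the Weyl functions enters this argument here: the terms
        containing them cancel, which leaves an expression entire in \<open>z\<close>.\<close>
      also have "\<dots> = D (Z s)" using m[OF zi[of s]] by (simp add: D_def ps_def ps'_def algebra_simps)
      finally show ?thesis .
    qed
    ultimately show ?thesis by (simp add: Z_def)
  qed
  have lim2: "((\<lambda>t. D (complex_of_real \<sigma> * \<i> * complex_of_real t)) \<longlongrightarrow> 0) at_top" if \<sigma>: "\<sigma> = 1 \<or> \<sigma> = -1" for \<sigma>
  proof -
    \<comment> \<open>For s >= 1 the spectral parameter on the ray is \<sigma> \<i> 2 s^2, so the
      point at height t on the axis belongs to s = sqrt (t / 2), from t = 2 on.\<close>
    have "LIM t at_top. sqrt (t / 2) :> at_top"
    proof (rule filterlim_compose[OF sqrt_at_top])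
      have "LIM t at_top. (1/2) * t :> (at_top :: real filter)"
        by (rule filterlim_tendsto_pos_mult_at_top[OF tendsto_const _ filterlim_ident]) simp
      then show "LIM t at_top. t / 2 :> (at_top :: real filter)" by simp
    qed
    from filterlim_compose[OF lim[OF \<sigma>] this]
    have "((\<lambda>t. D (- (ray \<sigma> (sqrt (t / 2)))\<^sup>2)) \<longlongrightarrow> 0) at_top" .
    moreover have "\<forall>\<^sub>F t in at_top. D (- (ray \<sigma> (sqrt (t / 2)))\<^sup>2) = D (complex_of_real \<sigma> * \<i> * complex_of_real t)"
      using eventually_ge_at_top[of 2]
    proof eventually_elim
      case (elim t)
      have "1 \<le> sqrt (t / 2)" using elim by (intro real_le_rsqrt) auto
      then have "2 * (max 1 (sqrt (t / 2)))\<^sup>2 = t" using elim by (simp add: max_absorb2)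
      then show ?case unfolding ray_simps(4)[OF \<sigma>] by simp
    qed
    ultimately show ?thesis by (rule Lim_transform_eventually)
  qed
  have "D z = 0"
    by (rule entire_zero_if_axis_limits_zero[OF hol _ _ growth])
      (use x 1 2 3 4 lim2[of 1] lim2[of "-1"] in simp_all)
  then show ?thesis by (simp add: D_def)
qed

lemma ac_zero_fun:
  fixes f f' :: "real \<Rightarrow> complex"
  assumes f: "ac l f f'" and z: "\<And>x. x \<ge> l \<Longrightarrow> f x = 0"
  shows "AE x in lborel. x \<ge> l \<longrightarrow> f' x = 0"
    and "continuous_on {l..} f' \<Longrightarrow> x \<ge> l \<Longrightarrow> f' x = 0"
proof -
  have a0: "ac l f (\<lambda>x. 0)" by (rule ac_cong[OF ac_const[of l 0]]) (auto simp: z)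
  show "AE x in lborel. x \<ge> l \<longrightarrow> f' x = 0" by (rule ac_AE_unique[OF f a0])
  assume "continuous_on {l..} f'" "x \<ge> l"
  then show "f' x = 0" using ac_dl[OF f] ac_dl[OF a0] by fastforce
qed

theorem borg_marchenko:
  assumes q: "locsum l q1" "locsum l q2" and d: "def11 q1 l" "def11 q2 l"
    and m: "\<And>z. Im z \<noteq> 0 \<Longrightarrow> m_inf q1 l z = m_inf q2 l z"
  shows "AE x in lborel. x \<ge> l \<longrightarrow> q1 x = q2 x"
proof -
  obtain ph ph1 where ph: "\<And>z. solves q1 l z (ph z) (ph1 z)" "\<And>z. ph z l = 0" "\<And>z. ph1 z l = 1"
    by (rule solves_family[OF q(1), where A = 0 and B = 1]) blast
  obtain th th1 where th: "\<And>z. solves q1 l z (th z) (th1 z)" "\<And>z. th z l = -1" "\<And>z. th1 z l = 0"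
    by (rule solves_family[OF q(1), where A = "-1" and B = 0]) blast
  obtain ph' ph1' where ph': "\<And>z. solves q2 l z (ph' z) (ph1' z)" "\<And>z. ph' z l = 0" "\<And>z. ph1' z l = 1"
    by (rule solves_family[OF q(2), where A = 0 and B = 1]) blast
  obtain th' th1' where th': "\<And>z. solves q2 l z (th' z) (th1' z)" "\<And>z. th' z l = -1" "\<And>z. th1' z l = 0"
    by (rule solves_family[OF q(2), where A = "-1" and B = 0]) blast
  \<comment> \<open>From here on one nonreal spectral parameter is enough; at \<i> the Dirichlet
    solutions have no zeros beyond \<open>l\<close>.\<close>
  define a a1 b b1 c c1 e e1 where "a = th \<i>" and "a1 = th1 \<i>" and "b = ph \<i>" and "b1 = ph1 \<i>"
    and "c = th' \<i>" and "c1 = th1' \<i>" and "e = ph' \<i>" and "e1 = ph1' \<i>"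
  note defs = a_def a1_def b_def b1_def c_def c1_def e_def e1_def
  have s: "solves q1 l \<i> a a1" "solves q1 l \<i> b b1" "solves q2 l \<i> c c1" "solves q2 l \<i> e e1"
    unfolding defs by (rule th ph th' ph')+
  note ct = solves_continuous[OF s(1)] solves_continuous[OF s(2)] solves_continuous[OF s(3)] solves_continuous[OF s(4)]
  have i: "a l = -1" "a1 l = 0" "b l = 0" "b1 l = 1" "c l = -1" "c1 l = 0" "e l = 0" "e1 l = 1"
    unfolding defs by (rule th ph th' ph')+
  have ae: "a x * e x - b x * c x = 0" if "x \<ge> l" for x
  proof (cases "x = l")
    case False
    then show ?thesis using cross_wronskian_zero[OF q d m ph th ph' th', of x \<i>] that by (simp add: defs)
  qed (simp add: i)
  have der: "a1 x * e x + a x * e1 x - (b1 x * c x + b x * c1 x) = 0" if "x \<ge> l" for x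
    by (rule ac_zero_fun(2)[OF ac_diff_fun[OF ac_mult[OF solvesD(1)[OF s(1)] solvesD(1)[OF s(4)]]
            ac_mult[OF solvesD(1)[OF s(2)] solvesD(1)[OF s(3)]]] ae _ that], assumption)
      (intro continuous_intros ct)
  \<comment> \<open>In terms of quotients: th/ph has derivative 1/ph^2 because the Wronskian is
    constant, and the quotients for the two potentials agree. The polynomial form avoids division,
    so it covers x = l as well.\<close>
  have sq: "b x * b x - e x * e x = 0" if "x \<ge> l" for x
  proof -
    have "a x * b1 x - a1 x * b x = -1" "c x * e1 x - c1 x * e x = -1"
      using wronskian_const[OF s(1,2) that] wronskian_const[OF s(3,4) that] by (simp_all add: i)
    then show ?thesis using ae[OF that] der[OF that] by algebra
  qed
  have "b1 x * b x + b x * b1 x - (e1 x * e x + e x * e1 x) = 0" if "x \<ge> l" for x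
    by (rule ac_zero_fun(2)[OF ac_diff_fun[OF ac_mult[OF solvesD(1)[OF s(2)] solvesD(1)[OF s(2)]]
            ac_mult[OF solvesD(1)[OF s(4)] solvesD(1)[OF s(4)]]] sq _ that], assumption)
      (intro continuous_intros ct)
  then have sq1: "b x * b1 x - e x * e1 x = 0" if "x \<ge> l" for x
    using that by (simp add: algebra_simps flip: mult_2)
  \<comment> \<open>This differentiation brings in the second derivatives and with them the
    potentials, so it holds only almost everywhere.\<close>
  have "AE x in lborel. x \<ge> l \<longrightarrow> (b1 x * b1 x + b x * ((complex_of_real (q1 x) - \<i>) * b x))
     - (e1 x * e1 x + e x * ((complex_of_real (q2 x) - \<i>) * e x)) = 0"
    by (rule ac_zero_fun(1)[OF ac_diff_fun[OF ac_mult[OF solvesD[OF s(2)]] ac_mult[OF solvesD[OF s(4)]]] sq1])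
  moreover have "AE x in lborel. x \<noteq> l" by (rule AE_lborel_singleton)
  ultimately show ?thesis
  proof eventually_elim
    case (elim x)
    show ?case
    proof
      assume xl: "x \<ge> l"
      then have "b x \<noteq> 0" using dirichlet_nonzero[OF s(2) i(3), of x] i(4) elim by simp
      \<comment> \<open>Multiplication by b^2 = e^2 turns the terms b1^2 and e1^2 into the squares
        of b b1 and e e1, which agree by \<open>sq1\<close>; only the difference of the potentials
        is left.\<close>
      moreover have "(complex_of_real (q1 x) - q2 x) * (b x * b x) * (b x * b x) = 0"
        using elim(1) xl sq[OF xl] sq1[OF xl] by algebra
      ultimately show "q1 x = q2 x" by simp
    qed
  qed
qed

section \<open>Equality of the L-systems\<close>

lemma l2ip_cong_AE:
  assumes "sqint l f" "sqint l g" "sqint l f'" "sqint l g'"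
    and e: "AE x in lborel. x \<ge> l \<longrightarrow> f x = f' x" "AE x in lborel. x \<ge> l \<longrightarrow> g x = g' x"
  shows "l2ip l f g = l2ip l f' g'"
  unfolding l2ip_def set_lebesgue_integral_def
proof (rule integral_cong_AE)
  show "AE x in lborel. indicat_real {l..} x *\<^sub>R (f x * cnj (g x)) = indicat_real {l..} x *\<^sub>R (f' x * cnj (g' x))"
    using e by eventually_elim (auto split: split_indicator)
qed (use sqint_mult_integrable[OF assms(1) sqint_cnj[OF assms(2)]]
    sqint_mult_integrable[OF assms(3) sqint_cnj[OF assms(4)]] in \<open>auto simp: set_integrable_def\<close>)

text \<open>The potential enters only through \<open>lq\<close>, inside integrals and square
  integrability, and the chosen \<open>sec l y\<close> does not depend on it. Null sets are
  invisible there once \<open>lq\<close> is known to be measurable for the other potential too,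
  which \<open>lq_measurable\<close> provides.\<close>

lemma schr_lsys_AE_cong:
  assumes q: "locsum l q1" "locsum l q2" and e: "AE x in lborel. x \<ge> l \<longrightarrow> q1 x = q2 x"
  shows "lsys_eq (schr_lsys q1 l mu h) (schr_lsys q2 l mu h)"
proof -
  have le: "AE x in lborel. x \<ge> l \<longrightarrow> lq q1 l y x = lq q2 l y x" for y
    using e by eventually_elim (simp add: lq_def)
  have sub: "Hplus q l \<subseteq> Hplus q' l"
    if q': "locsum l q'" and e: "\<And>y. AE x in lborel. x \<ge> l \<longrightarrow> lq q l y x = lq q' l y x" for q q'
  proof
    fix y assume y: "y \<in> Hplus q l"
    have "sqint l (lq q' l y)"
      by (rule sqint_AE_cong[OF HplusD(4)[OF y] e lq_measurable[OF q' HplusD(1,2)[OF y]]])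
    then show "y \<in> Hplus q' l" using y unfolding Hplus_def by blast
  qed
  have "AE x in lborel. x \<ge> l \<longrightarrow> lq q2 l y x = lq q1 l y x" for y
    using le[of y] by eventually_elim simp
  then have H: "Hplus q1 l = Hplus q2 l" using sub[OF q(2) le] sub[OF q(1)] by blast
  have ip: "l2ip l w (lq q1 l y) = l2ip l w (lq q2 l y)" "l2ip l (lq q1 l w) (lq q1 l y) = l2ip l (lq q2 l w) (lq q2 l y)"
    if "y \<in> Hplus q1 l" "w \<in> Hplus q1 l" for y w
    using HplusD[OF that(1)] HplusD[OF that(2)] HplusD(4)[of y q2 l] HplusD(4)[of w q2 l] that le
    unfolding H by (auto intro!: l2ip_cong_AE)
  show ?thesis
    unfolding lsys_eq_def schr_lsys_def
    using H ip by (auto simp: plus_ip_q_def schr_stateop_def split: option.split)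
qed

theorem theorem15:
  fixes q1 q2 :: "real \<Rightarrow> real" and l a1 a2 :: real
  assumes "l \<ge> 0"
    and "locsum l q1" and "locsum l q2"
    and "def11 q1 l" and "def11 q2 l"
    and "\<forall>z. Im z \<noteq> 0 \<longrightarrow> m_inf q1 l z = m_inf q2 l z"
    and "\<forall>z. Im z \<noteq> 0 \<longrightarrow>
           impedance (schr_lsys q1 l (mu_of a1) \<i>) z = impedance (schr_lsys q2 l (mu_of a2) \<i>) z"
  shows "lsys_eq (schr_lsys q1 l (mu_of a1) \<i>) (schr_lsys q2 l (mu_of a2) \<i>)"
proof -
  obtain z where z: "Im z \<noteq> 0" "(m_inf q1 l z)\<^sup>2 \<noteq> -1"
    using m_inf_not_imaginary_unit[OF assms(2,4)] by blast
  have "impedance_value (mu_of a1) (m_inf q1 l z) = impedance_value (mu_of a2) (m_inf q1 l z)"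
    using assms(6,7) z(1) impedance_schr[OF assms(2,4) z(1), of "mu_of a1"]
      impedance_schr[OF assms(3,5) z(1), of "mu_of a2"] by metis
  \<comment> \<open>The angles themselves need not agree, as the tangent has period pi; the L-system
    depends on them only through \<open>mu_of\<close>. One point with m^2 different from -1 suffices
    because the parameters do not depend on \<open>z\<close>.\<close>
  then have "mu_of a1 = mu_of a2"
    by (rule impedance_value_inj[OF m_inf_nonreal[OF assms(2,4) z(1)] z(2)])
  moreover have "AE x in lborel. x \<ge> l \<longrightarrow> q1 x = q2 x"
    by (rule borg_marchenko[OF assms(2-5)]) (use assms(6) in blast)
  ultimately show ?thesis using schr_lsys_AE_cong[OF assms(2,3)] by simp
qed

end
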